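(* Let $(G,g)$ be a Lie group equipped with a left-invariant semi-Riemannian metric $g$, and let $K$ be a semisimple Lie subgroup of $G$, of codimension two, generating a left-invariant conformal foliation $\mathcal{F}$ on $G$. If $K$ is compact and the metric induced by $g$ on $K$ is a biinvariant Riemannian metric, then the foliation $\mathcal{F}$ is totally geodesic.
   Context: A Lie group is semisimple if its Lie algebra is semisimple. Let $\mathfrak{g}$ and $\mathfrak{k}$ be the Lie algebras of $G$ and $K$. A metric on $K$ is biinvariant if it is invariant under both left and right translations of $K$. The foliation $\mathcal{F}$ generated by $K$ is the foliation tangent to the left-invariant integrable distribution $\mathcal{V}$ on $G$ obtained by left-translating $\mathfrak{k}\subset\mathfrak{g}$. Let $\mathcal{H}$ be the orthogonal complementary distribution of $\mathcal{V}$ with respect to $g$ (it has rank two); the symbols $\mathcal{V},\mathcal{H}$ also denote the orthogonal projections of $TG$ onto these subbundles. Let $\nabla$ be the Levi-Civita connection of $g$. The second fundamental forms are $$B^{\mathcal{V}}(V,W)=\tfrac12\,\mathcal{H}(\nabla_V W+\nabla_W V)\ \ (V,W\in\mathcal{V}),\qquad B^{\mathcal{H}}(X,Y)=\tfrac12\,\mathcal{V}(\nabla_X Y+\nabla_Y X)\ \ (X,Y\in\mathcal{H}).$$ The foliation $\mathcal{F}$ is conformal if there is a vector field $V\in\mathcal{V}$ such that $B^{\mathcal{H}}(X,Y)=g(X,Y)\,V$ for all $X,Y\in\mathcal{H}$. It is totally geodesic if $B^{\mathcal{V}}=0$. *)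

theory Defs
  imports "HOL-Analysis.Analysis" "HOL-Algebra.Group"
begin

section \<open>Smooth maps between open subsets of finite-dimensional normed spaces\<close>

text \<open>
  Class \<open>C\<^sup>n\<close>, by recursion on directional derivatives. On an open subset of a
  finite-dimensional space (the only use made of it below) this is the usual notion.
\<close>

primrec C_on :: "nat \<Rightarrow> 'e set \<Rightarrow> ('e::real_normed_vector \<Rightarrow> 'f::real_normed_vector) \<Rightarrow> bool" where
  "C_on 0 S f \<longleftrightarrow> continuous_on S f"
| "C_on (Suc n) S f \<longleftrightarrow>
     (\<forall>x\<in>S. f differentiable (at x)) \<and> (\<forall>v. C_on n S (\<lambda>x. frechet_derivative f (at x) v))"

definition smooth_on :: "'e set \<Rightarrow> ('e::real_normed_vector \<Rightarrow> 'f::real_normed_vector) \<Rightarrow> bool" where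
  "smooth_on S f \<longleftrightarrow> (\<forall>n. C_on n S f)"

section \<open>Smooth manifolds\<close>

text \<open>
  A chart is a pair of its domain and its coordinate map; the coordinate map is irrelevant outside
  the domain. A manifold is given by an atlas, which determines the underlying set and the topology.
\<close>

type_synonym ('a, 'e) chart = "'a set \<times> ('a \<Rightarrow> 'e)"

definition chart_inv :: "('a, 'e) chart \<Rightarrow> 'e \<Rightarrow> 'a" where
  "chart_inv c = inv_into (fst c) (snd c)"

definition mcarrier :: "('a, 'e) chart set \<Rightarrow> 'a set" where
  "mcarrier A = (\<Union>c\<in>A. fst c)"

definition manifold_topology :: "('a, 'e::real_normed_vector) chart set \<Rightarrow> 'a topology" where
  "manifold_topology A = topology_generated_by {{p \<in> fst c. snd c p \<in> S} | c S. c \<in> A \<and> open S}"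

text \<open>
  The model space is an arbitrary finite-dimensional normed space and not of class
  \<open>euclidean_space\<close>, because that class excludes dimension zero.
\<close>

definition smooth_manifold :: "('a, 'e::real_normed_vector) chart set \<Rightarrow> bool" where
  "smooth_manifold A \<longleftrightarrow>
     (\<exists>b::'e set. finite b \<and> span b = UNIV) \<and>
     (\<forall>c\<in>A. inj_on (snd c) (fst c) \<and> open (snd c ` fst c)) \<and>
     (\<forall>c\<in>A. \<forall>d\<in>A. open (snd c ` (fst c \<inter> fst d)) \<and>
        smooth_on (snd c ` (fst c \<inter> fst d)) (snd d \<circ> chart_inv c)) \<and>
     Hausdorff_space (manifold_topology A) \<and> second_countable (manifold_topology A)"

definition smooth_map ::
  "('a, 'e::real_normed_vector) chart set \<Rightarrow> ('b, 'f::real_normed_vector) chart set \<Rightarrow> ('a \<Rightarrow> 'b) \<Rightarrow> bool" where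
  "smooth_map A B F \<longleftrightarrow>
     F ` mcarrier A \<subseteq> mcarrier B \<and>
     (\<forall>c\<in>A. \<forall>d\<in>B. open (snd c ` {p \<in> fst c. F p \<in> fst d}) \<and>
        smooth_on (snd c ` {p \<in> fst c. F p \<in> fst d}) (snd d \<circ> F \<circ> chart_inv c))"

definition smooth_function :: "('a, 'e::real_normed_vector) chart set \<Rightarrow> ('a \<Rightarrow> real) \<Rightarrow> bool" where
  "smooth_function A f \<longleftrightarrow> (\<forall>c\<in>A. smooth_on (snd c ` fst c) (f \<circ> chart_inv c))"

definition prod_atlas ::
  "('a, 'e) chart set \<Rightarrow> ('b, 'f) chart set \<Rightarrow> ('a \<times> 'b, 'e \<times> 'f) chart set" where
  "prod_atlas A B = {(fst c \<times> fst d, map_prod (snd c) (snd d)) | c d. c \<in> A \<and> d \<in> B}"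

section \<open>Tangent vectors and vector fields\<close>

text \<open>
  A tangent vector at \<open>p\<close> is represented by its coordinate vector in the preferred chart
  \<open>chart_at A p\<close>, so that every tangent space is the model space \<open>'e\<close>. Coordinates in another
  chart are obtained by the derivative of the change of charts.
\<close>

definition chart_at :: "('a, 'e) chart set \<Rightarrow> 'a \<Rightarrow> ('a, 'e) chart" where
  "chart_at A p = (SOME c. c \<in> A \<and> p \<in> fst c)"

definition tangent_map ::
  "('a, 'e::real_normed_vector) chart set \<Rightarrow> ('b, 'f::real_normed_vector) chart set
    \<Rightarrow> ('a \<Rightarrow> 'b) \<Rightarrow> 'a \<Rightarrow> 'e \<Rightarrow> 'f" where
  "tangent_map A B F p =
     frechet_derivative (snd (chart_at B (F p)) \<circ> F \<circ> chart_inv (chart_at A p))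
       (at (snd (chart_at A p) p))"

definition directional_derivative ::
  "('a, 'e::real_normed_vector) chart set \<Rightarrow> ('a \<Rightarrow> real) \<Rightarrow> 'a \<Rightarrow> 'e \<Rightarrow> real" where
  "directional_derivative A f p =
     frechet_derivative (f \<circ> chart_inv (chart_at A p)) (at (snd (chart_at A p) p))"

definition to_chart :: "('a, 'e::real_normed_vector) chart set \<Rightarrow> ('a, 'e) chart \<Rightarrow> 'a \<Rightarrow> 'e \<Rightarrow> 'e" where
  "to_chart A c p =
     frechet_derivative (snd c \<circ> chart_inv (chart_at A p)) (at (snd (chart_at A p) p))"

definition from_chart :: "('a, 'e::real_normed_vector) chart set \<Rightarrow> ('a, 'e) chart \<Rightarrow> 'a \<Rightarrow> 'e \<Rightarrow> 'e" where
  "from_chart A c p = frechet_derivative (snd (chart_at A p) \<circ> chart_inv c) (at (snd c p))"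

text \<open>A vector field has type \<open>'a \<Rightarrow> 'e\<close>; its values outside \<open>mcarrier A\<close> are irrelevant.\<close>

definition field_in_chart ::
  "('a, 'e::real_normed_vector) chart set \<Rightarrow> ('a, 'e) chart \<Rightarrow> ('a \<Rightarrow> 'e) \<Rightarrow> 'e \<Rightarrow> 'e" where
  "field_in_chart A c X x = to_chart A c (chart_inv c x) (X (chart_inv c x))"

definition smooth_field :: "('a, 'e::real_normed_vector) chart set \<Rightarrow> ('a \<Rightarrow> 'e) \<Rightarrow> bool" where
  "smooth_field A X \<longleftrightarrow> (\<forall>c\<in>A. smooth_on (snd c ` fst c) (field_in_chart A c X))"

text \<open>\<open>[X,Y] = DY(X) - DX(Y)\<close> in coordinates, i.e. \<open>[X,Y]f = X(Yf) - Y(Xf)\<close>.\<close>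

definition lie_bracket ::
  "('a, 'e::real_normed_vector) chart set \<Rightarrow> ('a \<Rightarrow> 'e) \<Rightarrow> ('a \<Rightarrow> 'e) \<Rightarrow> 'a \<Rightarrow> 'e" where
  "lie_bracket A X Y p =
     (let c = chart_at A p; x = snd c p; X' = field_in_chart A c X; Y' = field_in_chart A c Y
      in frechet_derivative Y' (at x) (X' x) - frechet_derivative X' (at x) (Y' x))"

section \<open>Semi-Riemannian metrics and the Levi-Civita connection\<close>

text \<open>
  Constancy of the index is not required; it is automatic on connected manifolds and for
  left-invariant metrics on Lie groups.
\<close>

definition semi_riemannian_metric ::
  "('a, 'e::real_normed_vector) chart set \<Rightarrow> ('a \<Rightarrow> 'e \<Rightarrow> 'e \<Rightarrow> real) \<Rightarrow> bool" where
  "semi_riemannian_metric A g \<longleftrightarrow>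
     (\<forall>p\<in>mcarrier A. bilinear (g p) \<and> (\<forall>u v. g p u v = g p v u) \<and>
        (\<forall>u. (\<forall>v. g p u v = 0) \<longrightarrow> u = 0)) \<and>
     (\<forall>c\<in>A. \<forall>u v. smooth_on (snd c ` fst c)
        (\<lambda>x. let p = chart_inv c x in g p (from_chart A c p u) (from_chart A c p v)))"

definition riemannian_metric ::
  "('a, 'e::real_normed_vector) chart set \<Rightarrow> ('a \<Rightarrow> 'e \<Rightarrow> 'e \<Rightarrow> real) \<Rightarrow> bool" where
  "riemannian_metric A g \<longleftrightarrow>
     semi_riemannian_metric A g \<and> (\<forall>p\<in>mcarrier A. \<forall>u. u \<noteq> 0 \<longrightarrow> g p u u > 0)"

definition induced_metric ::
  "('a, 'k::real_normed_vector) chart set \<Rightarrow> ('a, 'e::real_normed_vector) chart set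
    \<Rightarrow> ('a \<Rightarrow> 'e \<Rightarrow> 'e \<Rightarrow> real) \<Rightarrow> 'a \<Rightarrow> 'k \<Rightarrow> 'k \<Rightarrow> real" where
  "induced_metric B A g p u v =
     g p (tangent_map B A (\<lambda>q. q) p u) (tangent_map B A (\<lambda>q. q) p v)"

text \<open>
  The Levi-Civita connection is unique on smooth fields, as fields on \<open>mcarrier A\<close>; it is
  given here by its characterising properties: a torsion-free metric affine connection.
\<close>

definition affine_connection ::
  "('a, 'e::real_normed_vector) chart set \<Rightarrow> (('a \<Rightarrow> 'e) \<Rightarrow> ('a \<Rightarrow> 'e) \<Rightarrow> 'a \<Rightarrow> 'e) \<Rightarrow> bool" where
  "affine_connection A nabla \<longleftrightarrow>
     (\<forall>X Y. smooth_field A X \<longrightarrow> smooth_field A Y \<longrightarrow> smooth_field A (nabla X Y)) \<and>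
     (\<forall>X X' Y. smooth_field A X \<longrightarrow> smooth_field A X' \<longrightarrow> smooth_field A Y \<longrightarrow>
        (\<forall>p\<in>mcarrier A. nabla (\<lambda>q. X q + X' q) Y p = nabla X Y p + nabla X' Y p \<and>
           nabla Y (\<lambda>q. X q + X' q) p = nabla Y X p + nabla Y X' p)) \<and>
     (\<forall>f X Y. smooth_function A f \<longrightarrow> smooth_field A X \<longrightarrow> smooth_field A Y \<longrightarrow>
        (\<forall>p\<in>mcarrier A. nabla (\<lambda>q. f q *\<^sub>R X q) Y p = f p *\<^sub>R nabla X Y p \<and>
           nabla X (\<lambda>q. f q *\<^sub>R Y q) p =
             directional_derivative A f p (X p) *\<^sub>R Y p + f p *\<^sub>R nabla X Y p))"

definition levi_civita_connection ::
  "('a, 'e::real_normed_vector) chart set \<Rightarrow> ('a \<Rightarrow> 'e \<Rightarrow> 'e \<Rightarrow> real)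
    \<Rightarrow> (('a \<Rightarrow> 'e) \<Rightarrow> ('a \<Rightarrow> 'e) \<Rightarrow> 'a \<Rightarrow> 'e) \<Rightarrow> bool" where
  "levi_civita_connection A g nabla \<longleftrightarrow>
     affine_connection A nabla \<and>
     (\<forall>X Y. smooth_field A X \<longrightarrow> smooth_field A Y \<longrightarrow>
        (\<forall>p\<in>mcarrier A. nabla X Y p - nabla Y X p = lie_bracket A X Y p)) \<and>
     (\<forall>X Y Z. smooth_field A X \<longrightarrow> smooth_field A Y \<longrightarrow> smooth_field A Z \<longrightarrow>
        (\<forall>p\<in>mcarrier A. directional_derivative A (\<lambda>q. g q (Y q) (Z q)) p (X p) =
           g p (nabla X Y p) (Z p) + g p (Y p) (nabla X Z p)))"

section \<open>Lie groups\<close>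

definition lie_group :: "'a monoid \<Rightarrow> ('a, 'e::real_normed_vector) chart set \<Rightarrow> bool" where
  "lie_group G A \<longleftrightarrow>
     group G \<and> smooth_manifold A \<and> mcarrier A = carrier G \<and>
     smooth_map (prod_atlas A A) A (\<lambda>(x, y). x \<otimes>\<^bsub>G\<^esub> y) \<and>
     smooth_map A A (\<lambda>x. inv\<^bsub>G\<^esub> x)"

text \<open>Lie subgroups are immersed, and carry a manifold structure (hence a topology) of their own.\<close>

definition lie_subgroup ::
  "'a set \<Rightarrow> ('a, 'k::real_normed_vector) chart set \<Rightarrow> 'a monoid \<Rightarrow> ('a, 'e::real_normed_vector) chart set
    \<Rightarrow> bool" where
  "lie_subgroup K B G A \<longleftrightarrow>
     subgroup K G \<and> lie_group (G\<lparr>carrier := K\<rparr>) B \<and>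
     smooth_map B A (\<lambda>q. q) \<and> (\<forall>p\<in>K. inj (tangent_map B A (\<lambda>q. q) p))"

definition left_translate ::
  "'a monoid \<Rightarrow> ('a, 'e::real_normed_vector) chart set \<Rightarrow> 'a \<Rightarrow> 'a \<Rightarrow> 'e \<Rightarrow> 'e" where
  "left_translate G A a p = tangent_map A A (\<lambda>q. a \<otimes>\<^bsub>G\<^esub> q) p"

definition right_translate ::
  "'a monoid \<Rightarrow> ('a, 'e::real_normed_vector) chart set \<Rightarrow> 'a \<Rightarrow> 'a \<Rightarrow> 'e \<Rightarrow> 'e" where
  "right_translate G A a p = tangent_map A A (\<lambda>q. q \<otimes>\<^bsub>G\<^esub> a) p"

definition left_invariant_metric ::
  "'a monoid \<Rightarrow> ('a, 'e::real_normed_vector) chart set \<Rightarrow> ('a \<Rightarrow> 'e \<Rightarrow> 'e \<Rightarrow> real) \<Rightarrow> bool" where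
  "left_invariant_metric G A g \<longleftrightarrow>
     (\<forall>a\<in>carrier G. \<forall>p\<in>carrier G. \<forall>u v.
        g (a \<otimes>\<^bsub>G\<^esub> p) (left_translate G A a p u) (left_translate G A a p v) = g p u v)"

definition right_invariant_metric ::
  "'a monoid \<Rightarrow> ('a, 'e::real_normed_vector) chart set \<Rightarrow> ('a \<Rightarrow> 'e \<Rightarrow> 'e \<Rightarrow> real) \<Rightarrow> bool" where
  "right_invariant_metric G A g \<longleftrightarrow>
     (\<forall>a\<in>carrier G. \<forall>p\<in>carrier G. \<forall>u v.
        g (p \<otimes>\<^bsub>G\<^esub> a) (right_translate G A a p u) (right_translate G A a p v) = g p u v)"

definition biinvariant_metric ::
  "'a monoid \<Rightarrow> ('a, 'e::real_normed_vector) chart set \<Rightarrow> ('a \<Rightarrow> 'e \<Rightarrow> 'e \<Rightarrow> real) \<Rightarrow> bool" where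
  "biinvariant_metric G A g \<longleftrightarrow> left_invariant_metric G A g \<and> right_invariant_metric G A g"

text \<open>The Lie algebra is the tangent space at the identity, with the bracket of left-invariant fields.\<close>

definition left_invariant_field ::
  "'a monoid \<Rightarrow> ('a, 'e::real_normed_vector) chart set \<Rightarrow> 'e \<Rightarrow> 'a \<Rightarrow> 'e" where
  "left_invariant_field G A u p = left_translate G A p \<one>\<^bsub>G\<^esub> u"

definition lie_algebra_bracket ::
  "'a monoid \<Rightarrow> ('a, 'e::real_normed_vector) chart set \<Rightarrow> 'e \<Rightarrow> 'e \<Rightarrow> 'e" where
  "lie_algebra_bracket G A u v =
     lie_bracket A (left_invariant_field G A u) (left_invariant_field G A v) \<one>\<^bsub>G\<^esub>"

definition lie_ideal :: "('e::real_vector \<Rightarrow> 'e \<Rightarrow> 'e) \<Rightarrow> 'e set \<Rightarrow> bool" where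
  "lie_ideal br I \<longleftrightarrow> subspace I \<and> (\<forall>x. \<forall>y\<in>I. br x y \<in> I)"

primrec derived_series :: "('e::real_vector \<Rightarrow> 'e \<Rightarrow> 'e) \<Rightarrow> 'e set \<Rightarrow> nat \<Rightarrow> 'e set" where
  "derived_series br I 0 = I"
| "derived_series br I (Suc n) =
     span {br x y | x y. x \<in> derived_series br I n \<and> y \<in> derived_series br I n}"

definition solvable_lie :: "('e::real_vector \<Rightarrow> 'e \<Rightarrow> 'e) \<Rightarrow> 'e set \<Rightarrow> bool" where
  "solvable_lie br I \<longleftrightarrow> (\<exists>n. derived_series br I n = {0})"

definition semisimple_lie :: "('e::real_vector \<Rightarrow> 'e \<Rightarrow> 'e) \<Rightarrow> bool" where
  "semisimple_lie br \<longleftrightarrow> (\<forall>I. lie_ideal br I \<longrightarrow> solvable_lie br I \<longrightarrow> I = {0})"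

definition semisimple_lie_group :: "'a monoid \<Rightarrow> ('a, 'e::real_normed_vector) chart set \<Rightarrow> bool" where
  "semisimple_lie_group G A \<longleftrightarrow> lie_group G A \<and> semisimple_lie (lie_algebra_bracket G A)"

section \<open>The foliation generated by a subgroup\<close>

text \<open>
  The foliation is represented by its tangent distribution. Inside the Lie algebra of \<open>G\<close>, the Lie
  algebra of \<open>K\<close> is the image of the derivative of the inclusion at the identity.
\<close>

definition subgroup_lie_algebra ::
  "'a monoid \<Rightarrow> ('a, 'e::real_normed_vector) chart set \<Rightarrow> ('a, 'k::real_normed_vector) chart set \<Rightarrow> 'e set" where
  "subgroup_lie_algebra G A B = range (tangent_map B A (\<lambda>q. q) \<one>\<^bsub>G\<^esub>)"

definition generated_distribution ::
  "'a monoid \<Rightarrow> ('a, 'e::real_normed_vector) chart set \<Rightarrow> ('a, 'k::real_normed_vector) chart set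
    \<Rightarrow> 'a \<Rightarrow> 'e set" where
  "generated_distribution G A B p = left_translate G A p \<one>\<^bsub>G\<^esub> ` subgroup_lie_algebra G A B"

definition orthogonal_distribution ::
  "('a \<Rightarrow> 'e \<Rightarrow> 'e \<Rightarrow> real) \<Rightarrow> ('a \<Rightarrow> 'e set) \<Rightarrow> 'a \<Rightarrow> 'e set" where
  "orthogonal_distribution g D p = {x. \<forall>v\<in>D p. g p x v = 0}"

text \<open>
  Projection onto \<open>U\<close> along \<open>W\<close>; meaningful only if the space is the direct sum of \<open>U\<close> and \<open>W\<close>,
  as is the case for a nondegenerate distribution and its orthogonal complement.
\<close>

definition proj_along :: "'e::real_vector set \<Rightarrow> 'e set \<Rightarrow> 'e \<Rightarrow> 'e" where
  "proj_along U W x = (THE u. u \<in> U \<and> x - u \<in> W)"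

definition smooth_section ::
  "('a, 'e::real_normed_vector) chart set \<Rightarrow> ('a \<Rightarrow> 'e set) \<Rightarrow> ('a \<Rightarrow> 'e) \<Rightarrow> bool" where
  "smooth_section A D X \<longleftrightarrow> smooth_field A X \<and> (\<forall>p\<in>mcarrier A. X p \<in> D p)"

text \<open>
  \<open>second_fundamental_form nabla D E\<close> is the form of the distribution \<open>D\<close>, with values in the
  complementary distribution \<open>E\<close>.
\<close>

definition second_fundamental_form ::
  "(('a \<Rightarrow> 'e) \<Rightarrow> ('a \<Rightarrow> 'e) \<Rightarrow> 'a \<Rightarrow> 'e::real_normed_vector) \<Rightarrow> ('a \<Rightarrow> 'e set) \<Rightarrow> ('a \<Rightarrow> 'e set)
    \<Rightarrow> ('a \<Rightarrow> 'e) \<Rightarrow> ('a \<Rightarrow> 'e) \<Rightarrow> 'a \<Rightarrow> 'e" where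
  "second_fundamental_form nabla D E X Y p =
     (1/2) *\<^sub>R proj_along (E p) (D p) (nabla X Y p + nabla Y X p)"

definition conformal_foliation ::
  "('a, 'e::real_normed_vector) chart set \<Rightarrow> ('a \<Rightarrow> 'e \<Rightarrow> 'e \<Rightarrow> real)
    \<Rightarrow> (('a \<Rightarrow> 'e) \<Rightarrow> ('a \<Rightarrow> 'e) \<Rightarrow> 'a \<Rightarrow> 'e) \<Rightarrow> ('a \<Rightarrow> 'e set) \<Rightarrow> bool" where
  "conformal_foliation A g nabla D \<longleftrightarrow>
     (let H = orthogonal_distribution g D in
      \<exists>V. smooth_section A D V \<and>
        (\<forall>X Y. smooth_section A H X \<longrightarrow> smooth_section A H Y \<longrightarrow>
           (\<forall>p\<in>mcarrier A. second_fundamental_form nabla H D X Y p = g p (X p) (Y p) *\<^sub>R V p)))"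

definition totally_geodesic_foliation ::
  "('a, 'e::real_normed_vector) chart set \<Rightarrow> ('a \<Rightarrow> 'e \<Rightarrow> 'e \<Rightarrow> real)
    \<Rightarrow> (('a \<Rightarrow> 'e) \<Rightarrow> ('a \<Rightarrow> 'e) \<Rightarrow> 'a \<Rightarrow> 'e) \<Rightarrow> ('a \<Rightarrow> 'e set) \<Rightarrow> bool" where
  "totally_geodesic_foliation A g nabla D \<longleftrightarrow>
     (let H = orthogonal_distribution g D in
      \<forall>V W. smooth_section A D V \<longrightarrow> smooth_section A D W \<longrightarrow>
        (\<forall>p\<in>mcarrier A. second_fundamental_form nabla D H V W p = 0))"

end

theory Submission
  imports Defs
begin

text \<open>
  Let \<open>\<kk>\<close> be the Lie algebra of \<open>K\<close> and \<open>\<hh>\<close> its orthogonal complement, of dimension two. By the Koszul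
  formula for left-invariant fields, conformality says that for \<open>w \<in> \<kk>\<close> the map \<open>\<hh> \<rightarrow> \<hh>\<close> induced by
  \<open>ad w\<close> is a skew map plus a multiple of the identity. Such maps commute in dimension two, so that brackets
  of \<open>\<kk>\<close> act trivially, and \<open>\<kk>\<close> is spanned by its brackets: \<open>[\<kk>, \<hh>] \<subseteq> \<kk>\<close>. For \<open>x \<in> \<hh>\<close> the
  restriction of \<open>ad x\<close> to \<open>\<kk>\<close> is then a derivation, hence inner, hence skew for the ad-invariant inner
  product, which by the Koszul formula again is the vanishing of the second fundamental form of \<open>\<V>\<close>.
\<close>

section \<open>Calculus of smooth maps\<close>

text \<open>In a plane with a nondegenerate form, of any signature, the skew maps form a line; this
  is why they commute. Compressing \<open>ad w\<close> to \<hh> gives a representation of \<kk>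
  because \<open>ad w\<close> maps \<kk> into itself, so commuting compressions make brackets act by
  zero. That \<kk> is spanned by brackets and has only inner derivations comes from biinvariance:
  the inner product is then ad-invariant, the Killing form is negative semidefinite with the centre
  as kernel, and the centre is a solvable ideal. The Koszul formula is never written down: metric
  products of left-invariant fields are constant, so metric compatibility and vanishing torsion do
  its work. The obstacle is that the conclusion concerns all smooth sections of \<V>, not only
  left-invariant ones. For a left-invariant field \<open>X\<close> in \<H>, the pairing of
  \<open>nabla V W\<close> with \<open>X\<close> is minus that of \<open>W\<close> with
  \<open>nabla V X\<close>, where \<open>V\<close> stands in the argument in which the connection is
  linear over functions; \<open>V\<close> can thus be expanded in a left-invariant frame without
  differentiating its coefficients.\<close>

lemma C_on_mono_Suc: "C_on (Suc n) S f \<Longrightarrow> C_on n S f"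
proof (induction n arbitrary: f)
  case 0
  then show ?case
    by (auto intro!: continuous_at_imp_continuous_on differentiable_imp_continuous_within)
next
  case (Suc n)
  then show ?case by (metis C_on.simps(2))
qed

lemma frechet_derivativeI: "(f has_derivative f') (at x) \<Longrightarrow> frechet_derivative f (at x) = f'"
  by (metis frechet_derivative_at)

lemma has_frechet_derivative:
  "f differentiable (at x) \<Longrightarrow> (f has_derivative frechet_derivative f (at x)) (at x)"
  by (simp add: frechet_derivative_works)

lemma differentiable_transform_open:
  assumes "f differentiable (at x)" "open S" "x \<in> S" "\<And>y. y \<in> S \<Longrightarrow> f y = g y"
  shows "g differentiable (at x)"
  using assms unfolding differentiable_def
  by (meson has_derivative_transform_within_open)

lemma frechet_derivative_cong_open:
  assumes "open S" "x \<in> S" "\<And>y. y \<in> S \<Longrightarrow> f y = g y"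
  shows "frechet_derivative f (at x) = frechet_derivative g (at x)"
proof -
  have "(f has_derivative f') (at x) \<longleftrightarrow> (g has_derivative f') (at x)" for f'
    using assms has_derivative_transform_within_open[of f f' x UNIV S g]
      has_derivative_transform_within_open[of g f' x UNIV S f]
    by auto
  then show ?thesis by (simp add: frechet_derivative_def)
qed

lemma C_on_cong:
  assumes "open S" "\<And>x. x \<in> S \<Longrightarrow> f x = g x" "C_on n S f"
  shows "C_on n S g"
  using assms(2,3)
proof (induction n arbitrary: f g)
  case 0
  then show ?case using continuous_on_cong[of S S f g] by auto
next
  case (Suc n)
  have fd: "frechet_derivative f (at x) = frechet_derivative g (at x)" if "x \<in> S" for x
    using frechet_derivative_cong_open[OF assms(1) that] Suc.prems(1) by blast
  have "g differentiable (at x)" if "x \<in> S" for x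
    using differentiable_transform_open[OF _ assms(1) that] Suc.prems that by auto
  moreover have "C_on n S (\<lambda>x. frechet_derivative g (at x) v)" for v
    using Suc.IH[of "\<lambda>x. frechet_derivative f (at x) v"] fd Suc.prems by auto
  ultimately show ?case by simp
qed

lemma C_on_const: "C_on n S (\<lambda>x. c)"
  by (induction n arbitrary: c) auto

lemma C_on_bounded_linear:
  assumes "bounded_linear L" "open S" "C_on n S f"
  shows "C_on n S (\<lambda>x. L (f x))"
  using assms(3)
proof (induction n arbitrary: f)
  case 0
  then show ?case using bounded_linear.continuous_on[OF assms(1)] by auto
next
  case (Suc n)
  have d: "((\<lambda>x. L (f x)) has_derivative (\<lambda>v. L (frechet_derivative f (at x) v))) (at x)"
    if "x \<in> S" for x
    by (rule bounded_linear.has_derivative[OF assms(1)] has_frechet_derivative)+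
      (use Suc.prems that in auto)
  have "C_on n S (\<lambda>x. frechet_derivative (\<lambda>x. L (f x)) (at x) v)" for v
    by (rule C_on_cong[OF assms(2), of "\<lambda>x. L (frechet_derivative f (at x) v)"])
      (use frechet_derivativeI[OF d] Suc in auto)
  then show ?case using d by (auto simp: differentiable_def)
qed

text \<open>Affine inner maps suffice below: fixing one factor of the group multiplication in
  product coordinates is an affine embedding.\<close>

lemma C_on_compose_affine:
  assumes L: "bounded_linear L" and S: "open S" "\<And>x. x \<in> S \<Longrightarrow> c + L x \<in> T" and f: "C_on n T f"
  shows "C_on n S (\<lambda>x. f (c + L x))"
  using f
proof (induction n arbitrary: f)
  case 0
  have "continuous_on S (\<lambda>x. c + L x)"
    by (intro continuous_intros linear_continuous_on L)
  then show ?case using continuous_on_compose2[of T f S "\<lambda>x. c + L x"] 0 S(2) by auto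
next
  case (Suc n)
  have d: "((\<lambda>x. f (c + L x)) has_derivative (\<lambda>v. frechet_derivative f (at (c + L x)) (L v))) (at x)"
    if "x \<in> S" for x
  proof -
    have "((\<lambda>x. c + L x) has_derivative L) (at x)"
      by (auto intro!: derivative_eq_intros bounded_linear_imp_has_derivative L)
    then show ?thesis
      by (rule has_derivative_compose[OF _ has_frechet_derivative])
        (use Suc.prems S(2) that in auto)
  qed
  have "C_on n S (\<lambda>x. frechet_derivative (\<lambda>x. f (c + L x)) (at x) v)" for v
    by (rule C_on_cong[OF S(1), of "\<lambda>x. frechet_derivative f (at (c + L x)) (L v)"])
      (use frechet_derivativeI[OF d] Suc in auto)
  then show ?case using d by (auto simp: differentiable_def)
qed

lemma C_on_add:
  assumes "open S" "C_on n S f" "C_on n S g"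
  shows "C_on n S (\<lambda>x. f x + g x)"
  using assms(2,3)
proof (induction n arbitrary: f g)
  case 0
  then show ?case by (auto intro: continuous_intros)
next
  case (Suc n)
  have d: "((\<lambda>x. f x + g x) has_derivative
      (\<lambda>v. frechet_derivative f (at x) v + frechet_derivative g (at x) v)) (at x)"
    if "x \<in> S" for x
    using Suc.prems that by (intro has_derivative_add has_frechet_derivative) auto
  have "C_on n S (\<lambda>x. frechet_derivative (\<lambda>x. f x + g x) (at x) v)" for v
    by (rule C_on_cong[OF assms(1), of "\<lambda>x. frechet_derivative f (at x) v + frechet_derivative g (at x) v"])
      (use frechet_derivativeI[OF d] Suc in auto)
  then show ?case using d by (auto simp: differentiable_def)
qed

lemma C_on_scaleR:
  assumes "open S" "C_on n S f" "C_on n S g"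
  shows "C_on n S (\<lambda>x. f x *\<^sub>R g x)"
  using assms(2,3)
proof (induction n arbitrary: f g)
  case 0
  then show ?case by (auto intro: continuous_intros)
next
  case (Suc n)
  have d: "((\<lambda>x. f x *\<^sub>R g x) has_derivative
      (\<lambda>v. f x *\<^sub>R frechet_derivative g (at x) v + frechet_derivative f (at x) v *\<^sub>R g x)) (at x)"
    if "x \<in> S" for x
    using Suc.prems that by (intro has_derivative_scaleR has_frechet_derivative) auto
  \<comment> \<open>The product rule leaves \<open>f\<close> and \<open>g\<close> undifferentiated
    in the derivative, so each must also be lowered from level \<open>Suc n\<close> to level
    \<open>n\<close>.\<close>
  have "C_on n S (\<lambda>x. frechet_derivative (\<lambda>x. f x *\<^sub>R g x) (at x) v)" for v
    by (rule C_on_cong[OF assms(1),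
          of "\<lambda>x. f x *\<^sub>R frechet_derivative g (at x) v + frechet_derivative f (at x) v *\<^sub>R g x"])
      (use frechet_derivativeI[OF d] Suc C_on_mono_Suc[OF Suc.prems(1)] C_on_mono_Suc[OF Suc.prems(2)]
        in \<open>auto intro!: C_on_add[OF assms(1)]\<close>)
  then show ?case using d by (auto simp: differentiable_def)
qed

lemma C_on_sum:
  assumes "open S" "\<And>i. i \<in> I \<Longrightarrow> C_on n S (f i)"
  shows "C_on n S (\<lambda>x. \<Sum>i\<in>I. f i x)"
  using assms(2)
  by (induction I rule: infinite_finite_induct) (auto intro: C_on_const C_on_add[OF assms(1)])

lemma smooth_on_diff: "smooth_on S f \<Longrightarrow> x \<in> S \<Longrightarrow> f differentiable (at x)"
  unfolding smooth_on_def by (metis C_on.simps(2))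

lemma smooth_on_deriv: "smooth_on S f \<Longrightarrow> smooth_on S (\<lambda>x. frechet_derivative f (at x) v)"
  unfolding smooth_on_def by (metis C_on.simps(2))

lemma smooth_on_cong: "open S \<Longrightarrow> (\<And>x. x \<in> S \<Longrightarrow> f x = g x) \<Longrightarrow> smooth_on S f \<Longrightarrow> smooth_on S g"
  unfolding smooth_on_def using C_on_cong by blast

lemma smooth_on_compose_affine:
  "bounded_linear L \<Longrightarrow> open S \<Longrightarrow> (\<And>x. x \<in> S \<Longrightarrow> c + L x \<in> T) \<Longrightarrow> smooth_on T f
    \<Longrightarrow> smooth_on S (\<lambda>x. f (c + L x))"
  unfolding smooth_on_def using C_on_compose_affine by blast

section \<open>Symmetry of second derivatives\<close>

text \<open>Two applications of the mean value theorem: along \<open>v\<close> to the increment of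
  \<open>f\<close> in direction \<open>w\<close>, and along \<open>w\<close> to the derivative of
  \<open>f\<close> in direction \<open>v\<close>.\<close>

lemma mixed_second_difference:
  fixes f :: "'e::real_normed_vector \<Rightarrow> real"
  assumes t: "t > 0"
    and seg: "\<And>a b. 0 \<le> a \<Longrightarrow> a \<le> t \<Longrightarrow> 0 \<le> b \<Longrightarrow> b \<le> t \<Longrightarrow> x + a *\<^sub>R v + b *\<^sub>R w \<in> S"
    and f: "\<And>y. y \<in> S \<Longrightarrow> f differentiable (at y)"
    and fv: "\<And>y. y \<in> S \<Longrightarrow> (\<lambda>y. frechet_derivative f (at y) v) differentiable (at y)"
  shows "\<exists>a b. 0 \<le> a \<and> a \<le> t \<and> 0 \<le> b \<and> b \<le> t \<and>
    f (x + t *\<^sub>R v + t *\<^sub>R w) - f (x + t *\<^sub>R v) - f (x + t *\<^sub>R w) + f x =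
    t\<^sup>2 * frechet_derivative (\<lambda>y. frechet_derivative f (at y) v) (at (x + a *\<^sub>R v + b *\<^sub>R w)) w"
proof -
  let ?D = "\<lambda>y. frechet_derivative f (at y)"
  \<comment> \<open>The summand \<open>0 *\<^sub>R w\<close> is kept so that both terms are
    instances of fact \<open>1\<close> below.\<close>
  let ?g = "\<lambda>s. f (x + s *\<^sub>R v + t *\<^sub>R w) - f (x + s *\<^sub>R v + 0 *\<^sub>R w)"
  have "(?g has_derivative (\<lambda>h. ?D (x + s *\<^sub>R v + t *\<^sub>R w) (h *\<^sub>R v) - ?D (x + s *\<^sub>R v + 0 *\<^sub>R w) (h *\<^sub>R v)))
     (at s within {0..t})" if "0 \<le> s" "s \<le> t" for s
  proof -
    have 1: "((\<lambda>s. f (x + s *\<^sub>R v + b *\<^sub>R w)) has_derivative (\<lambda>h. ?D (x + s *\<^sub>R v + b *\<^sub>R w) (h *\<^sub>R v)))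
       (at s within {0..t})" if "0 \<le> b" "b \<le> t" for b
      by (rule has_derivative_compose[of "\<lambda>s. x + s *\<^sub>R v + b *\<^sub>R w" "\<lambda>h. h *\<^sub>R v"])
        (auto intro!: derivative_eq_intros has_frechet_derivative f seg that \<open>0 \<le> s\<close> \<open>s \<le> t\<close>)
    show ?thesis
      using has_derivative_diff[OF 1[of t] 1[of 0]] t by auto
  qed
  then obtain a where a: "a \<in> {0<..<t}" and
    ga: "?g t - ?g 0 = ?D (x + a *\<^sub>R v + t *\<^sub>R w) ((t - 0) *\<^sub>R v) - ?D (x + a *\<^sub>R v + 0 *\<^sub>R w) ((t - 0) *\<^sub>R v)"
    using mvt_simple[OF t, of ?g "\<lambda>s h. ?D (x + s *\<^sub>R v + t *\<^sub>R w) (h *\<^sub>R v) - ?D (x + s *\<^sub>R v + 0 *\<^sub>R w) (h *\<^sub>R v)"]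
    by blast
  have lin: "?D y (c *\<^sub>R u) = c * ?D y u" if "y \<in> S" for y c u
    using linear_cmul[OF linear_frechet_derivative[OF f[OF that]]] by simp
  let ?E = "\<lambda>y. frechet_derivative (\<lambda>y. ?D y v) (at y)"
  have "((\<lambda>s. ?D (x + a *\<^sub>R v + s *\<^sub>R w) v) has_derivative (\<lambda>h. ?E (x + a *\<^sub>R v + s *\<^sub>R w) (h *\<^sub>R w)))
     (at s within {0..t})" if "0 \<le> s" "s \<le> t" for s
    by (rule has_derivative_compose[of "\<lambda>s. x + a *\<^sub>R v + s *\<^sub>R w" "\<lambda>h. h *\<^sub>R w"])
      (use a that in \<open>auto intro!: derivative_eq_intros has_frechet_derivative fv seg\<close>)
  then obtain b where b: "b \<in> {0<..<t}" and
    gb: "?D (x + a *\<^sub>R v + t *\<^sub>R w) v - ?D (x + a *\<^sub>R v + 0 *\<^sub>R w) v = ?E (x + a *\<^sub>R v + b *\<^sub>R w) ((t - 0) *\<^sub>R w)"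
    using mvt_simple[OF t, of "\<lambda>s. ?D (x + a *\<^sub>R v + s *\<^sub>R w) v" "\<lambda>s h. ?E (x + a *\<^sub>R v + s *\<^sub>R w) (h *\<^sub>R w)"]
    by blast
  have inS: "x + a *\<^sub>R v + t *\<^sub>R w \<in> S" "x + a *\<^sub>R v + 0 *\<^sub>R w \<in> S" "x + a *\<^sub>R v + b *\<^sub>R w \<in> S"
    using seg[of a t] seg[of a 0] seg[of a b] a b t by auto
  have "?E (x + a *\<^sub>R v + b *\<^sub>R w) ((t - 0) *\<^sub>R w) = t * ?E (x + a *\<^sub>R v + b *\<^sub>R w) w"
    using linear_cmul[OF linear_frechet_derivative[OF fv[OF inS(3)]]] by simp
  then have "?g t - ?g 0 = t\<^sup>2 * ?E (x + a *\<^sub>R v + b *\<^sub>R w) w"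
    unfolding ga lin[OF inS(1)] lin[OF inS(2)] using gb
    by (simp add: power2_eq_square right_diff_distrib[symmetric])
  then show ?thesis
    using a b by (intro exI[of _ a] exI[of _ b]) (auto simp: algebra_simps)
qed

text \<open>The second difference over the parallelogram spanned by \<open>t v\<close> and
  \<open>t w\<close> does not change when \<open>v\<close> and \<open>w\<close> are exchanged. Hence
  the two mixed derivatives agree at some pair of points of the parallelogram, and continuity
  carries this to \<open>x\<close> as \<open>t\<close> shrinks.\<close>

lemma symmetric_second_derivative_real:
  fixes f :: "'e::real_normed_vector \<Rightarrow> real"
  assumes S: "open S" "x \<in> S" and f: "C_on 2 S f"
  shows "frechet_derivative (\<lambda>y. frechet_derivative f (at y) v) (at x) w =
    frechet_derivative (\<lambda>y. frechet_derivative f (at y) w) (at x) v"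
proof (rule ccontr)
  let ?E = "\<lambda>v w y. frechet_derivative (\<lambda>y. frechet_derivative f (at y) v) (at y) w"
  have d1: "f differentiable (at y)" if "y \<in> S" for y
    using f that by (simp add: numeral_2_eq_2)
  have d2: "(\<lambda>y. frechet_derivative f (at y) v) differentiable (at y)" if "y \<in> S" for y v
    using f that by (simp add: numeral_2_eq_2)
  have cont: "continuous_on S (?E v w)" for v w
    using f by (simp add: numeral_2_eq_2)
  assume ne: "\<not> ?thesis"
  \<comment> \<open>Half the supposed gap: two deviations below \<open>e\<close> cannot bridge
    it.\<close>
  define e where "e = \<bar>?E v w x - ?E w v x\<bar> / 2"
  have e: "e > 0" using ne by (auto simp: e_def)
  obtain d1 where d1p: "d1 > 0" "\<And>y. y \<in> S \<Longrightarrow> dist y x < d1 \<Longrightarrow> dist (?E v w y) (?E v w x) < e"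
    using cont[of v w] S(2) e unfolding continuous_on_iff by metis
  obtain d2 where d2p: "d2 > 0" "\<And>y. y \<in> S \<Longrightarrow> dist y x < d2 \<Longrightarrow> dist (?E w v y) (?E w v x) < e"
    using cont[of w v] S(2) e unfolding continuous_on_iff by metis
  obtain d3 where d3p: "d3 > 0" "ball x d3 \<subseteq> S"
    using S open_contains_ball by blast
  define r where "r = min d1 (min d2 d3)"
  \<comment> \<open>The summand 1 keeps \<open>N\<close> positive when both vectors vanish; the
    factor 2 in \<open>t\<close> keeps the whole parallelogram within \<open>r / 2\<close> of
    \<open>x\<close>.\<close>
  define N where "N = norm v + norm w + 1"
  define t where "t = r / (2 * N)"
  have r: "r > 0" using d1p d2p d3p by (simp add: r_def)
  have nn: "N > 0" by (simp add: N_def add_nonneg_pos)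
  have t: "t > 0" unfolding t_def using r nn by simp
  have near: "dist (x + a *\<^sub>R v + b *\<^sub>R w) x < r" if "0 \<le> a" "a \<le> t" "0 \<le> b" "b \<le> t" for a b
  proof -
    have "dist (x + a *\<^sub>R v + b *\<^sub>R w) x = norm (a *\<^sub>R v + b *\<^sub>R w)" by (simp add: dist_norm)
    also have "\<dots> \<le> a * norm v + b * norm w"
      using norm_triangle_ineq[of "a *\<^sub>R v" "b *\<^sub>R w"] that by simp
    also have "\<dots> \<le> t * norm v + t * norm w" using that by (intro add_mono mult_right_mono) auto
    also have "\<dots> \<le> t * N" using t by (simp add: N_def algebra_simps)
    also have "\<dots> = r / 2" using nn by (simp add: t_def)
    also have "\<dots> < r" using r by simp
    finally show ?thesis .
  qed
  have inS: "x + a *\<^sub>R v + b *\<^sub>R w \<in> S" if "0 \<le> a" "a \<le> t" "0 \<le> b" "b \<le> t" for a b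
    using near[OF that] d3p(2) by (auto simp: r_def dist_commute)
  have inS': "x + a *\<^sub>R w + b *\<^sub>R v \<in> S" if "0 \<le> a" "a \<le> t" "0 \<le> b" "b \<le> t" for a b
    using inS[of b a] that by (simp add: algebra_simps)
  obtain a b where ab: "0 \<le> a" "a \<le> t" "0 \<le> b" "b \<le> t"
    "f (x + t *\<^sub>R v + t *\<^sub>R w) - f (x + t *\<^sub>R v) - f (x + t *\<^sub>R w) + f x = t\<^sup>2 * ?E v w (x + a *\<^sub>R v + b *\<^sub>R w)"
    using mixed_second_difference[OF t inS d1 d2[of _ v]] by blast
  obtain c d where cd: "0 \<le> c" "c \<le> t" "0 \<le> d" "d \<le> t"
    "f (x + t *\<^sub>R w + t *\<^sub>R v) - f (x + t *\<^sub>R w) - f (x + t *\<^sub>R v) + f x = t\<^sup>2 * ?E w v (x + c *\<^sub>R w + d *\<^sub>R v)"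
    using mixed_second_difference[OF t inS' d1 d2[of _ w]] by blast
  have "f (x + t *\<^sub>R v + t *\<^sub>R w) - f (x + t *\<^sub>R v) - f (x + t *\<^sub>R w) + f x =
    f (x + t *\<^sub>R w + t *\<^sub>R v) - f (x + t *\<^sub>R w) - f (x + t *\<^sub>R v) + f x"
    by (simp add: algebra_simps)
  then have eq: "?E v w (x + a *\<^sub>R v + b *\<^sub>R w) = ?E w v (x + d *\<^sub>R v + c *\<^sub>R w)"
    using ab(5) cd(5) t by (simp add: algebra_simps)
  have "dist (?E v w (x + a *\<^sub>R v + b *\<^sub>R w)) (?E v w x) < e"
    using d1p(2)[OF inS] near[of a b] ab by (simp add: r_def)
  moreover have "dist (?E w v (x + d *\<^sub>R v + c *\<^sub>R w)) (?E w v x) < e"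
    using d2p(2)[OF inS] near[of d c] cd by (simp add: r_def)
  ultimately have "dist (?E v w x) (?E w v x) < 2 * e"
    using dist_triangle3[of "?E v w x" "?E w v x" "?E v w (x + a *\<^sub>R v + b *\<^sub>R w)"]
    unfolding eq by linarith
  then show False by (simp add: e_def dist_real_def)
qed

section \<open>The bracket of vector fields in coordinates\<close>

text \<open>
  The model space of the subgroup is not of class \<open>euclidean_space\<close>, so coordinates are taken by a
  linear embedding \<open>i\<close> into a Euclidean space with a left inverse \<open>l\<close>.
\<close>

definition coord_pair :: "('k::real_normed_vector \<Rightarrow> 'e::euclidean_space) \<Rightarrow> ('e \<Rightarrow> 'k) \<Rightarrow> bool" where
  "coord_pair i l \<longleftrightarrow> bounded_linear i \<and> bounded_linear l \<and> (\<forall>x. l (i x) = x)"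

lemma coord_pair_id: "coord_pair (\<lambda>x::'e::euclidean_space. x) (\<lambda>x. x)"
  by (simp add: coord_pair_def bounded_linear_ident)

text \<open>The vectors \<open>l b\<close> span but need not be independent. This is enough to
  reduce linear and bilinear maps to finitely many values.\<close>

lemma coord_expansion:
  fixes i :: "'k::real_normed_vector \<Rightarrow> 'e::euclidean_space"
  assumes "coord_pair i l"
  shows "(\<Sum>b\<in>Basis. (i x \<bullet> b) *\<^sub>R l b) = x"
proof -
  have l: "linear l" and li: "l (i x) = x"
    using assms by (auto simp: coord_pair_def bounded_linear.linear)
  have "(\<Sum>b\<in>Basis. (i x \<bullet> b) *\<^sub>R l b) = l (\<Sum>b\<in>Basis. (i x \<bullet> b) *\<^sub>R b)"
    by (simp add: linear_sum[OF l] linear_cmul[OF l])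
  also have "\<dots> = x" by (simp add: euclidean_representation li)
  finally show ?thesis .
qed

text \<open>Componentwise reduction to the real case; only the target space needs coordinates, and
  \<open>l\<close> undoes the embedding at the end.\<close>

lemma symmetric_second_derivative:
  fixes f :: "'d::real_normed_vector \<Rightarrow> 'k::real_normed_vector" and i :: "'k \<Rightarrow> 'e::euclidean_space"
  assumes i: "coord_pair i l" and S: "open S" "x \<in> S" and f: "C_on 2 S f"
  shows "frechet_derivative (\<lambda>y. frechet_derivative f (at y) v) (at x) w =
    frechet_derivative (\<lambda>y. frechet_derivative f (at y) w) (at x) v"
proof -
  let ?E = "\<lambda>v w. frechet_derivative (\<lambda>y. frechet_derivative f (at y) v) (at x) w"
  have bi: "bounded_linear i" and li: "\<And>x. l (i x) = x"
    using i by (auto simp: coord_pair_def)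
  have d1: "f differentiable (at y)" if "y \<in> S" for y
    using f that by (simp add: numeral_2_eq_2)
  have d2: "(\<lambda>y. frechet_derivative f (at y) v) differentiable (at y)" if "y \<in> S" for y v
    using f that by (simp add: numeral_2_eq_2)
  have "i (?E v w) \<bullet> b = i (?E w v) \<bullet> b" for b
  proof -
    have L: "bounded_linear (\<lambda>x. i x \<bullet> b)"
      using bounded_linear_compose[OF bounded_linear_inner_left bi] .
    have 1: "frechet_derivative (\<lambda>y. i (f y) \<bullet> b) (at y) u = i (frechet_derivative f (at y) u) \<bullet> b"
      if "y \<in> S" for y u
      by (subst frechet_derivativeI[OF bounded_linear.has_derivative[OF L has_frechet_derivative[OF d1[OF that]]]]) simp
    have 2: "frechet_derivative (\<lambda>y. frechet_derivative (\<lambda>y. i (f y) \<bullet> b) (at y) u) (at x) z = i (?E u z) \<bullet> b"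
      for u z
    proof -
      have "frechet_derivative (\<lambda>y. frechet_derivative (\<lambda>y. i (f y) \<bullet> b) (at y) u) (at x)
        = frechet_derivative (\<lambda>y. i (frechet_derivative f (at y) u) \<bullet> b) (at x)"
        by (rule frechet_derivative_cong_open[OF S]) (rule 1)
      then show ?thesis
        using frechet_derivativeI[OF bounded_linear.has_derivative[OF L has_frechet_derivative[OF d2[OF S(2)]]]]
        by simp
    qed
    show ?thesis
      using symmetric_second_derivative_real[OF S C_on_bounded_linear[OF L S(1) f], of v w]
      unfolding 2 .
  qed
  then have "i (?E v w) = i (?E w v)" by (rule euclidean_eqI)
  from arg_cong[OF this, of l] show ?thesis unfolding li .
qed

text \<open>Differentiability of the derivative is available only in each fixed direction. Expanding
  \<open>X\<close> over the finitely many vectors \<open>l b\<close> turns the varying direction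
  into scalar coefficients, to which the product rule applies.\<close>

lemma has_derivative_family_apply:
  fixes f :: "'d::real_normed_vector \<Rightarrow> 'c::real_normed_vector" and i :: "'d \<Rightarrow> 'e::euclidean_space"
  assumes i: "coord_pair i l" and S: "open S" "x \<in> S"
    and f: "\<And>y. y \<in> S \<Longrightarrow> f differentiable (at y)"
    and f2: "\<And>v. (\<lambda>y. frechet_derivative f (at y) v) differentiable (at x)"
    and X: "(X has_derivative X') (at x)"
  shows "((\<lambda>y. frechet_derivative f (at y) (X y)) has_derivative
    (\<lambda>h. frechet_derivative (\<lambda>y. frechet_derivative f (at y) (X x)) (at x) h
        + frechet_derivative f (at x) (X' h))) (at x)"
proof -
  let ?D = "\<lambda>y. frechet_derivative f (at y)"
  let ?E = "\<lambda>v. frechet_derivative (\<lambda>y. ?D y v) (at x)"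
  have bi: "bounded_linear i" using i by (auto simp: coord_pair_def)
  have exp: "?D y v = (\<Sum>b\<in>Basis. (i v \<bullet> b) *\<^sub>R ?D y (l b))" if "y \<in> S" for y v
  proof -
    have lin: "linear (?D y)" using linear_frechet_derivative[OF f[OF that]] .
    have "?D y v = ?D y (\<Sum>b\<in>Basis. (i v \<bullet> b) *\<^sub>R l b)" using coord_expansion[OF i] by simp
    then show ?thesis by (simp add: linear_sum[OF lin] linear_cmul[OF lin])
  qed
  have iX: "((\<lambda>y. i (X y) \<bullet> b) has_derivative (\<lambda>h. i (X' h) \<bullet> b)) (at x)" for b
    using bounded_linear.has_derivative[OF bounded_linear_compose[OF bounded_linear_inner_left bi] X] .
  \<comment> \<open>The second derivative is linear in the inner direction, by uniqueness of the
    derivative of the same finite expansion.\<close>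
  have E: "?E v h = (\<Sum>b\<in>Basis. (i v \<bullet> b) *\<^sub>R ?E (l b) h)" for v h
  proof -
    have "((\<lambda>y. \<Sum>b\<in>Basis. (i v \<bullet> b) *\<^sub>R ?D y (l b)) has_derivative
       (\<lambda>h. \<Sum>b\<in>Basis. (i v \<bullet> b) *\<^sub>R ?E (l b) h)) (at x)"
      by (intro has_derivative_sum has_derivative_scaleR_right has_frechet_derivative f2)
    then have "((\<lambda>y. ?D y v) has_derivative (\<lambda>h. \<Sum>b\<in>Basis. (i v \<bullet> b) *\<^sub>R ?E (l b) h)) (at x)"
      by (rule has_derivative_transform_within_open[OF _ S]) (rule exp[symmetric])
    from fun_cong[OF frechet_derivativeI[OF this], of h] show ?thesis .
  qed
  have "((\<lambda>y. \<Sum>b\<in>Basis. (i (X y) \<bullet> b) *\<^sub>R ?D y (l b)) has_derivative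
     (\<lambda>h. \<Sum>b\<in>Basis. (i (X x) \<bullet> b) *\<^sub>R ?E (l b) h + (i (X' h) \<bullet> b) *\<^sub>R ?D x (l b))) (at x)"
    by (intro has_derivative_sum has_derivative_scaleR iX has_frechet_derivative f2)
  then have "((\<lambda>y. ?D y (X y)) has_derivative
     (\<lambda>h. \<Sum>b\<in>Basis. (i (X x) \<bullet> b) *\<^sub>R ?E (l b) h + (i (X' h) \<bullet> b) *\<^sub>R ?D x (l b))) (at x)"
    by (rule has_derivative_transform_within_open[OF _ S]) (rule exp[symmetric])
  then show ?thesis
    unfolding sum.distrib E[of "X x", symmetric] exp[OF S(2), symmetric] .
qed

text \<open>The body of \<open>lie_bracket\<close> in one fixed system of coordinates. The preferred
  chart used by \<open>lie_bracket\<close> varies with the point, so nested brackets are handled in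
  this form.\<close>

definition coord_bracket :: "('d::real_normed_vector \<Rightarrow> 'd) \<Rightarrow> ('d \<Rightarrow> 'd) \<Rightarrow> 'd \<Rightarrow> 'd" where
  "coord_bracket X Y x = frechet_derivative Y (at x) (X x) - frechet_derivative X (at x) (Y x)"

text \<open>Differentiating the two relations produces second derivatives of \<open>F\<close> in the
  directions \<open>X1 x\<close> and \<open>X2 x\<close>; by symmetry they cancel in the
  difference.\<close>

lemma coord_bracket_related:
  fixes F :: "'d::real_normed_vector \<Rightarrow> 'c::real_normed_vector"
    and i :: "'d \<Rightarrow> 'e::euclidean_space" and j :: "'c \<Rightarrow> 'f::euclidean_space"
  assumes i: "coord_pair i l" and j: "coord_pair j k"
    and S: "open S" "x \<in> S" and F: "C_on 2 S F"
    and X: "X1 differentiable (at x)" "X2 differentiable (at x)"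
    and Y: "Y1 differentiable (at (F x))" "Y2 differentiable (at (F x))"
    and r1: "\<And>y. y \<in> S \<Longrightarrow> frechet_derivative F (at y) (X1 y) = Y1 (F y)"
    and r2: "\<And>y. y \<in> S \<Longrightarrow> frechet_derivative F (at y) (X2 y) = Y2 (F y)"
  shows "frechet_derivative F (at x) (coord_bracket X1 X2 x) = coord_bracket Y1 Y2 (F x)"
proof -
  let ?D = "\<lambda>y. frechet_derivative F (at y)"
  let ?E = "\<lambda>v. frechet_derivative (\<lambda>y. ?D y v) (at x)"
  have d1: "F differentiable (at y)" if "y \<in> S" for y
    using F that by (simp add: numeral_2_eq_2)
  have d2: "(\<lambda>y. ?D y v) differentiable (at x)" for v
    using F S(2) by (simp add: numeral_2_eq_2)
  have key: "?E (X x) h + ?D x (frechet_derivative X (at x) h) = frechet_derivative Y (at (F x)) (?D x h)"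
    if X: "X differentiable (at x)" and Y: "Y differentiable (at (F x))"
      and r: "\<And>y. y \<in> S \<Longrightarrow> ?D y (X y) = Y (F y)" for X Y h
  proof -
    have "((\<lambda>y. ?D y (X y)) has_derivative (\<lambda>h. ?E (X x) h + ?D x (frechet_derivative X (at x) h))) (at x)"
      by (rule has_derivative_family_apply[OF i S d1 d2 has_frechet_derivative[OF X]])
    then have 1: "((\<lambda>y. Y (F y)) has_derivative (\<lambda>h. ?E (X x) h + ?D x (frechet_derivative X (at x) h))) (at x)"
      by (rule has_derivative_transform_within_open[OF _ S]) (rule r)
    have 2: "((\<lambda>y. Y (F y)) has_derivative (\<lambda>h. frechet_derivative Y (at (F x)) (?D x h))) (at x)"
      by (rule has_derivative_compose[OF has_frechet_derivative[OF d1[OF S(2)]] has_frechet_derivative[OF Y]])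
    show ?thesis using has_derivative_unique[OF 1 2] by metis
  qed
  have sym: "?E (X2 x) (X1 x) = ?E (X1 x) (X2 x)"
    by (rule symmetric_second_derivative[OF j S F])
  have lin: "linear (?D x)" by (rule linear_frechet_derivative[OF d1[OF S(2)]])
  have "?D x (coord_bracket X1 X2 x) = ?D x (frechet_derivative X2 (at x) (X1 x)) - ?D x (frechet_derivative X1 (at x) (X2 x))"
    unfolding coord_bracket_def by (rule linear_diff[OF lin])
  also have "\<dots> = frechet_derivative Y2 (at (F x)) (?D x (X1 x)) - frechet_derivative Y1 (at (F x)) (?D x (X2 x))"
    using key[OF X(2) Y(2) r2, of "X1 x"] key[OF X(1) Y(1) r1, of "X2 x"] sym by (metis add_diff_cancel_left)
  also have "\<dots> = coord_bracket Y1 Y2 (F x)" by (simp add: coord_bracket_def r1 r2 S(2))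
  finally show ?thesis .
qed

text \<open>In the expanded cyclic sum the second derivatives cancel by symmetry, and the composites
  of first derivatives cancel in pairs.\<close>

lemma coord_bracket_jacobi:
  fixes X Y Z :: "'d::real_normed_vector \<Rightarrow> 'd" and i :: "'d \<Rightarrow> 'e::euclidean_space"
  assumes i: "coord_pair i l" and S: "open S" "x \<in> S"
    and C: "C_on 2 S X" "C_on 2 S Y" "C_on 2 S Z"
  shows "coord_bracket (coord_bracket X Y) Z x + coord_bracket (coord_bracket Y Z) X x + coord_bracket (coord_bracket Z X) Y x = 0"
proof -
  let ?D = "\<lambda>X y. frechet_derivative X (at y)"
  let ?E = "\<lambda>X v. frechet_derivative (\<lambda>y. ?D X y v) (at x)"
  have d1: "X differentiable (at y)" if "y \<in> S" "C_on 2 S X" for X :: "'d \<Rightarrow> 'd" and y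
    using that by (simp add: numeral_2_eq_2)
  have d2: "(\<lambda>y. ?D X y v) differentiable (at x)" if "C_on 2 S X" for X :: "'d \<Rightarrow> 'd" and v
    using that S(2) by (simp add: numeral_2_eq_2)
  have fam: "((\<lambda>y. ?D Y y (X y)) has_derivative (\<lambda>h. ?E Y (X x) h + ?D Y x (?D X x h))) (at x)"
    if "C_on 2 S X" "C_on 2 S Y" for X Y :: "'d \<Rightarrow> 'd"
    by (rule has_derivative_family_apply[OF i S d1 d2 has_frechet_derivative[OF d1]])
      (use that S in auto)
  have Dv: "?D (coord_bracket X Y) x h = ?E Y (X x) h + ?D Y x (?D X x h) - (?E X (Y x) h + ?D X x (?D Y x h))"
    if "C_on 2 S X" "C_on 2 S Y" for X Y :: "'d \<Rightarrow> 'd" and h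
    using frechet_derivativeI[OF has_derivative_diff[OF fam[OF that] fam[OF that(2,1)]]]
    by (simp add: coord_bracket_def[abs_def])
  have sym: "?E X v w = ?E X w v" if "C_on 2 S X" for X :: "'d \<Rightarrow> 'd" and v w
    by (rule symmetric_second_derivative[OF i S that])
  have lin: "?D X x (v - w) = ?D X x v - ?D X x w" if "C_on 2 S X" for X :: "'d \<Rightarrow> 'd" and v w
    by (rule linear_diff[OF linear_frechet_derivative[OF d1[OF S(2) that]]])
  show ?thesis
    unfolding coord_bracket_def[of "coord_bracket _ _"] Dv[OF C(1,2)] Dv[OF C(2,3)] Dv[OF C(3,1)]
    unfolding coord_bracket_def lin[OF C(1)] lin[OF C(2)] lin[OF C(3)]
    using sym[OF C(1), of "Y x" "Z x"] sym[OF C(2), of "X x" "Z x"] sym[OF C(3), of "X x" "Y x"]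
    by simp
qed

section \<open>Charts\<close>

text \<open>A derivative between two arbitrary charts. \<open>tangent_map\<close>,
  \<open>to_chart\<close> and \<open>from_chart\<close> are all special cases, so that one chain
  rule governs them.\<close>

definition cderiv :: "('a, 'e::real_normed_vector) chart \<Rightarrow> ('a \<Rightarrow> 'b) \<Rightarrow> ('b, 'f::real_normed_vector) chart
    \<Rightarrow> 'a \<Rightarrow> 'e \<Rightarrow> 'f" where
  "cderiv c F d p = frechet_derivative (snd d \<circ> F \<circ> chart_inv c) (at (snd c p))"

lemma chart_inv_image: "chart_inv c x \<in> fst c" "snd c (chart_inv c x) = x" if "x \<in> snd c ` fst c"
  using that by (auto simp: chart_inv_def inv_into_into f_inv_into_f)

lemma chart_inv_snd: "smooth_manifold A \<Longrightarrow> c \<in> A \<Longrightarrow> p \<in> fst c \<Longrightarrow> chart_inv c (snd c p) = p"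
  by (simp add: smooth_manifold_def chart_inv_def)

lemma open_chart_image: "smooth_manifold A \<Longrightarrow> c \<in> A \<Longrightarrow> open (snd c ` fst c)"
  by (simp add: smooth_manifold_def)

lemma chart_at: "chart_at A p \<in> A" "p \<in> fst (chart_at A p)" if "p \<in> mcarrier A"
proof -
  from that have "\<exists>c. c \<in> A \<and> p \<in> fst c" by (auto simp: mcarrier_def)
  then have "chart_at A p \<in> A \<and> p \<in> fst (chart_at A p)" unfolding chart_at_def by (rule someI_ex)
  then show "chart_at A p \<in> A" "p \<in> fst (chart_at A p)" by auto
qed

lemma chart_subset: "c \<in> A \<Longrightarrow> p \<in> fst c \<Longrightarrow> p \<in> mcarrier A"
  by (auto simp: mcarrier_def)

lemma smooth_map_into: "smooth_map A B F \<Longrightarrow> p \<in> mcarrier A \<Longrightarrow> F p \<in> mcarrier B"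
  by (auto simp: smooth_map_def)

lemma smooth_map_rep:
  assumes "smooth_map A B F" "c \<in> A" "d \<in> B"
  shows "open (snd c ` {p \<in> fst c. F p \<in> fst d})"
    and "smooth_on (snd c ` {p \<in> fst c. F p \<in> fst d}) (snd d \<circ> F \<circ> chart_inv c)"
  using assms by (auto simp: smooth_map_def)

lemma has_derivative_cderiv:
  assumes "smooth_map A B F" "c \<in> A" "d \<in> B" "p \<in> fst c" "F p \<in> fst d"
  shows "((snd d \<circ> F \<circ> chart_inv c) has_derivative cderiv c F d p) (at (snd c p))"
  unfolding cderiv_def
  by (rule has_frechet_derivative, rule smooth_on_diff[OF smooth_map_rep(2)[OF assms(1-3)]])
    (use assms in auto)

lemma linear_cderiv:
  assumes "smooth_map A B F" "c \<in> A" "d \<in> B" "p \<in> fst c" "F p \<in> fst d"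
  shows "linear (cderiv c F d p)"
  using has_derivative_cderiv[OF assms] by (rule has_derivative_linear)

lemma cderiv_compose:
  assumes A: "smooth_manifold A" and B: "smooth_manifold B"
    and F: "smooth_map A B F" and H: "smooth_map B C H"
    and c: "c \<in> A" "p \<in> fst c" and d: "d \<in> B" "F p \<in> fst d" and e: "e \<in> C" "H (F p) \<in> fst e"
  shows "cderiv c (\<lambda>q. H (F q)) e p v = cderiv d H e (F p) (cderiv c F d p v)"
proof -
  let ?f = "snd d \<circ> F \<circ> chart_inv c" and ?h = "snd e \<circ> H \<circ> chart_inv d"
  let ?U = "snd c ` {q \<in> fst c. F q \<in> fst d}"
  have x: "?f (snd c p) = snd d (F p)" by (simp add: chart_inv_snd[OF A c])
  have "((\<lambda>x. ?h (?f x)) has_derivative (\<lambda>v. cderiv d H e (F p) (cderiv c F d p v))) (at (snd c p))"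
    by (rule has_derivative_compose[OF has_derivative_cderiv[OF F c(1) d(1) c(2) d(2)]])
      (use has_derivative_cderiv[OF H d(1) e(1) d(2) e(2)] in \<open>simp only: x\<close>)
  then have "((snd e \<circ> (\<lambda>q. H (F q)) \<circ> chart_inv c) has_derivative
      (\<lambda>v. cderiv d H e (F p) (cderiv c F d p v))) (at (snd c p))"
    \<comment> \<open>The two representatives agree only where \<open>F\<close> lands in the
      intermediate chart \<open>d\<close>, which is an open set of coordinates.\<close>
    by (rule has_derivative_transform_within_open[OF _ smooth_map_rep(1)[OF F c(1) d(1)]])
      (use c d in \<open>auto simp: chart_inv_snd[OF A] chart_inv_snd[OF B]\<close>)
  from fun_cong[OF frechet_derivativeI[OF this], of v] show ?thesis unfolding cderiv_def[of c _ e] .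
qed

lemma cderiv_cong:
  assumes A: "smooth_manifold A" and c: "c \<in> A" "p \<in> fst c" and eq: "\<And>q. q \<in> fst c \<Longrightarrow> F q = F' q"
  shows "cderiv c F d p = cderiv c F' d p"
  unfolding cderiv_def
  by (rule frechet_derivative_cong_open[OF open_chart_image[OF A c(1)]])
    (use c eq in \<open>auto simp: chart_inv_image chart_inv_snd[OF A]\<close>)

text \<open>Makes a change of charts the representative of a smooth map, so that
  \<open>cderiv_compose\<close> also covers conversions between charts.\<close>

lemma smooth_map_ident:
  assumes "smooth_manifold A"
  shows "smooth_map A A (\<lambda>q. q)"
proof -
  have "{p \<in> fst c. p \<in> fst d} = fst c \<inter> fst d" for c d :: "('a, 'b) chart" by auto
  then show ?thesis using assms by (auto simp: smooth_map_def smooth_manifold_def o_def)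
qed

lemma cderiv_ident:
  assumes A: "smooth_manifold A" and c: "c \<in> A" "p \<in> fst c"
  shows "cderiv c (\<lambda>q. q) c p v = v"
proof -
  have "frechet_derivative (snd c \<circ> (\<lambda>q. q) \<circ> chart_inv c) (at (snd c p)) = frechet_derivative (\<lambda>x. x) (at (snd c p))"
    by (rule frechet_derivative_cong_open[OF open_chart_image[OF A c(1)]])
      (use c in \<open>auto simp: chart_inv_image chart_inv_snd[OF A]\<close>)
  then show ?thesis by (simp add: cderiv_def)
qed

lemma tangent_map_cderiv: "tangent_map A B F p = cderiv (chart_at A p) F (chart_at B (F p)) p"
  by (simp add: tangent_map_def cderiv_def)

lemma to_chart_cderiv: "to_chart A c p = cderiv (chart_at A p) (\<lambda>q. q) c p"
  by (simp add: to_chart_def cderiv_def o_def)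

lemma from_chart_cderiv: "from_chart A c p = cderiv c (\<lambda>q. q) (chart_at A p) p"
  by (simp add: from_chart_def cderiv_def o_def)

lemma linear_to_chart: "smooth_manifold A \<Longrightarrow> c \<in> A \<Longrightarrow> p \<in> fst c \<Longrightarrow> linear (to_chart A c p)"
  unfolding to_chart_cderiv
  by (rule linear_cderiv[OF smooth_map_ident]) (auto intro: chart_at chart_subset)

lemma linear_from_chart: "smooth_manifold A \<Longrightarrow> c \<in> A \<Longrightarrow> p \<in> fst c \<Longrightarrow> linear (from_chart A c p)"
  unfolding from_chart_cderiv
  by (rule linear_cderiv[OF smooth_map_ident]) (auto intro: chart_at chart_subset)

lemma from_chart_to_chart:
  assumes A: "smooth_manifold A" and c: "c \<in> A" "p \<in> fst c"
  shows "from_chart A c p (to_chart A c p v) = v"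
  unfolding to_chart_cderiv from_chart_cderiv
  using cderiv_compose[OF A A smooth_map_ident[OF A] smooth_map_ident[OF A], of "chart_at A p" p c "chart_at A p" v]
    cderiv_ident[OF A, of "chart_at A p" p v] chart_at[OF chart_subset[OF c]] c by simp

lemma to_chart_chart_at:
  "smooth_manifold A \<Longrightarrow> p \<in> mcarrier A \<Longrightarrow> to_chart A (chart_at A p) p v = v"
  unfolding to_chart_cderiv by (rule cderiv_ident) (auto intro: chart_at)

lemma linear_tangent_map:
  assumes "smooth_map A B F" "p \<in> mcarrier A"
  shows "linear (tangent_map A B F p)"
  unfolding tangent_map_cderiv
  by (intro linear_cderiv[OF assms(1)] chart_at assms smooth_map_into[OF assms])

lemma tangent_map_compose:
  assumes A: "smooth_manifold A" and B: "smooth_manifold B"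
    and F: "smooth_map A B F" and H: "smooth_map B C H" and p: "p \<in> mcarrier A"
  shows "tangent_map A C (\<lambda>q. H (F q)) p v = tangent_map B C H (F p) (tangent_map A B F p v)"
  unfolding tangent_map_cderiv
  by (rule cderiv_compose[OF A B F H])
    (use p smooth_map_into[OF F p] smooth_map_into[OF H smooth_map_into[OF F p]] in \<open>auto intro: chart_at\<close>)

lemma tangent_map_cong:
  assumes A: "smooth_manifold A" and p: "p \<in> mcarrier A" and eq: "\<And>q. q \<in> mcarrier A \<Longrightarrow> F q = F' q"
  shows "tangent_map A B F p = tangent_map A B F' p"
  unfolding tangent_map_cderiv eq[OF p]
  by (rule cderiv_cong[OF A]) (use chart_at[OF p] eq in \<open>auto intro: chart_subset\<close>)

lemma tangent_map_ident:
  assumes "smooth_manifold A" "p \<in> mcarrier A"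
  shows "tangent_map A A (\<lambda>q. q) p v = v"
  unfolding tangent_map_cderiv by (rule cderiv_ident[OF assms(1)]) (use assms in \<open>auto intro: chart_at\<close>)

lemma to_chart_tangent_map:
  assumes A: "smooth_manifold A" and B: "smooth_manifold B" and F: "smooth_map A B F"
    and p: "p \<in> mcarrier A" and d: "d \<in> B" "F p \<in> fst d"
  shows "to_chart B d (F p) (tangent_map A B F p v) = cderiv (chart_at A p) F d p v"
  unfolding tangent_map_cderiv to_chart_cderiv
  using cderiv_compose[OF A B F smooth_map_ident[OF B], of "chart_at A p" p "chart_at B (F p)" d v]
    chart_at[OF p] chart_at[OF smooth_map_into[OF F p]] d by simp

lemma cderiv_to_chart:
  assumes A: "smooth_manifold A" and F: "smooth_map A B F"
    and c: "c \<in> A" "p \<in> fst c" and d: "d \<in> B" "F p \<in> fst d"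
  shows "cderiv c F d p (to_chart A c p v) = cderiv (chart_at A p) F d p v"
  unfolding to_chart_cderiv
  using cderiv_compose[OF A A smooth_map_ident[OF A] F, of "chart_at A p" p c d v]
    chart_at[OF chart_subset[OF c]] c d by simp

text \<open>The preferred charts cancel by the chain rule, so a relation between fields on the
  manifolds becomes the coordinate relation required by
  \<open>coord_bracket_related\<close>.\<close>

lemma field_in_chart_related:
  assumes A: "smooth_manifold A" and B: "smooth_manifold B" and F: "smooth_map A B F"
    and c: "c \<in> A" and d: "d \<in> B" and y: "y \<in> snd c ` {p \<in> fst c. F p \<in> fst d}"
    and r: "\<And>q. q \<in> mcarrier A \<Longrightarrow> tangent_map A B F q (X q) = Y (F q)"
  shows "frechet_derivative (snd d \<circ> F \<circ> chart_inv c) (at y) (field_in_chart A c X y)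
    = field_in_chart B d Y ((snd d \<circ> F \<circ> chart_inv c) y)"
proof -
  obtain p where p: "p \<in> fst c" "F p \<in> fst d" "y = snd c p" using y by auto
  have pA: "p \<in> mcarrier A" by (rule chart_subset[OF c p(1)])
  have "frechet_derivative (snd d \<circ> F \<circ> chart_inv c) (at y) (field_in_chart A c X y)
      = cderiv c F d p (to_chart A c p (X p))"
    by (simp add: cderiv_def p(3) field_in_chart_def chart_inv_snd[OF A c p(1)])
  also have "\<dots> = to_chart B d (F p) (Y (F p))"
    using cderiv_to_chart[OF A F c p(1) d p(2)] to_chart_tangent_map[OF A B F pA d p(2)] r[OF pA] by metis
  also have "\<dots> = field_in_chart B d Y ((snd d \<circ> F \<circ> chart_inv c) y)"
    by (simp add: p(3) field_in_chart_def chart_inv_snd[OF A c p(1)] chart_inv_snd[OF B d p(2)])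
  finally show ?thesis .
qed

lemma smooth_field_diff:
  assumes "smooth_field A X" "c \<in> A" "p \<in> fst c"
  shows "field_in_chart A c X differentiable (at (snd c p))"
  using assms smooth_on_diff unfolding smooth_field_def by blast

lemma lie_bracket_coord_bracket:
  "lie_bracket A X Y p = coord_bracket (field_in_chart A (chart_at A p) X) (field_in_chart A (chart_at A p) Y) (snd (chart_at A p) p)"
  by (simp add: lie_bracket_def coord_bracket_def Let_def)

text \<open>The charts are left arbitrary for two uses: with the identity map this is independence
  of the bracket from the chart, and with preferred charts it is naturality under smooth
  maps.\<close>

lemma coord_bracket_field_related:
  fixes A :: "('a, 'd::real_normed_vector) chart set" and B :: "('b, 'c::real_normed_vector) chart set"
    and i :: "'d \<Rightarrow> 'e::euclidean_space" and j :: "'c \<Rightarrow> 'f::euclidean_space"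
  assumes i: "coord_pair i l" and j: "coord_pair j k"
    and A: "smooth_manifold A" and B: "smooth_manifold B" and F: "smooth_map A B F"
    and c: "c \<in> A" "p \<in> fst c" and d: "d \<in> B" "F p \<in> fst d"
    and X: "smooth_field A X1" "smooth_field A X2" and Y: "smooth_field B Y1" "smooth_field B Y2"
    and r1: "\<And>q. q \<in> mcarrier A \<Longrightarrow> tangent_map A B F q (X1 q) = Y1 (F q)"
    and r2: "\<And>q. q \<in> mcarrier A \<Longrightarrow> tangent_map A B F q (X2 q) = Y2 (F q)"
  shows "cderiv c F d p (coord_bracket (field_in_chart A c X1) (field_in_chart A c X2) (snd c p))
    = coord_bracket (field_in_chart B d Y1) (field_in_chart B d Y2) (snd d (F p))"
proof -
  let ?F = "snd d \<circ> F \<circ> chart_inv c"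
  have Fx: "?F (snd c p) = snd d (F p)" by (simp add: chart_inv_snd[OF A c])
  have "frechet_derivative ?F (at (snd c p)) (coord_bracket (field_in_chart A c X1) (field_in_chart A c X2) (snd c p))
     = coord_bracket (field_in_chart B d Y1) (field_in_chart B d Y2) (?F (snd c p))"
  proof (rule coord_bracket_related[OF i j smooth_map_rep(1)[OF F c(1) d(1)]])
    show "snd c p \<in> snd c ` {p \<in> fst c. F p \<in> fst d}" using c d by auto
    show "C_on 2 (snd c ` {p \<in> fst c. F p \<in> fst d}) ?F"
      using smooth_map_rep(2)[OF F c(1) d(1)] by (simp add: smooth_on_def)
    show "field_in_chart A c X1 differentiable at (snd c p)" "field_in_chart A c X2 differentiable at (snd c p)"
      by (intro smooth_field_diff X c)+
    show "field_in_chart B d Y1 differentiable at (?F (snd c p))"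
         "field_in_chart B d Y2 differentiable at (?F (snd c p))"
      unfolding Fx by (intro smooth_field_diff Y d)+
  qed (intro field_in_chart_related[OF A B F c(1) d(1)] r1 r2; assumption)+
  then show ?thesis unfolding cderiv_def Fx .
qed

lemma lie_bracket_related:
  fixes A :: "('a, 'd::real_normed_vector) chart set" and B :: "('b, 'c::real_normed_vector) chart set"
    and i :: "'d \<Rightarrow> 'e::euclidean_space" and j :: "'c \<Rightarrow> 'f::euclidean_space"
  assumes i: "coord_pair i l" and j: "coord_pair j k"
    and A: "smooth_manifold A" and B: "smooth_manifold B" and F: "smooth_map A B F"
    and p: "p \<in> mcarrier A"
    and X: "smooth_field A X1" "smooth_field A X2" and Y: "smooth_field B Y1" "smooth_field B Y2"
    and r1: "\<And>q. q \<in> mcarrier A \<Longrightarrow> tangent_map A B F q (X1 q) = Y1 (F q)"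
    and r2: "\<And>q. q \<in> mcarrier A \<Longrightarrow> tangent_map A B F q (X2 q) = Y2 (F q)"
  shows "tangent_map A B F p (lie_bracket A X1 X2 p) = lie_bracket B Y1 Y2 (F p)"
  unfolding lie_bracket_coord_bracket tangent_map_cderiv
  by (rule coord_bracket_field_related[OF i j A B F chart_at[OF p] chart_at[OF smooth_map_into[OF F p]] X Y r1 r2])

lemma to_chart_lie_bracket:
  fixes A :: "('a, 'd::real_normed_vector) chart set" and i :: "'d \<Rightarrow> 'e::euclidean_space"
  assumes i: "coord_pair i l" and A: "smooth_manifold A" and c: "c \<in> A" "p \<in> fst c"
    and X: "smooth_field A X" and Y: "smooth_field A Y"
  shows "to_chart A c p (lie_bracket A X Y p) = coord_bracket (field_in_chart A c X) (field_in_chart A c Y) (snd c p)"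
  unfolding lie_bracket_coord_bracket to_chart_cderiv
  by (rule coord_bracket_field_related[OF i i A A smooth_map_ident[OF A] chart_at[OF chart_subset[OF c]] c X Y X Y])
    (auto simp: tangent_map_ident[OF A])

lemma coord_bracket_cong:
  assumes "open S" "x \<in> S" "\<And>y. y \<in> S \<Longrightarrow> X y = X' y"
  shows "coord_bracket X Y x = coord_bracket X' Y x"
  using assms frechet_derivative_cong_open[OF assms] by (simp add: coord_bracket_def)

text \<open>Chart independence identifies the inner bracket with a coordinate bracket on the whole
  domain of the chart at \<open>p\<close>, hence also inside a derivative.\<close>

lemma lie_bracket_jacobi:
  fixes A :: "('a, 'd::real_normed_vector) chart set" and i :: "'d \<Rightarrow> 'e::euclidean_space"
  assumes i: "coord_pair i l" and A: "smooth_manifold A" and p: "p \<in> mcarrier A"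
    and X: "smooth_field A X" and Y: "smooth_field A Y" and Z: "smooth_field A Z"
  shows "lie_bracket A (lie_bracket A X Y) Z p + lie_bracket A (lie_bracket A Y Z) X p
    + lie_bracket A (lie_bracket A Z X) Y p = 0"
proof -
  let ?c = "chart_at A p"
  let ?f = "field_in_chart A ?c" and ?S = "snd ?c ` fst ?c"
  have c: "?c \<in> A" "p \<in> fst ?c" using chart_at[OF p] .
  have S: "open ?S" "snd ?c p \<in> ?S" using open_chart_image[OF A c(1)] c by auto
  have f: "?f (lie_bracket A X Y) x = coord_bracket (?f X) (?f Y) x"
    if "x \<in> ?S" "smooth_field A X" "smooth_field A Y" for x X Y
    using to_chart_lie_bracket[OF i A c(1) chart_inv_image(1)[OF that(1)] that(2,3)] chart_inv_image(2)[OF that(1)]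
    by (simp add: field_in_chart_def[of _ _ "lie_bracket A X Y"])
  have C: "C_on 2 ?S (?f X)" if "smooth_field A X" for X
    using that c(1) by (simp add: smooth_field_def smooth_on_def)
  have vf: "lie_bracket A (lie_bracket A X Y) W p = coord_bracket (coord_bracket (?f X) (?f Y)) (?f W) (snd ?c p)"
    if "smooth_field A X" "smooth_field A Y" for X Y W
    unfolding lie_bracket_coord_bracket[of A "lie_bracket A X Y"] by (rule coord_bracket_cong[OF S f[OF _ that]])
  show ?thesis
    unfolding vf[OF X Y] vf[OF Y Z] vf[OF Z X]
    by (rule coord_bracket_jacobi[OF i S C[OF X] C[OF Y] C[OF Z]])
qed

section \<open>Lie groups\<close>

locale lie_group_coord =
  fixes G :: "'a monoid" (structure)
    and A :: "('a, 'e::real_normed_vector) chart set"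
    and i :: "'e \<Rightarrow> 'f::euclidean_space" and l :: "'f \<Rightarrow> 'e"
  assumes lie: "lie_group G A" and coord: "coord_pair i l"

sublocale lie_group_coord \<subseteq> group G
  using lie by (simp add: lie_group_def)

context lie_group_coord
begin

lemma group_manifold: "smooth_manifold A" and mcarrier_eq[simp]: "mcarrier A = carrier G"
  using lie by (auto simp: lie_group_def)

section \<open>Multiplication and translations in charts\<close>

definition "mul_rep c1 c2 d = (\<lambda>z. snd d (chart_inv c1 (fst z) \<otimes> chart_inv c2 (snd z)))"
definition "mul_dom c1 c2 d = {z. fst z \<in> snd c1 ` fst c1 \<and> snd z \<in> snd c2 ` fst c2 \<and>
   chart_inv c1 (fst z) \<otimes> chart_inv c2 (snd z) \<in> fst d}"

lemma chart_carrier: "c \<in> A \<Longrightarrow> p \<in> fst c \<Longrightarrow> p \<in> carrier G"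
  using chart_subset[of c A p] by simp

text \<open>The inverse of a product chart is a choice-based inverse of \<open>map_prod\<close>.
  Injectivity on the domain makes it componentwise, which transfers smoothness to
  \<open>mul_rep\<close>.\<close>

lemma mul_rep:
  assumes c: "c1 \<in> A" "c2 \<in> A" "d \<in> A"
  shows "open (mul_dom c1 c2 d)" "smooth_on (mul_dom c1 c2 d) (mul_rep c1 c2 d)"
proof -
  let ?F = "\<lambda>(x, y). x \<otimes> y"
  let ?c = "(fst c1 \<times> fst c2, map_prod (snd c1) (snd c2))"
  have m: "smooth_map (prod_atlas A A) A ?F" using lie by (simp add: lie_group_def)
  have cc: "?c \<in> prod_atlas A A" unfolding prod_atlas_def using c by blast
  have dom: "mul_dom c1 c2 d = snd ?c ` {p \<in> fst ?c. ?F p \<in> fst d}"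
  proof safe
    fix x y assume "(x, y) \<in> mul_dom c1 c2 d"
    then have "x \<in> snd c1 ` fst c1" "y \<in> snd c2 ` fst c2" "chart_inv c1 x \<otimes> chart_inv c2 y \<in> fst d"
      by (auto simp: mul_dom_def)
    then show "(x, y) \<in> snd ?c ` {p \<in> fst ?c. ?F p \<in> fst d}"
      by (intro image_eqI[of _ _ "(chart_inv c1 x, chart_inv c2 y)"]) (auto simp: chart_inv_image)
  qed (use c in \<open>auto simp: mul_dom_def chart_inv_snd[OF group_manifold]\<close>)
  have inj: "inj_on (snd ?c) (fst ?c)"
    using c group_manifold map_prod_inj_on[of "snd c1" "fst c1" "snd c2" "fst c2"] by (simp add: smooth_manifold_def)
  show op: "open (mul_dom c1 c2 d)" unfolding dom by (rule smooth_map_rep(1)[OF m cc c(3)])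
  have "smooth_on (mul_dom c1 c2 d) (snd d \<circ> ?F \<circ> chart_inv ?c)"
    unfolding dom by (rule smooth_map_rep(2)[OF m cc c(3)])
  then show "smooth_on (mul_dom c1 c2 d) (mul_rep c1 c2 d)"
  proof (rule smooth_on_cong[OF op, rotated])
    fix z assume "z \<in> mul_dom c1 c2 d"
    then obtain p q where "p \<in> fst c1" "q \<in> fst c2" "z = snd ?c (p, q)" unfolding dom by auto
    moreover from this have "chart_inv ?c z = (p, q)"
      using inv_into_f_f[OF inj, of "(p, q)"] by (simp add: chart_inv_def)
    ultimately show "(snd d \<circ> ?F \<circ> chart_inv ?c) z = mul_rep c1 c2 d z"
      using c by (simp add: mul_rep_def chart_inv_snd[OF group_manifold])
  qed
qed

lemma bounded_linear_Pair_left: "bounded_linear (\<lambda>x. (x, 0))"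
  and bounded_linear_Pair_right: "bounded_linear (\<lambda>x. (0, x))"
  by (auto intro!: bounded_linear_Pair bounded_linear_ident bounded_linear_zero)

text \<open>A translation is the multiplication restricted to a slice through the coordinate of
  \<open>a\<close>, that is, composed with an affine embedding.\<close>

lemma
  assumes a: "a \<in> carrier G"
  shows smooth_map_left: "smooth_map A A (\<lambda>q. a \<otimes> q)"
    and smooth_map_right: "smooth_map A A (\<lambda>q. q \<otimes> a)"
proof -
  let ?b = "chart_at A a"
  have b: "?b \<in> A" "a \<in> fst ?b" using chart_at[of a A] a by auto
  {
    fix c d assume c: "c \<in> A" "d \<in> A"
    let ?S = "snd c ` {p \<in> fst c. a \<otimes> p \<in> fst d}"
    have S: "?S = {y. (snd ?b a, 0) + (0, y) \<in> mul_dom ?b c d}"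
      using b c by (auto simp: mul_dom_def chart_inv_snd[OF group_manifold])
    have op: "open ?S"
    proof -
      have "open ((\<lambda>y. (snd ?b a, 0) + (0, y)) -` mul_dom ?b c d)"
        by (intro continuous_open_vimage mul_rep b c continuous_intros)
      then show ?thesis unfolding S by (simp add: vimage_def)
    qed
    have "smooth_on ?S (\<lambda>y. mul_rep ?b c d ((snd ?b a, 0) + (0, y)))"
      by (rule smooth_on_compose_affine[OF bounded_linear_Pair_right op _ mul_rep(2)[OF b(1) c]]) (simp only: S mem_Collect_eq)
    then have "smooth_on ?S (snd d \<circ> (\<lambda>q. a \<otimes> q) \<circ> chart_inv c)"
      by (rule smooth_on_cong[OF op, rotated]) (use b in \<open>simp add: mul_rep_def chart_inv_snd[OF group_manifold]\<close>)
    note op this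
  }
  then show "smooth_map A A (\<lambda>q. a \<otimes> q)" using a by (auto simp: smooth_map_def)
  {
    fix c d assume c: "c \<in> A" "d \<in> A"
    let ?S = "snd c ` {p \<in> fst c. p \<otimes> a \<in> fst d}"
    have S: "?S = {y. (0, snd ?b a) + (y, 0) \<in> mul_dom c ?b d}"
      using b c by (auto simp: mul_dom_def chart_inv_snd[OF group_manifold])
    have op: "open ?S"
    proof -
      have "open ((\<lambda>y. (0, snd ?b a) + (y, 0)) -` mul_dom c ?b d)"
        by (intro continuous_open_vimage mul_rep b c continuous_intros)
      then show ?thesis unfolding S by (simp add: vimage_def)
    qed
    have "smooth_on ?S (\<lambda>y. mul_rep c ?b d ((0, snd ?b a) + (y, 0)))"
      by (rule smooth_on_compose_affine[OF bounded_linear_Pair_left op _ mul_rep(2)[OF c(1) b(1) c(2)]]) (simp only: S mem_Collect_eq)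
    then have "smooth_on ?S (snd d \<circ> (\<lambda>q. q \<otimes> a) \<circ> chart_inv c)"
      by (rule smooth_on_cong[OF op, rotated]) (use b in \<open>simp add: mul_rep_def chart_inv_snd[OF group_manifold]\<close>)
    note op this
  }
  then show "smooth_map A A (\<lambda>q. q \<otimes> a)" using a by (auto simp: smooth_map_def)
qed

text \<open>Both translations are slices of one map, so their derivatives are its two partial
  derivatives. This is what later allows symmetry of the second derivative to compare left with
  right.\<close>

lemma
  assumes c: "c1 \<in> A" "c2 \<in> A" "d \<in> A" and p: "p \<in> fst c1" "q \<in> fst c2" "p \<otimes> q \<in> fst d"
  shows cderiv_left: "cderiv c2 (\<lambda>r. p \<otimes> r) d q v
      = frechet_derivative (mul_rep c1 c2 d) (at (snd c1 p, snd c2 q)) (0, v)"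
    and cderiv_right: "cderiv c1 (\<lambda>r. r \<otimes> q) d p v
      = frechet_derivative (mul_rep c1 c2 d) (at (snd c1 p, snd c2 q)) (v, 0)"
proof -
  let ?M = "mul_rep c1 c2 d" and ?D = "frechet_derivative (mul_rep c1 c2 d) (at (snd c1 p, snd c2 q))"
  have "(snd c1 p, snd c2 q) \<in> mul_dom c1 c2 d"
    using p c by (auto simp: mul_dom_def chart_inv_snd[OF group_manifold])
  then have M: "(?M has_derivative ?D) (at (snd c1 p, snd c2 q))"
    by (intro has_frechet_derivative smooth_on_diff[OF mul_rep(2)[OF c]])
  have "((\<lambda>y. ?M (snd c1 p, y)) has_derivative (\<lambda>v. ?D (0, v))) (at (snd c2 q))"
    by (rule has_derivative_compose[of "\<lambda>y. (snd c1 p, y)"]) (auto intro!: derivative_eq_intros M)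
  moreover have "(\<lambda>y. ?M (snd c1 p, y)) = snd d \<circ> (\<lambda>r. p \<otimes> r) \<circ> chart_inv c2"
    using c p by (auto simp: mul_rep_def chart_inv_snd[OF group_manifold])
  ultimately show "cderiv c2 (\<lambda>r. p \<otimes> r) d q v = ?D (0, v)"
    unfolding cderiv_def by (simp add: frechet_derivativeI)
  have "((\<lambda>x. ?M (x, snd c2 q)) has_derivative (\<lambda>v. ?D (v, 0))) (at (snd c1 p))"
    by (rule has_derivative_compose[of "\<lambda>x. (x, snd c2 q)"]) (auto intro!: derivative_eq_intros M)
  moreover have "(\<lambda>x. ?M (x, snd c2 q)) = snd d \<circ> (\<lambda>r. r \<otimes> q) \<circ> chart_inv c1"
    using c p by (auto simp: mul_rep_def chart_inv_snd[OF group_manifold])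
  ultimately show "cderiv c1 (\<lambda>r. r \<otimes> q) d p v = ?D (v, 0)"
    unfolding cderiv_def by (simp add: frechet_derivativeI)
qed

abbreviation "c0 \<equiv> chart_at A \<one>"
abbreviation "e0 \<equiv> snd c0 \<one>"
abbreviation "lfield \<equiv> left_invariant_field G A"
abbreviation "br \<equiv> lie_algebra_bracket G A"
abbreviation "lt \<equiv> left_translate G A"

lemma c0: "c0 \<in> A" "\<one> \<in> fst c0"
  using chart_at[of \<one> A] by auto

lemma field_in_chart_left:
  assumes c: "c \<in> A" "x \<in> snd c ` fst c"
  shows "field_in_chart A c (lfield u) x = frechet_derivative (mul_rep c c0 c) (at (x, e0)) (0, u)"
proof -
  obtain p where p: "p \<in> fst c" "x = snd c p" using c by auto
  have pG: "p \<in> carrier G" using chart_carrier c p by blast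
  have "field_in_chart A c (lfield u) x = to_chart A c (p \<otimes> \<one>) (tangent_map A A (\<lambda>q. p \<otimes> q) \<one> u)"
    using pG by (simp add: field_in_chart_def p chart_inv_snd[OF group_manifold c(1)] left_invariant_field_def left_translate_def)
  also have "\<dots> = cderiv c0 (\<lambda>q. p \<otimes> q) c \<one> u"
    by (rule to_chart_tangent_map[OF group_manifold group_manifold smooth_map_left[OF pG]]) (use pG p c in auto)
  also have "\<dots> = frechet_derivative (mul_rep c c0 c) (at (x, e0)) (0, u)"
    using cderiv_left[OF c(1) c0(1) c(1) p(1) c0(2)] pG p by simp
  finally show ?thesis .
qed

text \<open>As its base point varies, \<open>right_translate G A p \<one> u\<close> is the
  right-invariant field through \<open>u\<close>; it is needed to exploit a right-invariant
  metric.\<close>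

lemma to_chart_right_translate:
  assumes c: "c \<in> A" "x \<in> snd c ` fst c"
  shows "to_chart A c (chart_inv c x) (right_translate G A (chart_inv c x) \<one> u)
    = frechet_derivative (mul_rep c0 c c) (at (e0, x)) (u, 0)"
proof -
  obtain p where p: "p \<in> fst c" "x = snd c p" using c by auto
  have pG: "p \<in> carrier G" using chart_carrier c p by blast
  have "to_chart A c (chart_inv c x) (right_translate G A (chart_inv c x) \<one> u)
      = to_chart A c (\<one> \<otimes> p) (tangent_map A A (\<lambda>q. q \<otimes> p) \<one> u)"
    using pG by (simp add: p chart_inv_snd[OF group_manifold c(1)] right_translate_def)
  also have "\<dots> = cderiv c0 (\<lambda>q. q \<otimes> p) c \<one> u"
    by (rule to_chart_tangent_map[OF group_manifold group_manifold smooth_map_right[OF pG]]) (use pG p c in auto)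
  also have "\<dots> = frechet_derivative (mul_rep c0 c c) (at (e0, x)) (u, 0)"
    using cderiv_right[OF c0(1) c(1) c(1) c0(2) p(1)] pG p by simp
  finally show ?thesis .
qed

lemma smooth_field_left: "smooth_field A (lfield u)"
  unfolding smooth_field_def
proof
  fix c assume c: "c \<in> A"
  let ?S = "snd c ` fst c"
  have op: "open ?S" by (rule open_chart_image[OF group_manifold c])
  have "(0, e0) + (x, 0) \<in> mul_dom c c0 c" if "x \<in> ?S" for x
    using that c c0 chart_carrier[OF c] by (auto simp: mul_dom_def chart_inv_snd[OF group_manifold])
  then have "smooth_on ?S (\<lambda>x. frechet_derivative (mul_rep c c0 c) (at ((0, e0) + (x, 0))) (0, u))"
    by (rule smooth_on_compose_affine[OF bounded_linear_Pair_left op _ smooth_on_deriv[OF mul_rep(2)[OF c c0(1) c]]])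
  then show "smooth_on ?S (field_in_chart A c (lfield u))"
    by (rule smooth_on_cong[OF op, rotated]) (simp add: field_in_chart_left[OF c])
qed

lemma left_translate_compose:
  assumes "a \<in> carrier G" "b \<in> carrier G" "p \<in> carrier G"
  shows "lt a (b \<otimes> p) (lt b p v) = lt (a \<otimes> b) p v"
proof -
  have "lt (a \<otimes> b) p v = tangent_map A A (\<lambda>q. a \<otimes> (b \<otimes> q)) p v"
    unfolding left_translate_def by (subst tangent_map_cong[OF group_manifold]) (use assms in \<open>auto simp: m_assoc\<close>)
  also have "\<dots> = lt a (b \<otimes> p) (lt b p v)"
    unfolding left_translate_def
    by (rule tangent_map_compose[OF group_manifold group_manifold smooth_map_left smooth_map_left]) (use assms in auto)
  finally show ?thesis by simp
qed

lemma left_translate_one: "p \<in> carrier G \<Longrightarrow> lt \<one> p v = v"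
  unfolding left_translate_def
  by (subst tangent_map_cong[OF group_manifold, of _ _ "\<lambda>q. q"]) (auto simp: tangent_map_ident[OF group_manifold])

lemma linear_left_translate: "a \<in> carrier G \<Longrightarrow> p \<in> carrier G \<Longrightarrow> linear (lt a p)"
  unfolding left_translate_def by (rule linear_tangent_map[OF smooth_map_left]) auto

lemma left_translate_inv:
  assumes "p \<in> carrier G"
  shows "lt (inv p) p (lt p \<one> v) = v" "lt p \<one> (lt (inv p) p v) = v"
  using left_translate_compose[of "inv p" p \<one> v] left_translate_compose[of p "inv p" p v] assms
  by (auto simp: left_translate_one)

lemma left_translate_lfield:
  "a \<in> carrier G \<Longrightarrow> p \<in> carrier G \<Longrightarrow> lt a p (lfield u p) = lfield u (a \<otimes> p)"
  unfolding left_invariant_field_def using left_translate_compose[of a p \<one> u] by simp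

text \<open>Left translation relates each left-invariant field to itself, so naturality makes their
  bracket left-invariant too.\<close>

lemma lie_bracket_lfield:
  assumes p: "p \<in> carrier G"
  shows "lie_bracket A (lfield u) (lfield v) p = lfield (br u v) p"
proof -
  have "tangent_map A A (\<lambda>q. p \<otimes> q) \<one> (lie_bracket A (lfield u) (lfield v) \<one>)
    = lie_bracket A (lfield u) (lfield v) (p \<otimes> \<one>)"
    by (rule lie_bracket_related[OF coord coord group_manifold group_manifold smooth_map_left[OF p]])
      (use p left_translate_lfield in \<open>auto simp: smooth_field_left left_translate_def\<close>)
  then show ?thesis
    using p by (simp add: left_invariant_field_def left_translate_def lie_algebra_bracket_def)
qed

text \<open>The bracket of two left-invariant fields is again such a field only on the carrier; this
  permits the replacement inside an outer bracket.\<close>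

lemma lie_bracket_cong:
  assumes p: "p \<in> mcarrier A" and eq: "\<And>q. q \<in> mcarrier A \<Longrightarrow> X q = X' q"
  shows "lie_bracket A X Y p = lie_bracket A X' Y p"
  unfolding lie_bracket_coord_bracket
proof (rule coord_bracket_cong)
  note c = chart_at[OF p]
  show "open (snd (chart_at A p) ` fst (chart_at A p))" by (rule open_chart_image[OF group_manifold c(1)])
  show "field_in_chart A (chart_at A p) X y = field_in_chart A (chart_at A p) X' y"
    if "y \<in> snd (chart_at A p) ` fst (chart_at A p)" for y
    using eq[OF chart_subset[OF c(1) chart_inv_image(1)[OF that]]] by (simp add: field_in_chart_def)
qed (use chart_at[OF p] in auto)

lemma br_jacobi: "br (br u v) w + br (br v w) u + br (br w u) v = 0"
proof -
  have "br (br u v) w = lie_bracket A (lie_bracket A (lfield u) (lfield v)) (lfield w) \<one>" for u v w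
    unfolding lie_algebra_bracket_def[of _ _ "br u v"]
    by (rule lie_bracket_cong[symmetric]) (simp_all add: lie_bracket_lfield)
  then show ?thesis
    using lie_bracket_jacobi[OF coord group_manifold _ smooth_field_left smooth_field_left smooth_field_left] by simp
qed

lemma br_antisym: "br u v = - br v u"
  by (simp add: lie_algebra_bracket_def lie_bracket_coord_bracket coord_bracket_def)

section \<open>The Lie bracket from the second derivative of the multiplication\<close>

text \<open>Only mixed values are used below: one argument in the first factor and the other in the
  second.\<close>

definition "hess z w = frechet_derivative (\<lambda>y. frechet_derivative (mul_rep c0 c0 c0) (at y) w) (at (e0, e0)) z"

lemma e0_dom: "(e0, e0) \<in> mul_dom c0 c0 c0"
  using c0 by (auto simp: mul_dom_def chart_inv_snd[OF group_manifold])

lemma hess_sym: "hess z w = hess w z"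
  unfolding hess_def
  by (rule symmetric_second_derivative[OF coord mul_rep(1)[OF c0(1) c0(1) c0(1)] e0_dom])
    (use mul_rep(2)[OF c0(1) c0(1) c0(1)] in \<open>simp add: smooth_on_def\<close>)

lemma has_derivative_hess:
  "((\<lambda>y. frechet_derivative (mul_rep c0 c0 c0) (at y) w) has_derivative (\<lambda>z. hess z w)) (at (e0, e0))"
  unfolding hess_def
  by (rule has_frechet_derivative[OF smooth_on_diff[OF smooth_on_deriv[OF mul_rep(2)[OF c0(1) c0(1) c0(1)]] e0_dom]])

lemma linear_hess: "linear (\<lambda>z. hess z w)"
  using has_derivative_hess by (rule has_derivative_linear)

lemma e0_open: "open (snd c0 ` fst c0)" "e0 \<in> snd c0 ` fst c0"
  using open_chart_image[OF group_manifold c0(1)] c0 by auto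

lemma has_derivative_lfield:
  "(field_in_chart A c0 (lfield u) has_derivative (\<lambda>h. hess (h, 0) (0, u))) (at e0)"
proof -
  have "((\<lambda>x. frechet_derivative (mul_rep c0 c0 c0) (at (x, e0)) (0, u)) has_derivative (\<lambda>h. hess (h, 0) (0, u))) (at e0)"
    by (rule has_derivative_compose[of "\<lambda>x. (x, e0)"]) (auto intro!: derivative_eq_intros has_derivative_hess)
  then show ?thesis
    by (rule has_derivative_transform_within_open[OF _ e0_open]) (simp add: field_in_chart_left[OF c0(1)])
qed

lemma has_derivative_right_translate:
  "((\<lambda>x. to_chart A c0 (chart_inv c0 x) (right_translate G A (chart_inv c0 x) \<one> u))
     has_derivative (\<lambda>h. hess (0, h) (u, 0))) (at e0)"
proof -
  have "((\<lambda>x. frechet_derivative (mul_rep c0 c0 c0) (at (e0, x)) (u, 0)) has_derivative (\<lambda>h. hess (0, h) (u, 0))) (at e0)"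
    by (rule has_derivative_compose[of "\<lambda>x. (e0, x)"]) (auto intro!: derivative_eq_intros has_derivative_hess)
  then show ?thesis
    by (rule has_derivative_transform_within_open[OF _ e0_open]) (simp add: to_chart_right_translate[OF c0(1)])
qed

lemma lfield_one: "lfield u \<one> = u"
  by (simp add: left_invariant_field_def left_translate_one)

lemma field_in_chart_left_e0: "field_in_chart A c0 (lfield u) e0 = u"
  using c0 to_chart_chart_at[OF group_manifold, of \<one> u] by (simp add: field_in_chart_def chart_inv_snd[OF group_manifold] lfield_one)

text \<open>In coordinates the derivative at the identity of the left-invariant field through
  \<open>v\<close>, in direction \<open>u\<close>, is \<open>hess (u, 0) (0, v)\<close>.\<close>

lemma br_hess: "br u v = hess (u, 0) (0, v) - hess (v, 0) (0, u)"
  unfolding lie_algebra_bracket_def lie_bracket_coord_bracket coord_bracket_def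
  by (simp add: frechet_derivativeI[OF has_derivative_lfield] field_in_chart_left_e0)

text \<open>\<open>hess\<close> is linear in its first argument because it is a derivative there;
  symmetry moves \<open>u\<close> into that argument in the second term.\<close>

lemma linear_br_left: "linear (\<lambda>u. br u v)"
proof -
  have "linear (\<lambda>u. hess (u, 0) (0, v))"
    using linear_compose[OF bounded_linear.linear[OF bounded_linear_Pair_left] linear_hess[of "(0, v)"]] by (simp add: o_def)
  moreover have "linear (\<lambda>u. hess (0, u) (v, 0))"
    using linear_compose[OF bounded_linear.linear[OF bounded_linear_Pair_right] linear_hess[of "(v, 0)"]] by (simp add: o_def)
  ultimately have "linear (\<lambda>u. hess (u, 0) (0, v) - hess (0, u) (v, 0))" by (rule linear_compose_sub)
  then show ?thesis by (simp add: br_hess hess_sym[of "(v, 0)"])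
qed

lemma linear_br_right: "linear (br u)"
proof -
  have eq: "br u = (\<lambda>v. - br v u)" by (rule ext) (rule br_antisym)
  show ?thesis by (subst eq) (rule linear_compose_neg[OF linear_br_left])
qed

end

section \<open>Lie algebras with an invariant inner product\<close>

definition positive_form :: "('k::real_vector \<Rightarrow> 'k \<Rightarrow> real) \<Rightarrow> bool" where
  "positive_form q \<longleftrightarrow> bilinear q \<and> (\<forall>u v. q u v = q v u) \<and> (\<forall>u. u \<noteq> 0 \<longrightarrow> q u u > 0)"

definition orthonormal_basis :: "('k::real_vector \<Rightarrow> 'k \<Rightarrow> real) \<Rightarrow> 'k set \<Rightarrow> bool" where
  "orthonormal_basis q E \<longleftrightarrow> finite E \<and> span E = UNIV \<and> (\<forall>e\<in>E. \<forall>f\<in>E. q e f = (if e = f then 1 else 0))"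

lemma bilinear_sum_left: "bilinear q \<Longrightarrow> q (\<Sum>i\<in>I. c i *\<^sub>R f i) y = (\<Sum>i\<in>I. c i *\<^sub>R q (f i) y)"
  using linear_sum[of "\<lambda>x. q x y" "\<lambda>i. c i *\<^sub>R f i" I] linear_cmul[of "\<lambda>x. q x y"]
  by (simp add: bilinear_def)

lemma bilinear_sum_right: "bilinear q \<Longrightarrow> q x (\<Sum>i\<in>I. c i *\<^sub>R f i) = (\<Sum>i\<in>I. c i *\<^sub>R q x (f i))"
  using linear_sum[of "q x" "\<lambda>i. c i *\<^sub>R f i" I] linear_cmul[of "q x"]
  by (simp add: bilinear_def)

lemma orthonormal_residual:
  assumes q: "bilinear q" and E: "finite E" "\<forall>e\<in>E. \<forall>f\<in>E. q e f = (if e = f then 1 else 0)"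
    and f: "f \<in> E"
  shows "q (x - (\<Sum>e\<in>E. q x e *\<^sub>R e)) f = (0::real)"
proof -
  have "q (\<Sum>e\<in>E. q x e *\<^sub>R e) f = (\<Sum>e\<in>E. q x e * q e f)"
    using bilinear_sum_left[OF q, of "q x" "\<lambda>e. e" E f] by simp
  also have "\<dots> = (\<Sum>e\<in>E. if e = f then q x e else 0)"
    by (rule sum.cong) (use E f in auto)
  also have "\<dots> = q x f" using E(1) f by simp
  finally show ?thesis by (simp add: bilinear_lsub[OF q])
qed

text \<open>Gram-Schmidt for \<open>q\<close> on a finite set that may be dependent: a vector with
  zero residual is dropped.\<close>

lemma positive_form_orthonormal_exists:
  assumes q: "positive_form q" and B: "finite B"
  shows "\<exists>E. finite E \<and> span E = span B \<and> (\<forall>e\<in>E. \<forall>f\<in>E. q e f = (if e = f then 1 else 0))"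
  using B
proof (induction B)
  case empty
  then show ?case by (intro exI[of _ "{}"]) auto
next
  case (insert b B)
  have bil: "bilinear q" and sym: "\<And>u v. q u v = q v u" and pos: "\<And>u. u \<noteq> 0 \<Longrightarrow> q u u > 0"
    using q by (auto simp: positive_form_def)
  obtain E where E: "finite E" "span E = span B" "\<forall>e\<in>E. \<forall>f\<in>E. q e f = (if e = f then 1 else 0)"
    using insert.IH by blast
  define s where "s = (\<Sum>e\<in>E. q b e *\<^sub>R e)"
  define y where "y = b - s"
  have s: "s \<in> span E" unfolding s_def by (intro span_sum span_scale span_base)
  have y: "q y e = 0" if "e \<in> E" for e
    unfolding y_def s_def by (rule orthonormal_residual[OF bil E(1,3) that])
  show ?case
  proof (cases "y = 0")
    case True
    then have "b \<in> span B" using s E(2) y_def by simp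
    then have "span (insert b B) = span B" by (rule span_redundant)
    then show ?thesis using E by metis
  next
    case False
    define n where "n = sqrt (q y y)"
    define z where "z = (1 / n) *\<^sub>R y"
    have n: "n > 0" "n * n = q y y" using pos[OF False] by (auto simp: n_def)
    have zz: "q z z = 1" using n by (simp add: z_def bilinear_lmul[OF bil] bilinear_rmul[OF bil] n(2)[symmetric])
    have ze: "q z e = 0" if "e \<in> E" for e using y[OF that] by (simp add: z_def bilinear_lmul[OF bil])
    have "b = s + n *\<^sub>R z" using n by (simp add: y_def z_def)
    moreover have "s \<in> span (insert z E)" using s span_mono[of E "insert z E"] by auto
    ultimately have "b \<in> span (insert z E)" by (auto intro!: span_add span_scale intro: span_base)
    moreover have "B \<subseteq> span (insert z E)"
      using span_superset[of B] E(2) span_mono[of E "insert z E"] by auto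
    moreover have "z \<in> span (insert b B)"
    proof -
      have "s \<in> span (insert b B)" using s E(2) span_mono[of B "insert b B"] by auto
      then show ?thesis unfolding z_def y_def by (intro span_scale span_diff) (auto intro: span_base)
    qed
    moreover have "E \<subseteq> span (insert b B)"
      using span_superset[of E] E(2) span_mono[of B "insert b B"] by auto
    ultimately have "span (insert z E) = span (insert b B)"
      by (intro span_eq[THEN iffD2]) auto
    \<comment> \<open>Membership of \<open>z\<close> in \<open>E\<close> would give both
      \<open>q z z = 0\<close> and \<open>q z z = 1\<close>.\<close>
    moreover have "\<forall>e\<in>insert z E. \<forall>f\<in>insert z E. q e f = (if e = f then 1 else 0)"
      using E(3) zz ze sym by (metis insert_iff zero_neq_one)
    ultimately show ?thesis using E(1) by (intro exI[of _ "insert z E"]) auto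
  qed
qed

lemma positive_form_orthonormal_basis_exists:
  fixes q :: "'k::real_vector \<Rightarrow> 'k \<Rightarrow> real"
  assumes "positive_form q" "finite B" "span B = (UNIV :: 'k set)"
  shows "\<exists>E. orthonormal_basis q E"
  using positive_form_orthonormal_exists[OF assms(1,2)] assms(3) by (auto simp: orthonormal_basis_def)

lemma linear_zero_on_span:
  assumes "linear f" "\<And>x. x \<in> S \<Longrightarrow> f x = 0" "x \<in> span S"
  shows "f x = 0"
  using assms linear_eq_0_on_span by blast

text \<open>The residual is orthogonal to \<open>E\<close>, hence to the span of \<open>E\<close>
  and to itself, so definiteness makes it zero.\<close>

lemma orthonormal_basis_expansion:
  assumes q: "positive_form q" and E: "orthonormal_basis q E"
  shows "(\<Sum>e\<in>E. q x e *\<^sub>R e) = x"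
proof -
  have bil: "bilinear q" using q by (auto simp: positive_form_def)
  let ?y = "x - (\<Sum>e\<in>E. q x e *\<^sub>R e)"
  have "q ?y f = 0" if "f \<in> E" for f
    using orthonormal_residual[OF bil _ _ that] E by (auto simp: orthonormal_basis_def)
  moreover have "linear (q ?y)" "?y \<in> span E" using bil E by (auto simp: bilinear_def orthonormal_basis_def)
  ultimately have "q ?y ?y = 0" using linear_zero_on_span[of "q ?y" E ?y] by simp
  moreover have "q ?y ?y > 0" if "?y \<noteq> 0" using q that unfolding positive_form_def by blast
  ultimately have "?y = 0" by (metis less_irrefl)
  then show ?thesis by simp
qed

text \<open>Stated for a bare bracket because it serves the algebras of both groups.\<close>

lemma jacobi_ad:
  fixes br :: "'v::real_vector \<Rightarrow> 'v \<Rightarrow> 'v"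
  assumes linear: "\<And>u. linear (br u)" and antisym: "\<And>u v. br u v = - br v u"
    and jacobi: "\<And>u v w. br (br u v) w + br (br v w) u + br (br w u) v = 0"
  shows "br (br u v) w = br u (br v w) - br v (br u w)"
proof -
  have "br (br v w) u = - br u (br v w)" by (rule antisym)
  moreover have "br (br w u) v = br v (br u w)"
  proof -
    have "br v (br w u) = - br v (br u w)"
      using arg_cong[OF antisym[of w u], of "br v"] by (simp add: linear_neg[OF linear])
    then show ?thesis using antisym[of "br w u" v] by simp
  qed
  ultimately show ?thesis using jacobi[of u v w] by (simp add: algebra_simps)
qed

section \<open>Perfectness and derivations of a semisimple algebra with an invariant inner
  product\<close>

locale invariant_lie_algebra =
  fixes br :: "'k::real_vector \<Rightarrow> 'k \<Rightarrow> 'k" and q :: "'k \<Rightarrow> 'k \<Rightarrow> real" and B :: "'k set"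
  assumes br_linear: "\<And>u. linear (br u)"
    and br_antisym: "\<And>u v. br u v = - br v u"
    and br_jacobi: "\<And>u v w. br (br u v) w + br (br v w) u + br (br w u) v = 0"
    and q: "positive_form q"
    and inv: "\<And>u v w. q (br u v) w + q v (br u w) = 0"
    and fin: "finite B" "span B = UNIV"
    and semisimple: "semisimple_lie br"
begin

lemma bil: "bilinear q" and sym: "q u v = q v u" and pos: "u \<noteq> 0 \<Longrightarrow> q u u > 0"
  using q by (auto simp: positive_form_def)

lemma q_linear: "linear (q x)" "linear (\<lambda>x. q x y)"
  using bil by (auto simp: bilinear_def)

lemma q_nonneg: "q x x \<ge> 0"
  using pos[of x] bilinear_lzero[OF bil] by (cases "x = 0") auto

lemma br_linear_left: "linear (\<lambda>u. br u v)"
  by (subst br_antisym) (rule linear_compose_neg[OF br_linear])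

lemmas br_jacobi_ad = jacobi_ad[OF br_linear br_antisym br_jacobi]

text \<open>The centre is an abelian ideal, so its derived series reaches zero after one
  step.\<close>

lemma center_trivial:
  assumes z: "\<And>y. br z y = 0"
  shows "z = 0"
proof -
  let ?I = "{z. \<forall>y. br z y = 0}"
  have lin0: "br 0 y = 0" for y using linear_0[OF br_linear_left] .
  have sub: "subspace ?I"
    by (auto simp: subspace_def lin0 linear_add[OF br_linear_left] linear_cmul[OF br_linear_left])
  have ideal: "lie_ideal br ?I"
    unfolding lie_ideal_def
  proof (intro conjI allI ballI sub)
    fix x y assume "y \<in> ?I"
    then have "br x y = 0" using br_antisym[of x y] by simp
    then show "br x y \<in> ?I" by (simp add: lin0)
  qed
  have "{br x y |x y. x \<in> ?I \<and> y \<in> ?I} = {0}"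
    by (auto simp: lin0 linear_0[OF br_linear] intro!: exI[of _ 0])
  then have "derived_series br ?I (Suc 0) = {0}" by simp
  then have "solvable_lie br ?I" unfolding solvable_lie_def by blast
  then have "?I = {0}" using semisimple ideal unfolding semisimple_lie_def by blast
  then show ?thesis using z by blast
qed

text \<open>An element orthogonal to all brackets is central, by invariance.\<close>

lemma perfect: "span {br x y |x y. True} = UNIV"
proof -
  let ?S = "{br x y |x y. True}"
  have sp: "x \<in> span ?S" for x
  proof -
    \<comment> \<open>A finite spanning set is needed to project orthogonally onto the span of the
      brackets; a maximal independent set of brackets is finite by dimension.\<close>
    have "\<exists>b\<subseteq>?S. finite b \<and> span b = span ?S"
    proof -
      obtain C where C: "C \<subseteq> ?S" "independent C" "?S \<subseteq> span C"
        using maximal_independent_subset by blast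
      have "finite C"
        by (rule independent_span_bound[OF fin(1) C(2), THEN conjunct1]) (simp add: fin(2))
      moreover have "span C = span ?S"
        using C span_mono[OF C(1)] span_minimal[OF C(3) subspace_span] by blast
      ultimately show ?thesis using C by blast
    qed
    then obtain b where b: "finite b" "span b = span ?S" by blast
    obtain E where E: "finite E" "span E = span b" "\<forall>e\<in>E. \<forall>f\<in>E. q e f = (if e = f then 1 else 0)"
      using positive_form_orthonormal_exists[OF q b(1)] by blast
    let ?s = "\<Sum>e\<in>E. q x e *\<^sub>R e"
    let ?y = "x - ?s"
    have yE: "q ?y f = 0" if "f \<in> E" for f by (rule orthonormal_residual[OF bil E(1,3) that])
    have orth: "q ?y w = 0" if "w \<in> span ?S" for w
      using linear_zero_on_span[OF q_linear(1), of E ?y w] yE that E(2) b(2) by simp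
    have "br ?y v = 0" for v
    proof -
      have "q (br v ?y) u = 0" for u
      proof -
        have "br v u \<in> span ?S" by (intro span_base) blast
        from orth[OF this] show ?thesis using inv[of v ?y u] by simp
      qed
      then have "br v ?y = 0" using pos[of "br v ?y"] by (metis less_irrefl)
      then show ?thesis using br_antisym[of ?y v] by simp
    qed
    then have "x = ?s" using center_trivial[of ?y] by simp
    moreover have "?s \<in> span E" by (intro span_sum span_scale span_base)
    ultimately show ?thesis using E(2) b(2) by simp
  qed
  then show ?thesis by blast
qed

text \<open>
  Subtracting from \<open>D\<close> the inner derivation with the same pairings \<open>tr (D \<circ> ad y)\<close> leaves a derivation
  whose values lie in the kernel of the Killing form, up to sign the form \<open>\<kappa>\<close> below.
\<close>

lemma derivation_skew:
  assumes D: "linear D" and der: "\<And>u v. D (br u v) = br (D u) v + br u (D v)"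
  shows "q (D u) v + q u (D v) = 0"
proof -
  obtain E where E: "orthonormal_basis q E" using positive_form_orthonormal_basis_exists[OF q fin] by blast
  have finE: "finite E" using E by (simp add: orthonormal_basis_def)
  define \<kappa> where "\<kappa> x y = (\<Sum>e\<in>E. q (br x e) (br y e))" for x y
  have l1: "linear (\<lambda>x. q (br x e) w)" for e w
    using linear_compose[OF br_linear_left q_linear(2)] by (simp add: o_def)
  have \<kappa>bil: "bilinear \<kappa>"
    unfolding bilinear_def \<kappa>_def
  proof (intro conjI allI linear_compose_sum ballI)
    show "linear (\<lambda>x. q (br x e) (br y e))" for e y by (rule l1)
    show "linear (\<lambda>y. q (br x e) (br y e))" for e x unfolding sym[of "br x e"] by (rule l1)
  qed
  \<comment> \<open>A vanishing sum of nonnegative terms makes \<open>br u\<close> zero on a basis,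
    hence \<open>u\<close> central. This is where semisimplicity makes \<kappa> definite.\<close>
  have \<kappa>0: "u = 0" if "\<kappa> u u = 0" for u
  proof -
    have "q (br u e) (br u e) = 0" if "e \<in> E" for e
      using sum_nonneg_0[OF finE _ \<open>\<kappa> u u = 0\<close>[unfolded \<kappa>_def] that] q_nonneg by blast
    then have "br u e = 0" if "e \<in> E" for e using pos[of "br u e"] that by force
    then have "br u y = 0" for y
      using linear_zero_on_span[OF br_linear, of E u y] E by (auto simp: orthonormal_basis_def)
    then show "u = 0" by (rule center_trivial)
  qed
  have "\<kappa> u u \<ge> 0" for u unfolding \<kappa>_def by (intro sum_nonneg q_nonneg)
  then have \<kappa>: "positive_form \<kappa>"
    unfolding positive_form_def using \<kappa>bil \<kappa>0 sym by (auto simp: \<kappa>_def order.strict_iff_order intro!: sum.cong)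
  then obtain F where F: "orthonormal_basis \<kappa> F" using positive_form_orthonormal_basis_exists[OF \<kappa> fin] by blast
  \<comment> \<open>By invariance this is minus the trace of \<open>D\<close> composed with
    \<open>ad y\<close>.\<close>
  define \<phi> where "\<phi> D y = (\<Sum>e\<in>E. q (D e) (br y e))" for D y
  have \<phi>lin: "linear (\<phi> D)" for D
    unfolding \<phi>_def by (intro linear_compose_sum ballI) (subst sym, rule l1)
  \<comment> \<open>The vector representing the functional \<open>\<phi> D\<close> with respect to
    \<kappa>, written in a \<kappa>-orthonormal basis.\<close>
  define Z where "Z = (\<Sum>f\<in>F. \<phi> D f *\<^sub>R f)"
  have Z: "\<kappa> Z y = \<phi> D y" for y
  proof -
    have "\<kappa> Z y = (\<Sum>f\<in>F. \<phi> D f * \<kappa> f y)"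
      using bilinear_sum_left[OF \<kappa>bil, of "\<phi> D" "\<lambda>f. f" F y] by (simp add: Z_def)
    also have "\<dots> = \<phi> D (\<Sum>f\<in>F. \<kappa> y f *\<^sub>R f)"
      using \<kappa> by (simp add: linear_sum[OF \<phi>lin] linear_cmul[OF \<phi>lin] positive_form_def mult.commute)
    also have "\<dots> = \<phi> D y" by (simp add: orthonormal_basis_expansion[OF \<kappa> F])
    finally show ?thesis .
  qed
  define D' where "D' u = D u - br Z u" for u
  have D'lin: "linear D'" unfolding D'_def using D br_linear by (intro linear_compose_sub)
  have D'der: "D' (br u v) = br (D' u) v + br u (D' v)" for u v
    unfolding D'_def der linear_diff[OF br_linear] linear_diff[OF br_linear_left] br_jacobi_ad[of Z u v]
    by simp
  \<comment> \<open>For the inner derivation \<open>br Z\<close> the functional \<phi> is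
    \<open>\<kappa> Z\<close>, which equals \<open>\<phi> D\<close> by the choice of
    \<open>Z\<close>.\<close>
  have \<phi>0: "\<phi> D' y = 0" for y
    using Z[of y] by (simp add: \<phi>_def \<kappa>_def D'_def linear_diff[OF q_linear(2)] sum_subtractf)
  have "D' x = 0" for x
  proof -
    \<comment> \<open>Cyclicity of the trace: \<open>ad y\<close>, \<open>D'\<close>,
      \<open>ad x\<close> composed in this order have the same trace as \<open>ad x\<close>,
      \<open>ad y\<close>, \<open>D'\<close>. Invariance moves each \<open>ad\<close> across
      \<open>q\<close> at the cost of a sign.\<close>
    have trace: "(\<Sum>e\<in>E. q (D' (br x e)) (br y e)) = - (\<Sum>e\<in>E. q (D' e) (br y (br x e)))" for y
    proof -
      have "(\<Sum>e\<in>E. q (D' (br x e)) (br y e)) = (\<Sum>e\<in>E. \<Sum>f\<in>E. q (br x e) f * q (D' f) (br y e))"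
      proof (rule sum.cong[OF refl])
        fix e
        have "q (D' (br x e)) (br y e) = q (D' (\<Sum>f\<in>E. q (br x e) f *\<^sub>R f)) (br y e)"
          by (simp add: orthonormal_basis_expansion[OF q E])
        then show "q (D' (br x e)) (br y e) = (\<Sum>f\<in>E. q (br x e) f * q (D' f) (br y e))"
          by (simp add: linear_sum[OF D'lin] linear_cmul[OF D'lin] bilinear_sum_left[OF bil])
      qed
      also have "\<dots> = (\<Sum>f\<in>E. \<Sum>e\<in>E. q (br x e) f * q (D' f) (br y e))"
        by (rule sum.swap)
      also have "\<dots> = (\<Sum>f\<in>E. q (D' f) (br y (\<Sum>e\<in>E. q (br x e) f *\<^sub>R e)))"
        by (simp add: linear_sum[OF br_linear] linear_cmul[OF br_linear] bilinear_sum_right[OF bil])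
      also have "\<dots> = (\<Sum>f\<in>E. q (D' f) (br y (- br x f)))"
      proof -
        have "q (br x e) f = q (- br x f) e" for e f
          using inv[of x e f] sym[of e "br x f"] linear_neg[OF q_linear(2)[of e], of "br x f"] by simp
        then show ?thesis by (simp add: orthonormal_basis_expansion[OF q E])
      qed
      finally show ?thesis
        by (simp add: linear_neg[OF br_linear] linear_neg[OF q_linear(1)] sum_negf)
    qed
    \<comment> \<open>For a derivation, \<open>ad (D' x)\<close> is the commutator of
      \<open>D'\<close> with \<open>ad x\<close>. By cyclicity its pairing with \<open>ad y\<close>
      becomes that of \<open>D'\<close> with \<open>ad (br x y)\<close>, which is zero.\<close>
    have "\<kappa> (D' x) y = 0" for y
    proof -
      have "br (D' x) e = D' (br x e) - br x (D' e)" for e using D'der[of x e] by simp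
      then have "\<kappa> (D' x) y = (\<Sum>e\<in>E. q (D' (br x e)) (br y e)) - (\<Sum>e\<in>E. q (br x (D' e)) (br y e))"
        by (simp add: \<kappa>_def linear_diff[OF q_linear(2)] sum_subtractf)
      also have "(\<Sum>e\<in>E. q (br x (D' e)) (br y e)) = - (\<Sum>e\<in>E. q (D' e) (br x (br y e)))"
        unfolding sum_negf[symmetric] by (rule sum.cong[OF refl]) (use inv in \<open>simp add: eq_neg_iff_add_eq_0\<close>)
      also have "(\<Sum>e\<in>E. q (D' (br x e)) (br y e)) - - (\<Sum>e\<in>E. q (D' e) (br x (br y e))) = \<phi> D' (br x y)"
        unfolding trace \<phi>_def br_jacobi_ad linear_diff[OF q_linear(1)] sum_subtractf by simp
      finally show ?thesis by (simp add: \<phi>0)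
    qed
    then show "D' x = 0" by (rule \<kappa>0)
  qed
  then have "D u = br Z u" for u by (simp add: D'_def)
  then show ?thesis using inv by simp
qed

end

section \<open>Skew maps of a plane\<close>

text \<open>An alternating form on a plane is a multiple of the determinant, so two skew maps are
  proportional once the form \<open>g\<close> is nondegenerate on \<open>H\<close>.\<close>

lemma skew_maps_commute:
  fixes g :: "'e::real_vector \<Rightarrow> 'e \<Rightarrow> real"
  assumes bil: "bilinear g" and H: "H = span {h1, h2}"
    and nd: "\<And>x. x \<in> H \<Longrightarrow> (\<And>y. y \<in> H \<Longrightarrow> g x y = 0) \<Longrightarrow> x = 0"
    and S: "linear S" "\<And>x. x \<in> H \<Longrightarrow> S x \<in> H" "\<And>x y. x \<in> H \<Longrightarrow> y \<in> H \<Longrightarrow> g (S x) y + g (S y) x = 0"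
    and T: "linear T" "\<And>x. x \<in> H \<Longrightarrow> T x \<in> H" "\<And>x y. x \<in> H \<Longrightarrow> y \<in> H \<Longrightarrow> g (T x) y + g (T y) x = 0"
    and x: "x \<in> H"
  shows "S (T x) = T (S x)"
proof -
  have h: "h1 \<in> H" "h2 \<in> H" using H by (auto intro: span_base)
  have sub: "subspace H" using H by (simp add: subspace_span)
  have ex: "\<exists>a b. x = a *\<^sub>R h1 + b *\<^sub>R h2" if "x \<in> H" for x
  proof -
    obtain a where "x - a *\<^sub>R h1 \<in> span {h2}" using \<open>x \<in> H\<close> span_breakdown_eq H by metis
    then obtain b where "x - a *\<^sub>R h1 = b *\<^sub>R h2" by (auto simp: span_singleton)
    then show ?thesis by (metis add.commute diff_add_cancel)
  qed
  \<comment> \<open>The alternating form of a skew map: the determinant of the coefficients times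
    one constant.\<close>
  have form: "g (S (a *\<^sub>R h1 + b *\<^sub>R h2)) (c *\<^sub>R h1 + d *\<^sub>R h2) = (a * d - b * c) * g (S h1) h2"
    if S: "linear S" "\<And>x y. x \<in> H \<Longrightarrow> y \<in> H \<Longrightarrow> g (S x) y + g (S y) x = 0" for S a b c d
  proof -
    have "g (S h1) h1 = 0" "g (S h2) h2 = 0" "g (S h2) h1 = - g (S h1) h2"
      using S(2)[of h1 h1] S(2)[of h2 h2] S(2)[of h1 h2] h by auto
    then show ?thesis
      by (simp add: linear_add[OF S(1)] linear_cmul[OF S(1)] bilinear_ladd[OF bil] bilinear_radd[OF bil]
          bilinear_lmul[OF bil] bilinear_rmul[OF bil] algebra_simps)
  qed
  let ?s = "g (S h1) h2" and ?t = "g (T h1) h2"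
  \<comment> \<open>Proportionality without division, so that it also holds when one of the
    constants vanishes.\<close>
  have scaled: "?t *\<^sub>R S x = ?s *\<^sub>R T x" if "x \<in> H" for x
  proof -
    have "?t *\<^sub>R S x - ?s *\<^sub>R T x \<in> H"
      using S(2) T(2) that sub by (intro subspace_diff subspace_scale)
    moreover have "g (?t *\<^sub>R S x - ?s *\<^sub>R T x) y = 0" if "y \<in> H" for y
    proof -
      obtain a b c d where "x = a *\<^sub>R h1 + b *\<^sub>R h2" "y = c *\<^sub>R h1 + d *\<^sub>R h2"
        using ex[OF \<open>x \<in> H\<close>] ex[OF \<open>y \<in> H\<close>] by blast
      then show ?thesis
        using form[OF S(1,3), of a b c d] form[OF T(1,3), of a b c d]
        by (simp add: bilinear_lsub[OF bil] bilinear_lmul[OF bil])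
    qed
    ultimately show ?thesis using nd[of "?t *\<^sub>R S x - ?s *\<^sub>R T x"] by simp
  qed
  show ?thesis
  proof (cases "?s = 0")
    case True
    have "S x = 0" if "x \<in> H" for x
    proof (rule nd[OF S(2)[OF that]])
      fix y assume "y \<in> H"
      then obtain a b c d where "x = a *\<^sub>R h1 + b *\<^sub>R h2" "y = c *\<^sub>R h1 + d *\<^sub>R h2"
        using ex[OF \<open>x \<in> H\<close>] ex[OF \<open>y \<in> H\<close>] by blast
      then show "g (S x) y = 0" using form[OF S(1,3), of a b c d] True by simp
    qed
    then show ?thesis using x T(2) linear_0[OF T(1)] by simp
  next
    case False
    have Tx: "T x = (?t / ?s) *\<^sub>R S x" if "x \<in> H" for x
    proof -
      have "?s *\<^sub>R T x = ?s *\<^sub>R ((?t / ?s) *\<^sub>R S x)" using scaled[OF that] False by simp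
      then show ?thesis using False by (simp only: scaleR_cancel_left) simp
    qed
    show ?thesis using Tx[OF x] Tx[OF S(2)[OF x]] by (simp add: linear_cmul[OF S(1)])
  qed
qed

section \<open>Conformal subalgebras of codimension two\<close>

text \<open>The metric \<open>g\<close> may be indefinite; positivity on the range of \<iota> is
  what yields an orthogonal splitting. At the identity \<iota> is the inclusion of \<kk>, and
  elsewhere that inclusion followed by left translation.\<close>

locale nondegenerate_subspace =
  fixes g :: "'e::euclidean_space \<Rightarrow> 'e \<Rightarrow> real" and \<iota> :: "'k::real_vector \<Rightarrow> 'e" and E :: "'k set"
  assumes g_bil: "bilinear g" and g_sym: "\<And>u v. g u v = g v u"
    and g_nondeg: "\<And>u. (\<And>v. g u v = 0) \<Longrightarrow> u = 0"
    and \<iota>_linear: "linear \<iota>"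
    and form: "positive_form (\<lambda>u v. g (\<iota> u) (\<iota> v))" and E: "orthonormal_basis (\<lambda>u v. g (\<iota> u) (\<iota> v)) E"
begin

definition "H = {x. \<forall>v. g x (\<iota> v) = 0}"
text \<open>Orthogonal projection to the range of \<iota>, but with values in the abstract space
  \<open>'k\<close>, where the bracket of the subalgebra lives.\<close>

definition "coord_K x = (\<Sum>e\<in>E. g x (\<iota> e) *\<^sub>R e)"
definition "proj_H x = x - \<iota> (coord_K x)"

lemma form_pos: "u \<noteq> 0 \<Longrightarrow> g (\<iota> u) (\<iota> u) > 0"
  using form by (simp add: positive_form_def)

lemma g_linear: "linear (g x)" "linear (\<lambda>x. g x y)"
  using g_bil by (auto simp: bilinear_def)

lemma \<iota>_inj: "\<iota> u = 0 \<Longrightarrow> u = 0"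
  using form_pos[of u] bilinear_lzero[OF g_bil] by force

lemma subspace_H: "subspace H"
  unfolding H_def subspace_def
  by (auto simp: bilinear_lzero[OF g_bil] bilinear_ladd[OF g_bil] bilinear_lmul[OF g_bil])

lemma linear_coord_K: "linear coord_K"
  unfolding coord_K_def
  by (intro linear_compose_sum ballI linearI)
    (simp_all add: bilinear_ladd[OF g_bil] bilinear_lmul[OF g_bil] scaleR_add_left)

lemma linear_proj_H: "linear proj_H"
  unfolding proj_H_def
  using linear_compose_sub[OF linear_id linear_compose[OF linear_coord_K \<iota>_linear]] by (simp add: o_def id_def)

lemma coord_K_pair: "g (\<iota> (coord_K x)) (\<iota> v) = g x (\<iota> v)"
proof -
  have "g x (\<iota> v) = g x (\<iota> (\<Sum>e\<in>E. g (\<iota> v) (\<iota> e) *\<^sub>R e))"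
    using orthonormal_basis_expansion[OF form E, of v] by simp
  also have "\<dots> = g (\<iota> (coord_K x)) (\<iota> v)"
    by (simp add: coord_K_def linear_sum[OF \<iota>_linear] linear_cmul[OF \<iota>_linear] bilinear_sum_left[OF g_bil]
        bilinear_sum_right[OF g_bil] g_sym[of "\<iota> v"] mult.commute)
  finally show ?thesis by simp
qed

lemma proj_H_in: "proj_H x \<in> H"
  by (simp add: H_def proj_H_def bilinear_lsub[OF g_bil] coord_K_pair)

lemma proj_H_pair: "y \<in> H \<Longrightarrow> g (proj_H x) y = g x y"
  using g_sym[of "\<iota> (coord_K x)" y] by (simp add: H_def proj_H_def bilinear_lsub[OF g_bil])

text \<open>A vector of \<open>H\<close> is orthogonal to the range of \<iota> by definition;
  orthogonality to \<open>H\<close> as well makes it orthogonal to everything.\<close>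

lemma H_nondeg:
  assumes x: "x \<in> H" and y: "\<And>y. y \<in> H \<Longrightarrow> g x y = 0"
  shows "x = 0"
proof (rule g_nondeg)
  fix v
  have "g x v = g x (proj_H v) + g x (\<iota> (coord_K v))"
    using bilinear_radd[OF g_bil, of x "proj_H v" "\<iota> (coord_K v)"] by (simp add: proj_H_def)
  then show "g x v = 0" using x y[OF proj_H_in] by (simp add: H_def)
qed

lemma \<iota>_in_H: "\<iota> u \<in> H \<Longrightarrow> \<iota> u = 0"
  using form_pos[of u] linear_0[OF \<iota>_linear] by (fastforce simp: H_def)

lemma proj_along_range: "proj_along (range \<iota>) H n = \<iota> (coord_K n)"
  unfolding proj_along_def
proof (rule the_equality)
  show "\<iota> (coord_K n) \<in> range \<iota> \<and> n - \<iota> (coord_K n) \<in> H" using proj_H_in[of n] by (simp add: proj_H_def)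
  fix u assume u: "u \<in> range \<iota> \<and> n - u \<in> H"
  then obtain a where a: "u = \<iota> a" by blast
  have "proj_H n - (n - u) \<in> H" using u subspace_diff[OF subspace_H proj_H_in] by blast
  then have "\<iota> (a - coord_K n) \<in> H" by (simp add: a proj_H_def linear_diff[OF \<iota>_linear])
  from \<iota>_in_H[OF this] show "u = \<iota> (coord_K n)" by (simp add: a linear_diff[OF \<iota>_linear])
qed

text \<open>Orthogonality to \<open>H\<close> forces \<open>n\<close> into the range of \<iota>,
  which meets \<open>H\<close> only in zero, so the description in \<open>proj_along\<close> has the
  unique solution 0.\<close>

lemma proj_along_H_eq_0:
  assumes n: "\<And>y. y \<in> H \<Longrightarrow> g n y = 0"
  shows "proj_along H (range \<iota>) n = 0"
  unfolding proj_along_def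
proof (rule the_equality)
  have "proj_H n = 0" by (rule H_nondeg[OF proj_H_in]) (simp add: proj_H_pair n)
  then have nr: "n = \<iota> (coord_K n)" by (simp add: proj_H_def)
  show "0 \<in> H \<and> n - 0 \<in> range \<iota>" using nr subspace_0[OF subspace_H] by auto
  fix u assume u: "u \<in> H \<and> n - u \<in> range \<iota>"
  then obtain a where "n - u = \<iota> a" by blast
  then have "u = \<iota> (coord_K n - a)" using nr by (simp add: linear_diff[OF \<iota>_linear] algebra_simps)
  then show "u = 0" using u \<iota>_in_H by simp
qed

end

text \<open>The assumption \<open>conf\<close> is conformality tested on left-invariant fields at
  the identity; \<theta> arises in \<open>conformal_bracket\<close> as twice the pairing with the
  vector field of the definition.\<close>

locale conformal_subalgebra =
  nondegenerate_subspace g \<iota> E + K: invariant_lie_algebra brk "\<lambda>u v. g (\<iota> u) (\<iota> v)" E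
  for brk :: "'k::real_vector \<Rightarrow> 'k \<Rightarrow> 'k" and g :: "'e::euclidean_space \<Rightarrow> 'e \<Rightarrow> real"
    and \<iota> :: "'k \<Rightarrow> 'e" and E +
  fixes br :: "'e \<Rightarrow> 'e \<Rightarrow> 'e" and \<theta> :: "'k \<Rightarrow> real"
  assumes G_linear: "\<And>u. linear (br u)"
    and G_antisym: "\<And>u v. br u v = - br v u"
    and G_jacobi: "\<And>u v w. br (br u v) w + br (br v w) u + br (br w u) v = 0"
    and \<iota>_hom: "\<And>u v. \<iota> (brk u v) = br (\<iota> u) (\<iota> v)"
    and codim: "dim (UNIV :: 'e set) = dim (UNIV :: 'k set) + 2"
    and conf: "\<And>w x y. x \<in> H \<Longrightarrow> y \<in> H \<Longrightarrow>
      g (br (\<iota> w) x) y + g x (br (\<iota> w) y) = \<theta> w * g x y"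
begin

lemma G_linear_left: "linear (\<lambda>u. br u v)"
  by (subst G_antisym) (rule linear_compose_neg[OF G_linear])

text \<open>Dimension count for the direct sum of the range of \<iota> and \<open>H\<close>, using
  codimension two.\<close>

lemma H_basis: "\<exists>h1 h2. H = span {h1, h2}"
proof -
  have sub: "subspace (range \<iota>)" using linear_subspace_image[OF \<iota>_linear subspace_UNIV] .
  have "UNIV = {x + y |x y. x \<in> range \<iota> \<and> y \<in> H}"
  proof safe
    fix z
    have "z = \<iota> (coord_K z) + proj_H z" by (simp add: proj_H_def)
    then show "\<exists>x y. z = x + y \<and> x \<in> range \<iota> \<and> y \<in> H" using proj_H_in by blast
  qed auto
  moreover have "range \<iota> \<inter> H = {0}"
  proof safe
    fix u assume "\<iota> u \<in> H"
    then have "g (\<iota> u) (\<iota> u) = 0" by (simp add: H_def)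
    then have "u = 0" using K.pos[of u] by force
    then show "\<iota> u = 0" by (simp add: linear_0[OF \<iota>_linear])
  qed (auto intro: subspace_0[OF sub] subspace_0[OF subspace_H])
  moreover have "dim (range \<iota>) = dim (UNIV :: 'k set)"
  proof -
    obtain C where C: "independent C" "span C = (UNIV :: 'k set)" "card C = dim (UNIV :: 'k set)"
      using basis_exists[of "UNIV :: 'k set"] by (metis top.extremum_uniqueI)
    have inj: "inj \<iota>" using \<iota>_inj linear_injective_0[OF \<iota>_linear] by blast
    have "independent (\<iota> ` C)" using linear_independent_injective_image[OF \<iota>_linear C(1) inj_on_subset[OF inj subset_UNIV]] .
    moreover have "span (\<iota> ` C) = range \<iota>" using linear_span_image[OF \<iota>_linear, of C] C(2) by simp
    moreover have "card (\<iota> ` C) = card C" by (rule card_image) (use inj in \<open>auto intro: inj_on_subset\<close>)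
    ultimately show ?thesis using dim_eq_card[of "\<iota> ` C" "range \<iota>"] C(3) span_span by metis
  qed
  ultimately have "dim H = 2"
    using dim_sums_Int[OF sub subspace_H] codim by simp
  moreover obtain C where C: "C \<subseteq> H" "independent C" "H \<subseteq> span C" "card C = dim H"
    by (rule basis_exists)
  ultimately obtain h1 h2 where "C = {h1, h2}" by (metis card_2_iff)
  then show ?thesis using C(1,3) span_minimal[OF C(1) subspace_H] by blast
qed

lemmas G_jacobi_ad = jacobi_ad[OF G_linear G_antisym G_jacobi]

text \<open>The compressions of \<open>ad (\<iota> v)\<close> and \<open>ad (\<iota> w)\<close> to
  \<open>H\<close> are skew up to scalars, so they commute, while the Jacobi identity equates their
  commutator with the compression of \<open>ad (\<iota> (brk v w))\<close>.\<close>

lemma ad_trivial_bracket: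
  assumes x: "x \<in> H" and y: "y \<in> H"
  shows "g (br (\<iota> (brk v w)) x) y = 0"
proof -
  \<comment> \<open>The skew part of the compression: by \<open>conf\<close> its symmetric part is
    the scalar \<open>\<theta> v / 2\<close>.\<close>
  define S where "S v x = proj_H (br (\<iota> v) x) - (\<theta> v / 2) *\<^sub>R x" for v x
  have Slin: "linear (S v)" for v
    unfolding S_def
    using linear_compose_sub[OF linear_compose[OF G_linear linear_proj_H] linear_scale_self, of "\<iota> v" "\<theta> v / 2"]
    by (simp add: o_def)
  have SH: "S v x \<in> H" if "x \<in> H" for v x
    unfolding S_def using that by (intro subspace_diff subspace_scale subspace_H proj_H_in)
  have skew: "g (S v x) y + g (S v y) x = 0" if "x \<in> H" "y \<in> H" for v x y
    using conf[of x y v] that g_sym[of x "br (\<iota> v) y"] g_sym[of y x]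
    by (simp add: S_def bilinear_lsub[OF g_bil] bilinear_lmul[OF g_bil] proj_H_pair)
  obtain h1 h2 where h: "H = span {h1, h2}" using H_basis by blast
  have comm: "S v (S w x) = S w (S v x)"
    by (rule skew_maps_commute[OF g_bil h H_nondeg Slin SH skew Slin SH skew x])
  \<comment> \<open>The component of \<open>br (\<iota> w) x\<close> in the subalgebra stays there
    under \<open>br (\<iota> v)\<close> and is invisible to \<open>y\<close>. Apart from
    \<open>S v (S w x)\<close>, the result is symmetric in \<open>v\<close> and
    \<open>w\<close>.\<close>
  have step: "g (br (\<iota> v) (br (\<iota> w) x)) y
      = g (S v (S w x)) y + \<theta> w / 2 * g (S v x) y + \<theta> v / 2 * g (S w x) y + \<theta> v * \<theta> w / 4 * g x y" for v w
  proof -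
    have "br (\<iota> w) x = \<iota> (coord_K (br (\<iota> w) x)) + S w x + (\<theta> w / 2) *\<^sub>R x"
      by (simp add: S_def proj_H_def)
    then have "br (\<iota> v) (br (\<iota> w) x)
        = \<iota> (brk v (coord_K (br (\<iota> w) x))) + br (\<iota> v) (S w x) + (\<theta> w / 2) *\<^sub>R br (\<iota> v) x"
      by (metis \<iota>_hom linear_add[OF G_linear] linear_cmul[OF G_linear])
    moreover have "g (\<iota> u) y = 0" for u using y g_sym by (simp add: H_def)
    moreover have "g (br (\<iota> v) z) y = g (S v z) y + \<theta> v / 2 * g z y" for z
      using y by (simp add: S_def bilinear_lsub[OF g_bil] bilinear_lmul[OF g_bil] proj_H_pair)
    ultimately show ?thesis
      by (simp add: bilinear_ladd[OF g_bil] bilinear_lmul[OF g_bil] algebra_simps)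
  qed
  show ?thesis
    unfolding \<iota>_hom G_jacobi_ad bilinear_lsub[OF g_bil] step comm by simp
qed

lemma ad_trivial:
  assumes x: "x \<in> H" and y: "y \<in> H"
  shows "g (br (\<iota> w) x) y = 0"
proof -
  have lin: "linear (\<lambda>w. g (br (\<iota> w) x) y)"
    using linear_compose[OF linear_compose[OF \<iota>_linear G_linear_left] g_linear(2)] by (simp add: o_def)
  have mem: "w \<in> span {brk u v |u v. True}" unfolding K.perfect by (rule UNIV_I)
  show ?thesis
    by (rule linear_zero_on_span[OF lin _ mem]) (elim CollectE exE, simp only: ad_trivial_bracket[OF x y])
qed

lemma bracket_in_subalgebra:
  assumes x: "x \<in> H"
  shows "br x (\<iota> u) = \<iota> (coord_K (br x (\<iota> u)))"
proof -
  have "proj_H (br (\<iota> u) x) = 0"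
    by (rule H_nondeg[OF proj_H_in]) (simp add: proj_H_pair ad_trivial[OF x])
  then have "proj_H (br x (\<iota> u)) = 0"
    by (subst G_antisym) (simp add: linear_neg[OF linear_proj_H])
  then show ?thesis by (simp add: proj_H_def)
qed

theorem complement_skew:
  assumes x: "x \<in> H"
  shows "g (br x (\<iota> u)) (\<iota> v) + g (\<iota> u) (br x (\<iota> v)) = 0"
proof -
  let ?D = "\<lambda>u. coord_K (br x (\<iota> u))"
  note D = bracket_in_subalgebra[OF x]
  have lin: "linear ?D"
    using linear_compose[OF linear_compose[OF \<iota>_linear G_linear] linear_coord_K] by (simp add: o_def)
  \<comment> \<open>By injectivity of \<iota> this may be checked in the large algebra, where it is
    the Jacobi identity for \<open>br x\<close>.\<close>
  have der: "?D (brk u v) = brk (?D u) v + brk u (?D v)" for u v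
  proof -
    have "\<iota> (?D (brk u v)) = br x (\<iota> (brk u v))" by (rule D[symmetric])
    also have "\<dots> = br x (br (\<iota> u) (\<iota> v))" by (simp only: \<iota>_hom)
    also have "\<dots> = br (br x (\<iota> u)) (\<iota> v) + br (\<iota> u) (br x (\<iota> v))"
      using G_jacobi_ad[of x "\<iota> u" "\<iota> v"] by simp
    also have "\<dots> = \<iota> (brk (?D u) v + brk u (?D v))"
      by (simp add: linear_add[OF \<iota>_linear] \<iota>_hom D[symmetric])
    finally have "\<iota> (?D (brk u v) - (brk (?D u) v + brk u (?D v))) = 0"
      by (simp add: linear_diff[OF \<iota>_linear])
    then show ?thesis using \<iota>_inj by force
  qed
  show ?thesis using K.derivation_skew[OF lin der, of u v] by (simp add: D[symmetric])
qed

end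

section \<open>Left-invariant metrics and their Levi-Civita connection\<close>

lemma bilinear_coord_expansion:
  fixes i :: "'d::real_normed_vector \<Rightarrow> 'e::euclidean_space"
  assumes i: "coord_pair i l" and H: "bilinear H"
  shows "H u v = (\<Sum>b\<in>Basis. \<Sum>c\<in>Basis. ((i u \<bullet> b) * (i v \<bullet> c)) *\<^sub>R H (l b) (l c))"
proof -
  let ?u = "\<Sum>b\<in>Basis. (i u \<bullet> b) *\<^sub>R l b" and ?v = "\<Sum>c\<in>Basis. (i v \<bullet> c) *\<^sub>R l c"
  have 2: "H x ?v = (\<Sum>c\<in>Basis. (i v \<bullet> c) *\<^sub>R H x (l c))" for x
    by (rule bilinear_sum_right[OF H])
  have "H u v = H ?u ?v" unfolding coord_expansion[OF i] ..
  also have "\<dots> = (\<Sum>b\<in>Basis. (i u \<bullet> b) *\<^sub>R H (l b) ?v)" by (rule bilinear_sum_left[OF H])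
  also have "\<dots> = (\<Sum>b\<in>Basis. \<Sum>c\<in>Basis. ((i u \<bullet> b) * (i v \<bullet> c)) *\<^sub>R H (l b) (l c))"
    by (simp only: 2 scaleR_sum_right scaleR_scaleR)
  finally show ?thesis .
qed

text \<open>The contribution of the varying form depends on \<open>a\<close> and \<open>b\<close>
  only through their values at \<open>x\<close>, so it cancels between two pairs of fields that
  agree there.\<close>

lemma has_derivative_bilinear_family:
  fixes i :: "'d::real_normed_vector \<Rightarrow> 'e::euclidean_space"
    and H :: "'x::real_normed_vector \<Rightarrow> 'd \<Rightarrow> 'd \<Rightarrow> real"
  assumes i: "coord_pair i l" and S: "open S" "x \<in> S" and H: "\<And>y. y \<in> S \<Longrightarrow> bilinear (H y)"
    and H': "\<And>u v. ((\<lambda>y. H y u v) has_derivative H' u v) (at x)"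
    and a: "(a has_derivative a') (at x)" and b: "(b has_derivative b') (at x)"
  shows "((\<lambda>y. H y (a y) (b y)) has_derivative
    (\<lambda>h. (\<Sum>j\<in>Basis. \<Sum>k\<in>Basis. ((i (a x) \<bullet> j) * (i (b x) \<bullet> k)) *\<^sub>R H' (l j) (l k) h)
       + H x (a' h) (b x) + H x (a x) (b' h))) (at x)"
proof -
  have bi: "bounded_linear i" using i by (auto simp: coord_pair_def)
  have ia: "((\<lambda>y. i (a y) \<bullet> j) has_derivative (\<lambda>h. i (a' h) \<bullet> j)) (at x)" for j
    using bounded_linear.has_derivative[OF bounded_linear_compose[OF bounded_linear_inner_left bi] a] .
  have ib: "((\<lambda>y. i (b y) \<bullet> j) has_derivative (\<lambda>h. i (b' h) \<bullet> j)) (at x)" for j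
    using bounded_linear.has_derivative[OF bounded_linear_compose[OF bounded_linear_inner_left bi] b] .
  let ?f' = "\<lambda>h. \<Sum>j\<in>Basis. \<Sum>k\<in>Basis. ((i (a x) \<bullet> j) * (i (b x) \<bullet> k)) *\<^sub>R H' (l j) (l k) h
      + ((i (a x) \<bullet> j) * (i (b' h) \<bullet> k) + (i (a' h) \<bullet> j) * (i (b x) \<bullet> k)) *\<^sub>R H x (l j) (l k)"
  have "((\<lambda>y. \<Sum>j\<in>Basis. \<Sum>k\<in>Basis. ((i (a y) \<bullet> j) * (i (b y) \<bullet> k)) *\<^sub>R H y (l j) (l k)) has_derivative ?f') (at x)"
    by (intro has_derivative_sum has_derivative_scaleR has_derivative_mult ia ib H')
  then have d: "((\<lambda>y. H y (a y) (b y)) has_derivative ?f') (at x)"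
    by (rule has_derivative_transform_within_open[OF _ S])
      (rule bilinear_coord_expansion[OF i H, symmetric])
  have eq: "?f' h = (\<Sum>j\<in>Basis. \<Sum>k\<in>Basis. ((i (a x) \<bullet> j) * (i (b x) \<bullet> k)) *\<^sub>R H' (l j) (l k) h)
       + H x (a' h) (b x) + H x (a x) (b' h)" for h
    unfolding bilinear_coord_expansion[OF i H[OF S(2)], of "a' h"] bilinear_coord_expansion[OF i H[OF S(2)], of "a x"]
    by (simp add: sum.distrib scaleR_add_left distrib_right)
  show ?thesis using d unfolding eq .
qed

lemma smooth_field_add:
  assumes A: "smooth_manifold A" and X: "smooth_field A X" and Y: "smooth_field A Y"
  shows "smooth_field A (\<lambda>p. X p + Y p)"
  unfolding smooth_field_def smooth_on_def
proof (intro ballI allI)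
  fix c n assume c: "c \<in> A"
  note op = open_chart_image[OF A c]
  show "C_on n (snd c ` fst c) (field_in_chart A c (\<lambda>p. X p + Y p))"
  proof (rule C_on_cong[OF op _ C_on_add[OF op]])
    show "C_on n (snd c ` fst c) (field_in_chart A c X)" "C_on n (snd c ` fst c) (field_in_chart A c Y)"
      using X Y c by (auto simp: smooth_field_def smooth_on_def)
    show "field_in_chart A c X x + field_in_chart A c Y x = field_in_chart A c (\<lambda>p. X p + Y p) x"
      if "x \<in> snd c ` fst c" for x
      by (simp add: field_in_chart_def linear_add[OF linear_to_chart[OF A c chart_inv_image(1)[OF that]]])
  qed
qed

lemma smooth_field_scale:
  assumes A: "smooth_manifold A" and f: "smooth_function A f" and X: "smooth_field A X"
  shows "smooth_field A (\<lambda>p. f p *\<^sub>R X p)"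
  unfolding smooth_field_def smooth_on_def
proof (intro ballI allI)
  fix c n assume c: "c \<in> A"
  note op = open_chart_image[OF A c]
  show "C_on n (snd c ` fst c) (field_in_chart A c (\<lambda>p. f p *\<^sub>R X p))"
  proof (rule C_on_cong[OF op _ C_on_scaleR[OF op]])
    show "C_on n (snd c ` fst c) (f \<circ> chart_inv c)" "C_on n (snd c ` fst c) (field_in_chart A c X)"
      using f X c by (auto simp: smooth_function_def smooth_field_def smooth_on_def)
    show "(f \<circ> chart_inv c) x *\<^sub>R field_in_chart A c X x = field_in_chart A c (\<lambda>p. f p *\<^sub>R X p) x"
      if "x \<in> snd c ` fst c" for x
      by (simp add: field_in_chart_def linear_cmul[OF linear_to_chart[OF A c chart_inv_image(1)[OF that]]])
  qed
qed

lemma smooth_field_zero: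
  assumes A: "smooth_manifold A" and X: "\<And>p. p \<in> mcarrier A \<Longrightarrow> X p = 0"
  shows "smooth_field A X"
  unfolding smooth_field_def smooth_on_def
proof (intro ballI allI)
  fix c n assume c: "c \<in> A"
  have "0 = field_in_chart A c X x" if "x \<in> snd c ` fst c" for x
    using X[OF chart_subset[OF c chart_inv_image(1)[OF that]]]
      linear_0[OF linear_to_chart[OF A c chart_inv_image(1)[OF that]]] by (simp add: field_in_chart_def)
  then show "C_on n (snd c ` fst c) (field_in_chart A c X)"
    by (rule C_on_cong[OF open_chart_image[OF A c] _ C_on_const])
qed

lemma smooth_field_sum:
  assumes A: "smooth_manifold A" and "\<And>e. e \<in> I \<Longrightarrow> smooth_field A (X e)"
  shows "smooth_field A (\<lambda>p. \<Sum>e\<in>I. X e p)"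
  using assms(2)
  by (induction I rule: infinite_finite_induct)
    (auto intro: smooth_field_zero[OF A] smooth_field_add[OF A])

lemma bilinear_compose_linear: "bilinear g \<Longrightarrow> linear f \<Longrightarrow> bilinear (\<lambda>u v. g (f u) (f v))"
  using linear_compose[of f "g _"] linear_compose[of f "\<lambda>x. g x _"] by (auto simp: bilinear_def o_def)

text \<open>Provides the smooth coefficients of a section in a left-invariant frame. Smoothness of a
  metric is defined on constant coordinate vectors; the finite expansion extends it to smooth
  fields.\<close>

lemma smooth_function_metric:
  fixes A :: "('a, 'd::real_normed_vector) chart set" and i :: "'d \<Rightarrow> 'e::euclidean_space"
  assumes i: "coord_pair i l" and A: "smooth_manifold A" and g: "semi_riemannian_metric A g"
    and X: "smooth_field A X" and Y: "smooth_field A Y"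
  shows "smooth_function A (\<lambda>p. g p (X p) (Y p))"
  unfolding smooth_function_def smooth_on_def
proof (intro ballI allI)
  fix c n assume c: "c \<in> A"
  let ?S = "snd c ` fst c" and ?X = "field_in_chart A c X" and ?Y = "field_in_chart A c Y"
  let ?H = "\<lambda>x u v. let p = chart_inv c x in g p (from_chart A c p u) (from_chart A c p v)"
  note op = open_chart_image[OF A c]
  have bi: "bounded_linear i" using i by (auto simp: coord_pair_def)
  have L: "bounded_linear (\<lambda>x. i x \<bullet> b)" for b
    using bounded_linear_compose[OF bounded_linear_inner_left bi] .
  have XY: "C_on n ?S ?X" "C_on n ?S ?Y"
    using X Y c by (auto simp: smooth_field_def smooth_on_def)
  have bil: "bilinear (?H x)" if "x \<in> ?S" for x
  proof -
    have "bilinear (g (chart_inv c x))"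
      using g chart_subset[OF c chart_inv_image(1)[OF that]] by (simp add: semi_riemannian_metric_def)
    then show ?thesis
      unfolding Let_def by (rule bilinear_compose_linear[OF _ linear_from_chart[OF A c chart_inv_image(1)[OF that]]])
  qed
  have "C_on n ?S (\<lambda>x. ?H x u v)" for u v
    using g c by (simp add: semi_riemannian_metric_def smooth_on_def)
  then have "C_on n ?S (\<lambda>x. \<Sum>b\<in>Basis. \<Sum>d\<in>Basis. ((i (?X x) \<bullet> b) *\<^sub>R (i (?Y x) \<bullet> d)) *\<^sub>R ?H x (l b) (l d))"
    by (intro C_on_sum C_on_scaleR op C_on_bounded_linear[OF L] XY)
  then show "C_on n ?S ((\<lambda>p. g p (X p) (Y p)) \<circ> chart_inv c)"
  proof (rule C_on_cong[OF op, rotated])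
    fix x assume x: "x \<in> ?S"
    have "((\<lambda>p. g p (X p) (Y p)) \<circ> chart_inv c) x = ?H x (?X x) (?Y x)"
      by (simp add: field_in_chart_def Let_def from_chart_to_chart[OF A c chart_inv_image(1)[OF x]])
    then show "(\<Sum>b\<in>Basis. \<Sum>d\<in>Basis. ((i (?X x) \<bullet> b) *\<^sub>R (i (?Y x) \<bullet> d)) *\<^sub>R ?H x (l b) (l d)) =
      ((\<lambda>p. g p (X p) (Y p)) \<circ> chart_inv c) x"
      using bilinear_coord_expansion[OF i bil[OF x], of "?X x" "?Y x"] by simp
  qed
qed

lemma directional_derivative_const:
  assumes A: "smooth_manifold A" and p: "p \<in> mcarrier A" and f: "\<And>q. q \<in> mcarrier A \<Longrightarrow> f q = k"
  shows "directional_derivative A f p v = 0"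
proof -
  note c = chart_at[OF p]
  have k: "(f \<circ> chart_inv (chart_at A p)) x = k" if "x \<in> snd (chart_at A p) ` fst (chart_at A p)" for x
    using f[OF chart_subset[OF c(1) chart_inv_image(1)[OF that]]] by simp
  have "frechet_derivative (f \<circ> chart_inv (chart_at A p)) (at (snd (chart_at A p) p))
    = frechet_derivative (\<lambda>x. k) (at (snd (chart_at A p) p))"
    by (rule frechet_derivative_cong_open[OF open_chart_image[OF A c(1)] _ k]) (use c in auto)
  then show ?thesis by (simp add: directional_derivative_def)
qed

locale lie_group_metric = lie_group_coord G A i l
  for G :: "'a monoid" (structure) and A :: "('a, 'e::real_normed_vector) chart set"
    and i :: "'e \<Rightarrow> 'f::euclidean_space" and l +
  fixes g :: "'a \<Rightarrow> 'e \<Rightarrow> 'e \<Rightarrow> real"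
  assumes metric: "semi_riemannian_metric A g" and left_inv: "left_invariant_metric G A g"
begin

lemma g_bilinear: "p \<in> carrier G \<Longrightarrow> bilinear (g p)"
  and g_sym: "p \<in> carrier G \<Longrightarrow> g p u v = g p v u"
  and g_nondeg: "p \<in> carrier G \<Longrightarrow> (\<And>v. g p u v = 0) \<Longrightarrow> u = 0"
  using metric by (auto simp: semi_riemannian_metric_def)

lemma g_lfield: "p \<in> carrier G \<Longrightarrow> g p (lfield u p) (lfield v p) = g \<one> u v"
proof -
  assume p: "p \<in> carrier G"
  have "g (p \<otimes> \<one>) (lt p \<one> u) (lt p \<one> v) = g \<one> u v"
    using left_inv p unfolding left_invariant_metric_def by blast
  then show ?thesis using p by (simp add: left_invariant_field_def)
qed

text \<open>
  The products of left-invariant fields and the products of right-invariant fields are both constant.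
  Differentiating them at the identity and subtracting eliminates the derivative of the metric; the
  derivatives of the fields differ by the bracket, by symmetry of the second derivative of the
  multiplication.
\<close>

lemma ad_invariant:
  assumes right_inv: "right_invariant_metric G A g"
  shows "g \<one> (br u v) w + g \<one> v (br u w) = 0"
proof -
  let ?S = "snd c0 ` fst c0"
  define H where "H x u v = g (chart_inv c0 x) (from_chart A c0 (chart_inv c0 x) u) (from_chart A c0 (chart_inv c0 x) v)" for x u v
  define R where "R u x = to_chart A c0 (chart_inv c0 x) (right_translate G A (chart_inv c0 x) \<one> u)" for u x
  define Lf where "Lf u = field_in_chart A c0 (lfield u)" for u
  have carr: "chart_inv c0 x \<in> carrier G" if "x \<in> ?S" for x
    using chart_carrier[OF c0(1) chart_inv_image(1)[OF that]] .
  have bil: "bilinear (H x)" if "x \<in> ?S" for x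
    unfolding H_def
    by (rule bilinear_compose_linear[OF g_bilinear[OF carr[OF that]] linear_from_chart[OF group_manifold c0(1) chart_inv_image(1)[OF that]]])
  have dH: "((\<lambda>x. H x u v) has_derivative frechet_derivative (\<lambda>x. H x u v) (at e0)) (at e0)" for u v
  proof (rule has_frechet_derivative, rule smooth_on_diff[OF _ e0_open(2)])
    show "smooth_on ?S (\<lambda>x. H x u v)"
      using metric c0(1) by (simp add: semi_riemannian_metric_def H_def Let_def)
  qed
  have HL: "H x (Lf u x) (Lf v x) = g \<one> u v" if "x \<in> ?S" for x u v
    using g_lfield[OF carr[OF that]]
    by (simp add: H_def Lf_def field_in_chart_def from_chart_to_chart[OF group_manifold c0(1) chart_inv_image(1)[OF that]])
  have HR: "H x (R u x) (R v x) = g \<one> u v" if "x \<in> ?S" for x u v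
  proof -
    have "g (\<one> \<otimes> chart_inv c0 x) (right_translate G A (chart_inv c0 x) \<one> u) (right_translate G A (chart_inv c0 x) \<one> v) = g \<one> u v"
      using right_inv carr[OF that] unfolding right_invariant_metric_def by blast
    then show ?thesis
      using carr[OF that] by (simp add: H_def R_def from_chart_to_chart[OF group_manifold c0(1) chart_inv_image(1)[OF that]])
  qed
  have Le: "Lf u e0 = u" for u unfolding Lf_def by (rule field_in_chart_left_e0)
  have ce: "chart_inv c0 e0 = \<one>" using chart_inv_snd[OF group_manifold c0] .
  have Re: "R u e0 = u" for u
  proof -
    have "right_translate G A \<one> \<one> u = u"
      unfolding right_translate_def
      by (subst tangent_map_cong[OF group_manifold, of _ _ "\<lambda>q. q"]) (auto simp: tangent_map_ident[OF group_manifold])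
    then show ?thesis by (simp add: R_def ce to_chart_chart_at[OF group_manifold])
  qed
  have He: "H e0 u v = g \<one> u v" for u v
    using HL[OF e0_open(2), of u v] by (simp add: Le)
  \<comment> \<open>The derivative of the metric coefficients paired with \<open>v\<close> and
    \<open>w\<close>. It is the same for both kinds of fields because \<open>Lf u\<close> and
    \<open>R u\<close> agree at the identity.\<close>
  define T where "T h = (\<Sum>j\<in>Basis. \<Sum>k\<in>Basis. ((i v \<bullet> j) * (i w \<bullet> k)) *\<^sub>R frechet_derivative (\<lambda>x. H x (l j) (l k)) (at e0) h)" for h
  have zero: "f' h = 0" if "(f has_derivative f') (at e0)" "\<And>x. x \<in> ?S \<Longrightarrow> f x = k" for f :: "'e \<Rightarrow> real" and f' h k
  proof -
    have "((\<lambda>x. k) has_derivative f') (at e0)"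
      by (rule has_derivative_transform_within_open[OF that(1) e0_open]) (rule that(2))
    from has_derivative_unique[OF this has_derivative_const] show ?thesis by simp
  qed
  have dL: "(Lf u has_derivative (\<lambda>h. hess (h, 0) (0, u))) (at e0)" for u
    unfolding Lf_def by (rule has_derivative_lfield)
  have dR: "(R u has_derivative (\<lambda>h. hess (0, h) (u, 0))) (at e0)" for u
    using has_derivative_right_translate[of u] by (simp add: R_def[abs_def])
  have 1: "T u + g \<one> (hess (u, 0) (0, v)) w + g \<one> v (hess (u, 0) (0, w)) = 0"
    using zero[OF has_derivative_bilinear_family[OF coord e0_open bil dH dL[of v] dL[of w]] HL, of u]
    by (simp add: Le He T_def)
  have 2: "T u + g \<one> (hess (0, u) (v, 0)) w + g \<one> v (hess (0, u) (w, 0)) = 0"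
    using zero[OF has_derivative_bilinear_family[OF coord e0_open bil dH dR[of v] dR[of w]] HR, of u]
    by (simp add: Re He T_def)
  have b: "br u v = hess (u, 0) (0, v) - hess (0, u) (v, 0)" for v
    by (simp add: br_hess hess_sym[of "(v, 0)"])
  show ?thesis
    using 1 2 unfolding b bilinear_lsub[OF g_bilinear[OF one_closed]] bilinear_rsub[OF g_bilinear[OF one_closed]]
    by linarith
qed

end

locale lie_group_connection = lie_group_metric G A i l g
  for G :: "'a monoid" (structure) and A :: "('a, 'e::real_normed_vector) chart set"
    and i :: "'e \<Rightarrow> 'f::euclidean_space" and l and g +
  fixes nabla :: "('a \<Rightarrow> 'e) \<Rightarrow> ('a \<Rightarrow> 'e) \<Rightarrow> 'a \<Rightarrow> 'e"
  assumes LC: "levi_civita_connection A g nabla"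
begin

lemma nabla_add_left:
  assumes "smooth_field A X" "smooth_field A X'" "smooth_field A Y" "p \<in> carrier G"
  shows "nabla (\<lambda>q. X q + X' q) Y p = nabla X Y p + nabla X' Y p"
  using LC assms by (simp add: levi_civita_connection_def affine_connection_def)

lemma nabla_scale_left:
  assumes "smooth_function A f" "smooth_field A X" "smooth_field A Y" "p \<in> carrier G"
  shows "nabla (\<lambda>q. f q *\<^sub>R X q) Y p = f p *\<^sub>R nabla X Y p"
  using LC assms by (simp add: levi_civita_connection_def affine_connection_def)

lemma torsion_free:
  assumes "smooth_field A X" "smooth_field A Y" "p \<in> carrier G"
  shows "nabla X Y p = nabla Y X p + lie_bracket A X Y p"
proof -
  have "nabla X Y p - nabla Y X p = lie_bracket A X Y p"
    using LC assms by (simp add: levi_civita_connection_def)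
  then show ?thesis by (simp add: algebra_simps)
qed

lemma metric_constant:
  assumes "smooth_field A X" "smooth_field A Y" "smooth_field A Z" and p: "p \<in> carrier G"
    and c: "\<And>q. q \<in> carrier G \<Longrightarrow> g q (Y q) (Z q) = k"
  shows "g p (nabla X Y p) (Z p) + g p (Y p) (nabla X Z p) = 0"
proof -
  have "directional_derivative A (\<lambda>q. g q (Y q) (Z q)) p (X p) = g p (nabla X Y p) (Z p) + g p (Y p) (nabla X Z p)"
    using LC assms by (simp add: levi_civita_connection_def)
  then show ?thesis using directional_derivative_const[OF group_manifold, of p "\<lambda>q. g q (Y q) (Z q)" k "X p"] p c by simp
qed

text \<open>
  A field vanishing on the carrier is its own multiple by the indicator of the complement, which is a
  smooth function vanishing on the carrier.
\<close>

lemma nabla_zero_left: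
  assumes X: "\<And>q. q \<in> carrier G \<Longrightarrow> X q = 0" and Y: "smooth_field A Y" and p: "p \<in> carrier G"
  shows "nabla X Y p = 0"
proof -
  let ?f = "\<lambda>q. if q \<in> carrier G then 0 else 1 :: real"
  have f: "smooth_function A ?f"
    unfolding smooth_function_def smooth_on_def
  proof (intro ballI allI)
    fix c n assume c: "c \<in> A"
    have "0 = (?f \<circ> chart_inv c) x" if "x \<in> snd c ` fst c" for x
      using chart_carrier[OF c chart_inv_image(1)[OF that]] by simp
    then show "C_on n (snd c ` fst c) (?f \<circ> chart_inv c)"
      by (rule C_on_cong[OF open_chart_image[OF group_manifold c] _ C_on_const])
  qed
  have XX: "(\<lambda>q. ?f q *\<^sub>R X q) = X" using X by auto
  show ?thesis
    using nabla_scale_left[OF f smooth_field_zero[OF group_manifold] Y p, of X] X p unfolding XX by simp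
qed

text \<open>The connection takes functions on the whole type, so independence from values off the
  carrier has to be derived: the difference of the two fields vanishes on the carrier.\<close>

lemma nabla_cong_left:
  assumes X: "smooth_field A X" and Y: "smooth_field A Y" and p: "p \<in> carrier G"
    and eq: "\<And>q. q \<in> carrier G \<Longrightarrow> X q = X' q"
  shows "nabla X Y p = nabla X' Y p"
proof -
  have Z: "smooth_field A (\<lambda>q. X' q - X q)" by (rule smooth_field_zero[OF group_manifold]) (simp add: eq)
  have "nabla (\<lambda>q. X q + (X' q - X q)) Y p = nabla X Y p + nabla (\<lambda>q. X' q - X q) Y p"
    by (rule nabla_add_left[OF X Z Y p])
  then show ?thesis using nabla_zero_left[of "\<lambda>q. X' q - X q", OF _ Y p] eq by simp
qed

lemma nabla_sum_left:
  assumes "finite I" and "\<And>e. e \<in> I \<Longrightarrow> smooth_function A (f e)" "\<And>e. e \<in> I \<Longrightarrow> smooth_field A (X e)"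
    and Y: "smooth_field A Y" and p: "p \<in> carrier G"
  shows "nabla (\<lambda>q. \<Sum>e\<in>I. f e q *\<^sub>R X e q) Y p = (\<Sum>e\<in>I. f e p *\<^sub>R nabla (X e) Y p)"
  using assms(1-3)
proof (induction I)
  case empty
  then show ?case using nabla_zero_left[of "\<lambda>q. 0", OF _ Y p] by simp
next
  case (insert e I)
  have 1: "smooth_function A (f e)" "smooth_field A (X e)" using insert.prems by auto
  have 2: "smooth_field A (\<lambda>q. f d q *\<^sub>R X d q)" if "d \<in> insert e I" for d
    by (rule smooth_field_scale[OF group_manifold insert.prems(1)[OF that] insert.prems(2)[OF that]])
  have 3: "smooth_field A (\<lambda>q. \<Sum>e\<in>I. f e q *\<^sub>R X e q)"
    by (rule smooth_field_sum[OF group_manifold 2]) simp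
  have "nabla (\<lambda>q. f e q *\<^sub>R X e q + (\<Sum>e\<in>I. f e q *\<^sub>R X e q)) Y p =
     nabla (\<lambda>q. f e q *\<^sub>R X e q) Y p + nabla (\<lambda>q. \<Sum>e\<in>I. f e q *\<^sub>R X e q) Y p"
    by (rule nabla_add_left[OF 2[OF insertI1] 3 Y p])
  also have "nabla (\<lambda>q. f e q *\<^sub>R X e q) Y p = f e p *\<^sub>R nabla (X e) Y p"
    by (rule nabla_scale_left[OF 1 Y p])
  also have "nabla (\<lambda>q. \<Sum>e\<in>I. f e q *\<^sub>R X e q) Y p = (\<Sum>e\<in>I. f e p *\<^sub>R nabla (X e) Y p)"
    using insert.IH insert.prems by simp
  finally show ?case using insert.hyps by simp
qed

text \<open>The product of two left-invariant fields is constant, so the derivative term drops out.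
  Together with \<open>nabla_lfield_torsion\<close> this stands in for the Koszul formula.\<close>

lemma nabla_lfield_metric:
  assumes X: "smooth_field A X" and p: "p \<in> carrier G"
  shows "g p (nabla X (lfield u) p) (lfield v p) + g p (lfield u p) (nabla X (lfield v) p) = 0"
  by (rule metric_constant[OF X smooth_field_left smooth_field_left p g_lfield])

lemma nabla_lfield_torsion:
  "p \<in> carrier G \<Longrightarrow> nabla (lfield u) (lfield v) p = nabla (lfield v) (lfield u) p + lfield (br u v) p"
  using torsion_free[OF smooth_field_left smooth_field_left, of p u v] lie_bracket_lfield[of p u v] by simp

end

section \<open>The foliation generated by a subgroup\<close>

locale lie_subgroup_metric =
  lie_group_connection G A "\<lambda>x. x" "\<lambda>x. x" g nabla
  for G :: "'a monoid" (structure) and A :: "('a, 'e::euclidean_space) chart set" and g nabla +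
  fixes K :: "'a set" and B :: "('a, 'k::real_normed_vector) chart set"
  assumes sub: "lie_subgroup K B G A" and riem: "riemannian_metric B (induced_metric B A g)"
begin

abbreviation "GK \<equiv> G\<lparr>carrier := K\<rparr>"
abbreviation "inc \<equiv> tangent_map B A (\<lambda>q. q) \<one>"
abbreviation "D \<equiv> generated_distribution G A B"
abbreviation "kfield u p \<equiv> lfield (inc u) p"

lemma K_lie: "lie_group GK B" and K_smooth: "smooth_map B A (\<lambda>q. q)" and K_subgroup: "subgroup K G"
  using sub by (auto simp: lie_subgroup_def)

lemma K_manifold: "smooth_manifold B" and K_mcarrier: "mcarrier B = K"
  using K_lie by (auto simp: lie_group_def)

lemma one_K: "\<one> \<in> K" using K_subgroup by (rule subgroup.one_closed)

lemma K_carrier: "q \<in> K \<Longrightarrow> q \<in> carrier G"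
  using subgroup.subset[OF K_subgroup] by blast

lemma linear_inc: "linear inc"
  by (rule linear_tangent_map[OF K_smooth]) (simp add: K_mcarrier one_K)

text \<open>The derivative of the inclusion is itself an embedding of the model space of
  \<open>K\<close> into a Euclidean space, so it supplies the coordinates for
  \<open>K\<close>.\<close>

lemma coord_pair_inc: "\<exists>l. coord_pair inc l"
proof -
  have 1: "\<one> \<in> mcarrier B" "\<one> \<in> mcarrier A" by (auto simp: K_mcarrier one_K)
  have "bounded_linear inc"
    unfolding tangent_map_cderiv
    using has_derivative_cderiv[OF K_smooth chart_at(1)[OF 1(1)] chart_at(1)[OF 1(2)] chart_at(2)[OF 1(1)] chart_at(2)[OF 1(2)]]
    by (rule has_derivative_bounded_linear)
  moreover have "inj inc" using sub one_K by (auto simp: lie_subgroup_def)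
  then obtain l where l: "linear l" "l \<circ> inc = id"
    using linear_injective_left_inverse[OF linear_inc] by blast
  moreover from l have "bounded_linear l" "\<forall>x. l (inc x) = x"
    by (auto simp: linear_conv_bounded_linear fun_eq_iff)
  ultimately show ?thesis unfolding coord_pair_def by blast
qed

text \<open>For \<open>q\<close> in \<open>K\<close> the inclusion intertwines the left translations
  by \<open>q\<close> in \<open>K\<close> and in \<open>G\<close>; the chain rule for both
  composites gives the relation, and naturality of the bracket then makes \<open>inc\<close> a
  homomorphism.\<close>

lemma inc_kfield:
  assumes q: "q \<in> K"
  shows "tangent_map B A (\<lambda>q. q) q (left_invariant_field GK B u q) = lfield (inc u) q"
proof -
  obtain l where l: "coord_pair inc l" using coord_pair_inc by blast
  interpret K: lie_group_coord GK B inc l by unfold_locales (rule K_lie l)+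
  have "tangent_map B A (\<lambda>r. q \<otimes> r) \<one> u = tangent_map B A (\<lambda>q. q) (q \<otimes> \<one>) (tangent_map B B (\<lambda>r. q \<otimes> r) \<one> u)"
    using tangent_map_compose[OF K_manifold K_manifold K.smooth_map_left[of q] K_smooth, of \<one> u] q one_K by (simp add: K_mcarrier)
  moreover have "tangent_map B A (\<lambda>r. q \<otimes> r) \<one> u = tangent_map A A (\<lambda>r. q \<otimes> r) \<one> (inc u)"
    using tangent_map_compose[OF K_manifold group_manifold K_smooth smooth_map_left[OF K_carrier[OF q]], of \<one> u] one_K
    by (simp add: K_mcarrier)
  ultimately show ?thesis
    using K_carrier[OF q] by (simp add: left_invariant_field_def left_translate_def)
qed

lemma inc_bracket: "inc (lie_algebra_bracket GK B u v) = br (inc u) (inc v)"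
proof -
  obtain l where l: "coord_pair inc l" using coord_pair_inc by blast
  interpret K: lie_group_coord GK B inc l by unfold_locales (rule K_lie l)+
  have "tangent_map B A (\<lambda>q. q) \<one> (lie_bracket B (K.lfield u) (K.lfield v) \<one>)
    = lie_bracket A (lfield (inc u)) (lfield (inc v)) \<one>"
    by (rule lie_bracket_related[OF l coord K_manifold group_manifold K_smooth _ K.smooth_field_left K.smooth_field_left
          smooth_field_left smooth_field_left])
      (simp_all add: K_mcarrier one_K inc_kfield)
  then show ?thesis by (simp add: lie_algebra_bracket_def)
qed

lemma form: "positive_form (\<lambda>u v. g \<one> (inc u) (inc v))"
proof -
  have "bilinear (\<lambda>u v. g \<one> (inc u) (inc v))"
    by (rule bilinear_compose_linear[OF g_bilinear[OF one_closed] linear_inc])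
  moreover have "g \<one> (inc u) (inc u) > 0" if "u \<noteq> 0" for u
    using riem that one_K by (simp add: riemannian_metric_def induced_metric_def K_mcarrier)
  ultimately show ?thesis using g_sym[OF one_closed] by (simp add: positive_form_def)
qed

lemma orthonormal_basis_exists: "\<exists>E. orthonormal_basis (\<lambda>u v. g \<one> (inc u) (inc v)) E"
proof -
  obtain b :: "'k set" where "finite b" "span b = UNIV" using K_manifold by (auto simp: smooth_manifold_def)
  then show ?thesis by (rule positive_form_orthonormal_basis_exists[OF form])
qed

lemma linear_lfield: "p \<in> carrier G \<Longrightarrow> linear (\<lambda>u. lfield u p)"
  unfolding left_invariant_field_def using linear_left_translate[of p \<one>] by simp

text \<open>Left translations are isometries, so one orthonormal basis at the identity serves at
  every point.\<close>

lemma nondegenerate_subspace_at: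
  assumes p: "p \<in> carrier G" and E: "orthonormal_basis (\<lambda>u v. g \<one> (inc u) (inc v)) E"
  shows "nondegenerate_subspace (g p) (\<lambda>u. kfield u p) E"
proof (rule nondegenerate_subspace.intro)
  show "bilinear (g p)" by (rule g_bilinear[OF p])
  show "g p u v = g p v u" for u v by (rule g_sym[OF p])
  show "u = 0" if "\<And>v. g p u v = 0" for u using that by (rule g_nondeg[OF p])
  show "linear (\<lambda>u. kfield u p)"
    using linear_compose[OF linear_inc linear_lfield[OF p]] by (simp add: o_def)
  show "positive_form (\<lambda>u v. g p (kfield u p) (kfield v p))" "orthonormal_basis (\<lambda>u v. g p (kfield u p) (kfield v p)) E"
    unfolding g_lfield[OF p] by (rule form, rule E)
qed

lemma distribution: "D p = range (\<lambda>u. kfield u p)"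
  by (auto simp: generated_distribution_def subgroup_lie_algebra_def left_invariant_field_def)

lemma orthogonal_distribution_iff:
  "x \<in> orthogonal_distribution g D p \<longleftrightarrow> (\<forall>v. g p x (kfield v p) = 0)"
  by (auto simp: orthogonal_distribution_def distribution)

lemma orthogonal_lfield:
  assumes "\<And>v. g \<one> x (inc v) = 0"
  shows "smooth_section A (orthogonal_distribution g D) (lfield x)"
  using assms by (simp add: smooth_section_def smooth_field_left orthogonal_distribution_iff g_lfield)

text \<open>Pair the second fundamental form of \<H> with \<open>w\<close>. Metric compatibility
  shifts the derivative onto \<open>w\<close>, vanishing torsion trades it for a derivative along
  \<open>w\<close> and a bracket, and the derivatives along \<open>w\<close> cancel because
  \<open>g x y\<close> is constant.\<close>

lemma conformal_bracket:
  assumes conf: "conformal_foliation A g nabla D"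
  shows "\<exists>\<theta>. \<forall>w x y. (\<forall>v. g \<one> x (inc v) = 0) \<longrightarrow> (\<forall>v. g \<one> y (inc v) = 0) \<longrightarrow>
    g \<one> (br (inc w) x) y + g \<one> x (br (inc w) y) = \<theta> w * g \<one> x y"
proof -
  let ?H = "orthogonal_distribution g D"
  obtain V where V0: "\<forall>X Y. smooth_section A ?H X \<longrightarrow> smooth_section A ?H Y \<longrightarrow>
      (\<forall>p\<in>mcarrier A. second_fundamental_form nabla ?H D X Y p = g p (X p) (Y p) *\<^sub>R V p)"
    using conf unfolding conformal_foliation_def Let_def by blast
  have V: "second_fundamental_form nabla ?H D X Y \<one> = g \<one> (X \<one>) (Y \<one>) *\<^sub>R V \<one>"
    if "smooth_section A ?H X" "smooth_section A ?H Y" for X Y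
    using V0 that by simp
  obtain E where E: "orthonormal_basis (\<lambda>u v. g \<one> (inc u) (inc v)) E" using orthonormal_basis_exists by blast
  interpret N: nondegenerate_subspace "g \<one>" inc E
    using nondegenerate_subspace_at[OF one_closed E] by (simp add: lfield_one)
  have HN: "?H \<one> = N.H" by (auto simp: orthogonal_distribution_iff N.H_def lfield_one)
  have DN: "D \<one> = range inc" by (simp add: distribution lfield_one)
  have "g \<one> (br (inc w) x) y + g \<one> x (br (inc w) y) = (2 * g \<one> (V \<one>) (inc w)) * g \<one> x y"
    if x: "\<forall>v. g \<one> x (inc v) = 0" and y: "\<forall>v. g \<one> y (inc v) = 0" for w x y
  proof -
    let ?X = "lfield x" and ?Y = "lfield y" and ?W = "lfield (inc w)"
    let ?n = "nabla ?X ?Y \<one> + nabla ?Y ?X \<one>"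
    have "(1/2) *\<^sub>R inc (N.coord_K ?n) = g \<one> x y *\<^sub>R V \<one>"
      using V[OF orthogonal_lfield orthogonal_lfield, of x y] x y
      by (simp add: second_fundamental_form_def HN DN N.proj_along_range lfield_one)
    from arg_cong[OF this, of "\<lambda>z. 2 *\<^sub>R z"]
    have "inc (N.coord_K ?n) = 2 *\<^sub>R (g \<one> x y *\<^sub>R V \<one>)" by simp
    then have 1: "g \<one> ?n (inc w) = 2 * g \<one> x y * g \<one> (V \<one>) (inc w)"
      using N.coord_K_pair[of ?n w] by (simp add: bilinear_lmul[OF N.g_bil])
    have a: "g \<one> (nabla ?X ?Y \<one>) (inc w) + g \<one> y (nabla ?X ?W \<one>) = 0"
      "g \<one> (nabla ?Y ?X \<one>) (inc w) + g \<one> x (nabla ?Y ?W \<one>) = 0"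
      "g \<one> (nabla ?W ?X \<one>) y + g \<one> x (nabla ?W ?Y \<one>) = 0"
      using nabla_lfield_metric[OF smooth_field_left[of x] one_closed, of y "inc w"]
        nabla_lfield_metric[OF smooth_field_left[of y] one_closed, of x "inc w"]
        nabla_lfield_metric[OF smooth_field_left[of "inc w"] one_closed, of x y]
      by (simp_all add: lfield_one)
    have t: "nabla ?X ?W \<one> = nabla ?W ?X \<one> - br (inc w) x" "nabla ?Y ?W \<one> = nabla ?W ?Y \<one> - br (inc w) y"
      using nabla_lfield_torsion[OF one_closed, of x "inc w"] nabla_lfield_torsion[OF one_closed, of y "inc w"]
        br_antisym[of "inc w"] by (simp_all add: lfield_one)
    show ?thesis
      using 1 a unfolding t
      by (simp add: bilinear_ladd[OF N.g_bil] bilinear_rsub[OF N.g_bil] N.g_sym[of y] algebra_simps)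
  qed
  then show ?thesis by (intro exI[of _ "\<lambda>w. 2 * g \<one> (V \<one>) (inc w)"]) blast
qed

section \<open>From left-invariant fields to arbitrary sections\<close>

lemma section_expansion:
  assumes V: "smooth_section A D V" and q: "q \<in> carrier G"
    and E: "orthonormal_basis (\<lambda>u v. g \<one> (inc u) (inc v)) E"
  shows "V q = (\<Sum>e\<in>E. g q (V q) (kfield e q) *\<^sub>R kfield e q)"
proof -
  interpret N: nondegenerate_subspace "g q" "\<lambda>u. kfield u q" E by (rule nondegenerate_subspace_at[OF q E])
  have "V q \<in> D q" using V q by (simp add: smooth_section_def)
  then obtain u where u: "V q = kfield u q" by (auto simp: distribution)
  have "V q = kfield (\<Sum>e\<in>E. g q (kfield u q) (kfield e q) *\<^sub>R e) q"
    unfolding u using orthonormal_basis_expansion[OF N.form N.E, of u] by simp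
  then show ?thesis by (simp add: u linear_sum[OF N.\<iota>_linear] linear_cmul[OF N.\<iota>_linear])
qed

text \<open>The section is expanded only in the argument where the connection is linear over
  functions, so its coefficients are never differentiated.\<close>

lemma nabla_section_orthogonal:
  assumes V: "smooth_section A D V" and p: "p \<in> carrier G"
    and E: "orthonormal_basis (\<lambda>u v. g \<one> (inc u) (inc v)) E"
  shows "nabla V (lfield x) p = (\<Sum>e\<in>E. g p (V p) (kfield e p) *\<^sub>R nabla (lfield (inc e)) (lfield x) p)"
proof -
  have Vs: "smooth_field A V" using V by (simp add: smooth_section_def)
  have fin: "finite E" using E by (simp add: orthonormal_basis_def)
  have "nabla V (lfield x) p = nabla (\<lambda>q. \<Sum>e\<in>E. g q (V q) (kfield e q) *\<^sub>R kfield e q) (lfield x) p"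
    by (rule nabla_cong_left[OF Vs smooth_field_left p section_expansion[OF V _ E]])
  also have "\<dots> = (\<Sum>e\<in>E. g p (V p) (kfield e p) *\<^sub>R nabla (lfield (inc e)) (lfield x) p)"
    by (rule nabla_sum_left[OF fin smooth_function_metric[OF coord group_manifold metric Vs smooth_field_left] smooth_field_left smooth_field_left p])
  finally show ?thesis .
qed

text \<open>Tested against \<open>y\<close> in the complement, the form becomes a double sum of
  frame coefficients of \<open>V\<close> and \<open>W\<close> against terms that are antisymmetric
  in the two frame indices and vanish in total once symmetrised.\<close>

lemma totally_geodesic_if_skew:
  assumes skew: "\<And>x u v. (\<And>w. g \<one> x (inc w) = 0) \<Longrightarrow>
    g \<one> (br x (inc u)) (inc v) + g \<one> (inc u) (br x (inc v)) = 0"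
  shows "totally_geodesic_foliation A g nabla D"
  unfolding totally_geodesic_foliation_def Let_def
proof (intro allI impI ballI)
  let ?H = "orthogonal_distribution g D"
  fix V W p assume V: "smooth_section A D V" and W: "smooth_section A D W" and "p \<in> mcarrier A"
  then have p: "p \<in> carrier G" by simp
  obtain E where E: "orthonormal_basis (\<lambda>u v. g \<one> (inc u) (inc v)) E" using orthonormal_basis_exists by blast
  interpret N: nondegenerate_subspace "g p" "\<lambda>u. kfield u p" E by (rule nondegenerate_subspace_at[OF p E])
  have HN: "?H p = N.H" by (auto simp: orthogonal_distribution_iff N.H_def)
  let ?n = "nabla V W p + nabla W V p"
  have sm: "smooth_field A V" "smooth_field A W" using V W by (auto simp: smooth_section_def)
  have "g p ?n y = 0" if y: "y \<in> N.H" for y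
  proof -
    \<comment> \<open>Translating \<open>y\<close> back to the identity yields a left-invariant
      field through \<open>y\<close>; it is orthogonal to the distribution everywhere.\<close>
    define x where "x = lt (inv p) p y"
    let ?X = "lfield x"
    have Xp: "?X p = y" unfolding x_def left_invariant_field_def by (rule left_translate_inv(2)[OF p])
    have x: "g \<one> x (inc w) = 0" for w
      using y g_lfield[OF p, of x "inc w"] by (simp add: Xp N.H_def)
    have orth: "g q (U q) (?X q) = 0" if U: "smooth_section A D U" and q: "q \<in> carrier G" for U q
    proof -
      have "U q \<in> D q" using U q by (simp add: smooth_section_def)
      then obtain u where u: "U q = kfield u q" by (auto simp: distribution)
      show ?thesis unfolding u g_lfield[OF q] using x[of u] g_sym[OF one_closed] by simp
    qed
    \<comment> \<open>The products of sections with \<open>?X\<close> are constantly zero, which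
      moves the derivative from the sections to \<open>?X\<close>.\<close>
    have m: "g p (nabla V W p) y + g p (W p) (nabla V ?X p) = 0" "g p (nabla W V p) y + g p (V p) (nabla W ?X p) = 0"
      using metric_constant[OF sm(1) sm(2) smooth_field_left p orth[OF W]]
        metric_constant[OF sm(2) sm(1) smooth_field_left p orth[OF V]] by (simp_all add: Xp)
    define v where "v e = g p (V p) (kfield e p)" for e
    define w where "w e = g p (W p) (kfield e p)" for e
    let ?Z = "\<lambda>e. nabla (lfield (inc e)) ?X p"
    have "g p (W p) (nabla V ?X p) = (\<Sum>f\<in>E. w f *\<^sub>R g p (kfield f p) (\<Sum>e\<in>E. v e *\<^sub>R ?Z e))"
      unfolding nabla_section_orthogonal[OF V p E] v_def[symmetric]
      by (subst section_expansion[OF W p E]) (simp only: bilinear_sum_left[OF N.g_bil] w_def)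
    then have s1: "g p (W p) (nabla V ?X p) = (\<Sum>f\<in>E. \<Sum>e\<in>E. (w f * v e) * g p (kfield f p) (?Z e))"
      by (simp add: bilinear_sum_right[OF N.g_bil] sum_distrib_left mult.assoc)
    have "g p (V p) (nabla W ?X p) = (\<Sum>e\<in>E. v e *\<^sub>R g p (kfield e p) (\<Sum>f\<in>E. w f *\<^sub>R ?Z f))"
      unfolding nabla_section_orthogonal[OF W p E] w_def[symmetric]
      by (subst section_expansion[OF V p E]) (simp only: bilinear_sum_left[OF N.g_bil] v_def)
    then have "g p (V p) (nabla W ?X p) = (\<Sum>e\<in>E. \<Sum>f\<in>E. (w f * v e) * g p (kfield e p) (?Z f))"
      by (simp add: bilinear_sum_right[OF N.g_bil] sum_distrib_left mult_ac)
    then have s2: "g p (V p) (nabla W ?X p) = (\<Sum>f\<in>E. \<Sum>e\<in>E. (w f * v e) * g p (kfield e p) (?Z f))"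
      by (subst sum.swap)
    \<comment> \<open>Torsion splits \<open>?Z e\<close> into a derivative along \<open>?X\<close>,
      skew because frame products are constant, and a bracket with \<open>x\<close>, skew by
      assumption.\<close>
    have pair: "g p (kfield f p) (?Z e) + g p (kfield e p) (?Z f) = 0" for e f
    proof -
      have Z: "?Z e = nabla ?X (lfield (inc e)) p - lfield (br x (inc e)) p" for e
        using nabla_lfield_torsion[OF p, of x "inc e"] by simp
      have 1: "g p (nabla ?X (lfield (inc e)) p) (kfield f p) + g p (kfield e p) (nabla ?X (lfield (inc f)) p) = 0"
        by (rule nabla_lfield_metric[OF smooth_field_left p])
      have 2: "g \<one> (br x (inc e)) (inc f) + g \<one> (inc e) (br x (inc f)) = 0" by (rule skew[OF x])
      show ?thesis
        unfolding Z bilinear_rsub[OF N.g_bil] g_lfield[OF p]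
        using 1 2 N.g_sym[of "kfield f p"] g_sym[OF one_closed, of "inc f"] by simp
    qed
    have "g p (W p) (nabla V ?X p) + g p (V p) (nabla W ?X p) = 0"
      unfolding s1 s2 sum.distrib[symmetric] distrib_left[symmetric] pair by simp
    then show "g p ?n y = 0" using m by (simp add: bilinear_ladd[OF N.g_bil])
  qed
  then have "proj_along N.H (range (\<lambda>u. kfield u p)) ?n = 0" by (rule N.proj_along_H_eq_0)
  then show "second_fundamental_form nabla D ?H V W p = 0"
    by (simp add: second_fundamental_form_def HN distribution)
qed

end

theorem mainTheorem3:
  fixes G :: "'a monoid"
    and A :: "('a, 'e::euclidean_space) chart set"
    and g :: "'a \<Rightarrow> 'e \<Rightarrow> 'e \<Rightarrow> real"
    and nabla :: "('a \<Rightarrow> 'e) \<Rightarrow> ('a \<Rightarrow> 'e) \<Rightarrow> 'a \<Rightarrow> 'e"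
    and K :: "'a set"
    and B :: "('a, 'k::real_normed_vector) chart set"
  assumes "lie_group G A"
    and "semi_riemannian_metric A g"
    and "left_invariant_metric G A g"
    and "levi_civita_connection A g nabla"
    and "lie_subgroup K B G A"
    and "semisimple_lie_group (G\<lparr>carrier := K\<rparr>) B"
    and "dim (UNIV :: 'e set) = dim (UNIV :: 'k set) + 2"
    and "conformal_foliation A g nabla (generated_distribution G A B)"
    and "compact_space (manifold_topology B)"
    and "riemannian_metric B (induced_metric B A g)"
    and "biinvariant_metric (G\<lparr>carrier := K\<rparr>) B (induced_metric B A g)"
  shows "totally_geodesic_foliation A g nabla (generated_distribution G A B)"
proof -
  interpret lie_subgroup_metric G A g nabla K B
    by unfold_locales (use assms coord_pair_id in auto)
  obtain l where l: "coord_pair inc l" using coord_pair_inc by blast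
  \<comment> \<open>The subgroup with the induced metric is itself a Lie group with an invariant
    metric, so \<open>ad_invariant\<close> applies to it.\<close>
  interpret K: lie_group_metric GK B inc l "induced_metric B A g"
    by unfold_locales (use assms K_lie l in \<open>auto simp: riemannian_metric_def biinvariant_metric_def\<close>)
  obtain E where E: "orthonormal_basis (\<lambda>u v. g \<one>\<^bsub>G\<^esub> (inc u) (inc v)) E" using orthonormal_basis_exists by blast
  obtain \<theta> where \<theta>: "\<And>w x y. (\<forall>v. g \<one>\<^bsub>G\<^esub> x (inc v) = 0) \<Longrightarrow> (\<forall>v. g \<one>\<^bsub>G\<^esub> y (inc v) = 0) \<Longrightarrow>
      g \<one>\<^bsub>G\<^esub> (br (inc w) x) y + g \<one>\<^bsub>G\<^esub> x (br (inc w) y) = \<theta> w * g \<one>\<^bsub>G\<^esub> x y"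
    using conformal_bracket[OF assms(8)] by blast
  interpret N: nondegenerate_subspace "g \<one>\<^bsub>G\<^esub>" inc E
    using nondegenerate_subspace_at[OF one_closed E] by (simp add: lfield_one)
  interpret C: conformal_subalgebra K.br "g \<one>\<^bsub>G\<^esub>" inc E br \<theta>
  proof (intro conformal_subalgebra.intro N.nondegenerate_subspace_axioms invariant_lie_algebra.intro
      conformal_subalgebra_axioms.intro)
    show "linear (K.br u)" for u by (rule K.linear_br_right)
    show "K.br u v = - K.br v u" for u v by (rule K.br_antisym)
    show "K.br (K.br u v) w + K.br (K.br v w) u + K.br (K.br w u) v = 0" for u v w by (rule K.br_jacobi)
    show "positive_form (\<lambda>u v. g \<one>\<^bsub>G\<^esub> (inc u) (inc v))" by (rule form)
    \<comment> \<open>Right invariance is the half of biinvariance that turns left-invariant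
      products into ad-invariance.\<close>
    have "right_invariant_metric GK B (induced_metric B A g)" using assms(11) by (simp add: biinvariant_metric_def)
    from K.ad_invariant[OF this]
    show "g \<one>\<^bsub>G\<^esub> (inc (K.br u v)) (inc w) + g \<one>\<^bsub>G\<^esub> (inc v) (inc (K.br u w)) = 0" for u v w
      by (simp add: induced_metric_def)
    show "finite E" "span E = UNIV" using E by (auto simp: orthonormal_basis_def)
    show "semisimple_lie K.br" using assms(6) by (simp add: semisimple_lie_group_def)
    show "linear (br u)" for u by (rule linear_br_right)
    show "br u v = - br v u" for u v by (rule br_antisym)
    show "br (br u v) w + br (br v w) u + br (br w u) v = 0" for u v w by (rule br_jacobi)
    show "inc (K.br u v) = br (inc u) (inc v)" for u v by (rule inc_bracket)
    show "dim (UNIV :: 'e set) = dim (UNIV :: 'k set) + 2" by (rule assms(7))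
    show "g \<one>\<^bsub>G\<^esub> (br (inc w) x) y + g \<one>\<^bsub>G\<^esub> x (br (inc w) y) = \<theta> w * g \<one>\<^bsub>G\<^esub> x y"
      if "x \<in> N.H" "y \<in> N.H" for w x y
      using that by (intro \<theta>) (simp_all add: N.H_def)
  qed
  show ?thesis
    by (rule totally_geodesic_if_skew, rule C.complement_skew) (simp add: N.H_def)
qed

end
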